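(* Let $n$ nodes run the algorithm GT-HSGD (defined in the context) with an arbitrary initial minibatch size $b_0\ge 1$, under the oracle, global-function and network assumptions listed in the context. Suppose the weight parameter is $\beta=\frac{48L^2\alpha^2}{n}$ and the step-size $\alpha$ satisfies $$0<\alpha<\min\left\{\frac{(1-\lambda^2)^2}{90\lambda^2},\ \frac{\sqrt{n(1-\lambda)}}{26\lambda},\ \frac{1}{4\sqrt3}\right\}\frac1L .$$ Then for every integer $T\ge 2$ the output $\widetilde{x}_T$ of GT-HSGD satisfies $$\mathbb{E}\big[\|\nabla F(\widetilde{x}_T)\|^2\big]\le \frac{4(F(\overline{x}_0)-F^* )}{\alpha T}+\frac{8\beta\overline{\nu}^2}{n}+\frac{4\overline{\nu}^2}{\beta b_0 nT}+\frac{64\lambda^4\|\nabla \mathbf{f}(x_0)\|^2}{(1-\lambda^2)^3nT}+\frac{96\lambda^2\overline{\nu}^2}{(1-\lambda^2)^3b_0T}+\frac{256\lambda^2\beta^2\overline{\nu}^2}{(1-\lambda^2)^3},$$ where $\|\nabla\mathbf{f}(x_0)\|^2=\sum_{i=1}^n\|\nabla f_i(\overline{x}_0)\|^2$.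
   Context: Setting. There are $n\ge1$ nodes $\mathcal{V}=\{1,\dots,n\}$; node $i$ has a differentiable (possibly non-convex) cost $f_i:\mathbb{R}^p\to\mathbb{R}$, and $F=\frac1n\sum_{i=1}^n f_i$. $\|\cdot\|$ is the Euclidean norm (spectral norm for matrices). Oracle. On a probability space, node $i$ observes at iteration $t\ge0$ a random vector $\xi_t^i\in\mathbb{R}^q$; $\mathcal{F}_0$ is the trivial $\sigma$-algebra and $\mathcal{F}_t=\sigma(\{\xi_0^i,\dots,\xi_{t-1}^i:i\in\mathcal{V}\})$ for $t\ge1$. There are Borel measurable maps $g_i:\mathbb{R}^p\times\mathbb{R}^q\to\mathbb{R}^p$ and constants $L>0$, $\nu_i\ge0$ such that for all $i\in\mathcal{V}$, $t\ge0$ and all $\mathcal{F}_t$-measurable random vectors $x,y\in\mathbb{R}^p$: (1) $\mathbb{E}[g_i(x,\xi_t^i)\mid\mathcal{F}_t]=\nabla f_i(x)$; (2) $\mathbb{E}[\|g_i(x,\xi_t^i)-\nabla f_i(x)\|^2]\le\nu_i^2$, and $\overline{\nu}^2:=\frac1n\sum_{i=1}^n\nu_i^2$; (3) the family $\{\xi_t^i:t\ge0,i\in\mathcal{V}\}$ is independent; (4) $\mathbb{E}[\|g_i(x,\xi_t^i)-g_i(y,\xi_t^i)\|^2]\le L^2\,\mathbb{E}[\|x-y\|^2]$. At $t=0$ node $i$ draws a minibatch $\xi_{0,1}^i,\dots,\xi_{0,b_0}^i$ (playing the role of $\xi_0^i$ in $\mathcal F_t$); each $\xi_{0,r}^i$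 satisfies (1),(2),(4) in place of $\xi_0^i$, and all the $\xi_{0,r}^i$ and $\xi_t^i$ ($t\ge1$) are independent. Global function. $F^*:=\inf_{x\in\mathbb{R}^p}F(x)>-\infty$. Network. $\underline{W}=(\underline{w}_{ij})\in\mathbb{R}^{n\times n}$ is a primitive doubly stochastic (nonnegative) matrix and $\lambda:=\|\underline{W}-\frac1n\mathbf{1}_n\mathbf{1}_n^\top\|\in[0,1)$. An upper bound of the form $c/\lambda$ or $c/\lambda^2$ with $c>0$ is read as $+\infty$ when $\lambda=0$. Algorithm GT-HSGD (step-size $\alpha>0$, weight $\beta\in[0,1]$, initial minibatch size $b_0\ge1$, horizon $T$). Initialize $x_0^i=\overline{x}_0\in\mathbb{R}^p$ (deterministic, the same for all $i$), $y_0^i=0$, $v_{-1}^i=0$, $v_0^i=\frac1{b_0}\sum_{r=1}^{b_0}g_i(x_0^i,\xi_{0,r}^i)$. For $t\ge1$, $v_t^i=g_i(x_t^i,\xi_t^i)+(1-\beta)\big(v_{t-1}^i-g_i(x_{t-1}^i,\xi_t^i)\big)$. For all $t\ge0$, $y_{t+1}^i=\sum_{j=1}^n\underline{w}_{ij}(y_t^j+v_t^j-v_{t-1}^j)$ and $x_{t+1}^i=\sum_{j=1}^n\underline{w}_{ij}(x_t^j-\alpha y_{t+1}^j)$. The output $\widetilde{x}_T$ is selected uniformly at random (independently of everything else) from $\{x_t^i:0\le t\le T,\ i\in\mathcal{V}\}$. *)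

theory Defs
  imports "HOL-Probability.Probability"
begin

definition gradient :: "('a::real_inner \<Rightarrow> real) \<Rightarrow> 'a \<Rightarrow> 'a" where
  "gradient h x = (THE D. GDERIV h x :> D)"

definition global_cost :: "('n::finite \<Rightarrow> 'a \<Rightarrow> real) \<Rightarrow> 'a \<Rightarrow> real" where
  "global_cost f x = (1 / real CARD('n)) * (\<Sum>i\<in>UNIV. f i x)"

definition doubly_stochastic :: "real^'n^'n \<Rightarrow> bool" where
  "doubly_stochastic W \<longleftrightarrow>
     (\<forall>i j. 0 \<le> W $ i $ j) \<and>
     (\<forall>i. (\<Sum>j\<in>UNIV. W $ i $ j) = 1) \<and>
     (\<forall>j. (\<Sum>i\<in>UNIV. W $ i $ j) = 1)"

(* The multiplicative power of matrices is iterated by hand, since multiplication on the vector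
   type is componentwise. *)
definition primitive_matrix :: "real^'n^'n \<Rightarrow> bool" where
  "primitive_matrix W \<longleftrightarrow>
     (\<forall>i j. 0 \<le> W $ i $ j) \<and>
     (\<exists>k\<ge>1. \<forall>i j. 0 < (((\<lambda>B. W ** B) ^^ k) (mat 1)) $ i $ j)"

definition spectral_norm :: "real^'n^'m \<Rightarrow> real" where
  "spectral_norm A = onorm (\<lambda>v. A *v v)"

definition mixing_rate :: "real^'n^'n \<Rightarrow> real" where
  "mixing_rate W = spectral_norm (W - (\<chi> i j. 1 / real CARD('n)))"

(* The division is the one of ereal, where c / 0 = \<infinity> for c > 0; so for lam = 0 the first two
   bounds impose no restriction. *)
definition step_size_bound :: "nat \<Rightarrow> real \<Rightarrow> real \<Rightarrow> ereal" where
  "step_size_bound n lam L =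
     min (ereal ((1 - lam\<^sup>2)\<^sup>2) / ereal (90 * lam\<^sup>2))
       (min (ereal (sqrt (real n * (1 - lam))) / ereal (26 * lam))
            (ereal (1 / (4 * sqrt 3))))
     * ereal (1 / L)"

(* A sample array \<xi> t r i has time t, position r in the minibatch drawn at time t, and node i.
   The minibatch has size b0 at time 0 and size 1 later. *)
definition sample_index :: "nat \<Rightarrow> (nat \<times> nat \<times> 'n) set" where
  "sample_index b0 = {(t, r, i). r \<in> {1..(if t = 0 then b0 else 1)}}"

definition sample_algebra ::
  "'w measure \<Rightarrow> (nat \<Rightarrow> nat \<Rightarrow> 'n \<Rightarrow> 'w \<Rightarrow> 'b::topological_space)
     \<Rightarrow> (nat \<times> nat \<times> 'n) set \<Rightarrow> 'w measure" where
  "sample_algebra M \<xi> I =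
     sigma (space M) (\<Union>(t, r, i)\<in>I. {\<xi> t r i -` A \<inter> space M | A. A \<in> sets borel})"

definition history ::
  "'w measure \<Rightarrow> nat \<Rightarrow> (nat \<Rightarrow> nat \<Rightarrow> 'n \<Rightarrow> 'w \<Rightarrow> 'b::topological_space)
     \<Rightarrow> nat \<Rightarrow> 'w measure" where
  "history M b0 \<xi> t = sample_algebra M \<xi> {(s, r, i) \<in> sample_index b0. s < t}"

(* Conditional expectations of vectors are taken componentwise.  Second moments are values in
   [0, \<infinity>], since x and y need not be square integrable.  The variance bound makes
   g (x, s) - \<nabla>h(x) square integrable, so the conditional expectation of g (x, s) given G exists
   (in the generalized sense when \<nabla>h(x) is not integrable) and is the one computed by
   real_cond_exp. *)
definition unbiased_oracle ::
  "'w measure \<Rightarrow> 'w measure \<Rightarrow> (real^'p \<Rightarrow> real)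
     \<Rightarrow> (real^'p \<Rightarrow> 'b \<Rightarrow> real^'p) \<Rightarrow> ('w \<Rightarrow> 'b) \<Rightarrow> bool" where
  "unbiased_oracle M G h g s \<longleftrightarrow>
     (\<forall>x \<in> borel_measurable G. \<forall>k.
        AE \<omega> in M. real_cond_exp M G (\<lambda>\<omega>. g (x \<omega>) (s \<omega>) $ k) \<omega> = gradient h (x \<omega>) $ k)"

definition bounded_variance_oracle ::
  "'w measure \<Rightarrow> 'w measure \<Rightarrow> (real^'p \<Rightarrow> real)
     \<Rightarrow> (real^'p \<Rightarrow> 'b \<Rightarrow> real^'p) \<Rightarrow> real \<Rightarrow> ('w \<Rightarrow> 'b) \<Rightarrow> bool" where
  "bounded_variance_oracle M G h g \<nu> s \<longleftrightarrow>
     (\<forall>x \<in> borel_measurable G.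
        (\<integral>\<^sup>+\<omega>. ennreal ((norm (g (x \<omega>) (s \<omega>) - gradient h (x \<omega>)))\<^sup>2) \<partial>M) \<le> ennreal (\<nu>\<^sup>2))"

definition mean_square_smooth_oracle ::
  "'w measure \<Rightarrow> 'w measure \<Rightarrow> (real^'p \<Rightarrow> 'b \<Rightarrow> real^'p)
     \<Rightarrow> real \<Rightarrow> ('w \<Rightarrow> 'b) \<Rightarrow> bool" where
  "mean_square_smooth_oracle M G g L s \<longleftrightarrow>
     (\<forall>x \<in> borel_measurable G. \<forall>y \<in> borel_measurable G.
        (\<integral>\<^sup>+\<omega>. ennreal ((norm (g (x \<omega>) (s \<omega>) - g (y \<omega>) (s \<omega>)))\<^sup>2) \<partial>M)
          \<le> ennreal (L\<^sup>2) * (\<integral>\<^sup>+\<omega>. ennreal ((norm (x \<omega> - y \<omega>))\<^sup>2) \<partial>M))"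

(* The iterates are defined along one realization z of the sample array. *)
context
  fixes W :: "real^'n^'n"
    and g :: "'n \<Rightarrow> real^'p \<Rightarrow> 'b \<Rightarrow> real^'p"
    and \<alpha> \<beta> :: real
    and b0 :: nat
    and x0 :: "real^'p"
    and z :: "nat \<Rightarrow> nat \<Rightarrow> 'n \<Rightarrow> 'b"
begin

fun hsgd_x :: "nat \<Rightarrow> 'n \<Rightarrow> real^'p"
  and hsgd_y :: "nat \<Rightarrow> 'n \<Rightarrow> real^'p"
  and hsgd_v :: "nat \<Rightarrow> 'n \<Rightarrow> real^'p" where
  "hsgd_x 0 i = x0"
| "hsgd_x (Suc t) i =
     (\<Sum>j\<in>UNIV. W $ i $ j *\<^sub>R (hsgd_x t j - \<alpha> *\<^sub>R hsgd_y (Suc t) j))"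
| "hsgd_y 0 i = 0"
| "hsgd_y (Suc t) i =
     (\<Sum>j\<in>UNIV. W $ i $ j *\<^sub>R
        (hsgd_y t j + hsgd_v t j - (case t of 0 \<Rightarrow> 0 | Suc s \<Rightarrow> hsgd_v s j)))"
| "hsgd_v 0 i = (1 / real b0) *\<^sub>R (\<Sum>r = 1..b0. g i (hsgd_x 0 i) (z 0 r i))"
| "hsgd_v (Suc t) i =
     g i (hsgd_x (Suc t) i) (z (Suc t) 1 i)
       + (1 - \<beta>) *\<^sub>R (hsgd_v t i - g i (hsgd_x t i) (z (Suc t) 1 i))"

end

end

theory Submission
  imports Defs
begin

text \<open>
  The iterates at time \<open>t\<close> are functions of the samples drawn before \<open>t\<close>, which are independent of
  those drawn at time \<open>t\<close>. Hence the oracle assumptions are needed only for deterministic arguments,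
  and Fubini's theorem turns them into statements about the iterates. With the noise
  \<open>n\<^sub>i = (g\<^sub>i(x\<^sub>t, \<xi>\<^sub>t) - \<nabla>f\<^sub>i(x\<^sub>t)) - (1 - \<beta>) (g\<^sub>i(x\<^sub>t\<^sub>-\<^sub>1, \<xi>\<^sub>t) - \<nabla>f\<^sub>i(x\<^sub>t\<^sub>-\<^sub>1))\<close>, the estimator error
  \<open>e\<^sub>t = v\<^sub>t - \<nabla>f(x\<^sub>t)\<close> satisfies \<open>e\<^sub>t = (1 - \<beta>) e\<^sub>t\<^sub>-\<^sub>1 + n\<close>, and
  \<open>v\<^sub>t - v\<^sub>t\<^sub>-\<^sub>1 = \<nabla>f(x\<^sub>t) - \<nabla>f(x\<^sub>t\<^sub>-\<^sub>1) - \<beta> e\<^sub>t\<^sub>-\<^sub>1 + n\<close>. The components of \<open>n\<close> are centred and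
  uncorrelated given the past, so one orthogonality lemma yields geometric recursions for the mean
  squares of the averaged error, of the local errors and of the tracking deviation. Summed over time
  and combined with the contraction of the consensus error, they are absorbed by the term
  \<open>- \<parallel>avg v\<^sub>t\<parallel>\<^sup>2\<close> that the descent inequality provides. The descent inequality is summed before
  taking expectations, so the cost itself never has to be integrable.
\<close>

subsection \<open>Averages, mixing and gradients\<close>

text \<open>The error recursions form a loop: increments are bounded by the averaged estimator and
  the consensus errors, these by the tracking deviations, and those by increments and local errors,
  which are driven by increments again. No recursion closes on its own, so all sums over time are
  carried together and the loop is broken by constants. The weight \<beta> is tuned so that
  \<open>2 * L^2 / (\<beta> * n^2) = 1 / (24 * \<alpha>^2 * n)\<close>; four times the averaged
  error then costs one sixth of \<open>SG / (n * \<alpha>^2)\<close>, hence one sixth of the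
  negative term plus consensus errors. The step-size bound with 90 lets at most 1/72 of the
  increment sum return to the consensus sum. The bound \<open>1 / (4 * sqrt 3)\<close> yields
  \<open>\<beta> \<le> 1\<close> and makes the consensus term of the descent inequality at most one
  eighth of \<open>SC / (n * \<alpha>^2)\<close>.

  No gradient is assumed to be Lipschitz: this is derived from the mean-square smoothness of the
  samples, and it also supplies the measurability and the linear growth that keep all iterates
  square integrable.\<close>

lemma norm_sq_add: "(norm (a + b))\<^sup>2 = (norm a)\<^sup>2 + 2 * (a \<bullet> b) + (norm b)\<^sup>2"
  for a b :: "'a::real_inner"
  by (simp add: power2_norm_eq_inner inner_simps inner_commute)

lemma norm_sq_add_le: "(norm (a + b))\<^sup>2 \<le> 2 * (norm a)\<^sup>2 + 2 * (norm b)\<^sup>2"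
  for a b :: "'a::real_inner"
proof -
  have "0 \<le> (norm (a - b))\<^sup>2" by simp
  then show ?thesis by (simp add: power2_norm_eq_inner inner_simps inner_commute)
qed

lemma norm_sq_diff_le: "(norm (a - b))\<^sup>2 \<le> 2 * (norm a)\<^sup>2 + 2 * (norm b)\<^sup>2"
  for a b :: "'a::real_inner"
  using norm_sq_add_le[of a "- b"] by simp

text \<open>Young's inequality with parameter \<open>(1 - lam^2) / (2 * lam^2)\<close>: the rate
  moves from \<open>lam^2\<close> halfway to 1, at the price of a gap factor on the perturbation
  \<open>b\<close>. Completing the square after multiplication by \<open>2 * q\<close> avoids that
  parameter, so \<open>lam = 0\<close> is no special case.\<close>

lemma contraction_young:
  fixes a b :: "'a::real_inner" and lam :: real
  assumes "0 \<le> lam" "lam < 1"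
  shows "lam\<^sup>2 * (norm (a + b))\<^sup>2
      \<le> (1 + lam\<^sup>2) / 2 * (norm a)\<^sup>2 + 2 * lam\<^sup>2 / (1 - lam\<^sup>2) * (norm b)\<^sup>2"
proof -
  define q where "q = 1 - lam\<^sup>2"
  have q: "0 < q" "q \<le> 1" using assms by (auto simp: q_def power_less_one_iff)
  have l: "lam\<^sup>2 = 1 - q" by (simp add: q_def)
  define A B c where "A = a \<bullet> a" and "B = b \<bullet> b" and "c = a \<bullet> b"
  have sum: "(norm (a + b))\<^sup>2 = A + 2 * c + B" "(norm a)\<^sup>2 = A" "(norm b)\<^sup>2 = B"
    by (simp_all add: A_def B_def c_def power2_norm_eq_inner inner_simps inner_commute)
  have "(norm (q *\<^sub>R a - (2 * (1 - q)) *\<^sub>R b))\<^sup>2 = q\<^sup>2 * A - 4 * q * (1 - q) * c + 4 * (1 - q)\<^sup>2 * B"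
    unfolding power2_norm_eq_inner
    by (simp add: A_def B_def c_def inner_simps inner_commute algebra_simps power2_eq_square)
  then have "0 \<le> q\<^sup>2 * A - 4 * q * (1 - q) * c + 4 * (1 - q)\<^sup>2 * B" by (metis zero_le_power2)
  \<comment> \<open>The slack gained by replacing \<open>1 + lam^2\<close> with 2 in the coefficient
    of \<open>b\<close>.\<close>
  moreover have "0 \<le> 2 * (1 - q) * q * B" using q by (simp add: B_def)
  ultimately have "2 * q * ((1 - q) * (norm (a + b))\<^sup>2) \<le> q * (2 - q) * (norm a)\<^sup>2 + 4 * (1 - q) * (norm b)\<^sup>2"
    unfolding sum by (simp add: algebra_simps power2_eq_square)
  also have "\<dots> = 2 * q * ((2 - q) / 2 * (norm a)\<^sup>2 + 2 * (1 - q) / q * (norm b)\<^sup>2)"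
    using q by (simp add: field_simps)
  finally show ?thesis using q unfolding l by simp
qed

section \<open>Averages over the nodes and deviations from them\<close>

definition avg :: "('n::finite \<Rightarrow> 'a::real_vector) \<Rightarrow> 'a" where
  "avg u = (1 / real CARD('n)) *\<^sub>R (\<Sum>i\<in>UNIV. u i)"

definition spread :: "('n::finite \<Rightarrow> 'a::real_inner) \<Rightarrow> real" where
  "spread u = (\<Sum>i\<in>UNIV. (norm (u i - avg u))\<^sup>2)"

lemma avg_add: "avg (\<lambda>i. u i + v i) = avg u + avg v"
  and avg_diff: "avg (\<lambda>i. u i - v i) = avg u - avg v"
  and avg_scaleR: "avg (\<lambda>i. c *\<^sub>R u i) = c *\<^sub>R avg u"
  by (simp_all add: avg_def sum.distrib sum_subtractf scaleR_right_distrib scaleR_right_diff_distrib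
      scaleR_sum_right[symmetric] mult.commute)

lemma avg_const [simp]: "avg (\<lambda>i::'n::finite. c) = c"
  by (simp add: avg_def sum_constant_scaleR)

lemma sum_eq_avg: "(\<Sum>i\<in>UNIV. u i) = real CARD('n) *\<^sub>R avg u" for u :: "'n::finite \<Rightarrow> 'a::real_vector"
  by (simp add: avg_def)

text \<open>Pythagoras: the deviations sum to zero, hence are orthogonal to the constant family with
  value \<open>avg u\<close>.\<close>

lemma sum_norm_sq_decomp:
  fixes u :: "'n::finite \<Rightarrow> 'a::real_inner"
  shows "(\<Sum>i\<in>UNIV. (norm (u i))\<^sup>2) = spread u + real CARD('n) * (norm (avg u))\<^sup>2"
proof -
  have "(norm (u i))\<^sup>2 = (norm (u i - avg u))\<^sup>2 + 2 * (u i \<bullet> avg u) - (norm (avg u))\<^sup>2" for i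
    by (simp add: power2_norm_eq_inner inner_simps inner_commute)
  then have "(\<Sum>i\<in>UNIV. (norm (u i))\<^sup>2)
      = spread u + 2 * ((\<Sum>i\<in>UNIV. u i) \<bullet> avg u) - real CARD('n) * (norm (avg u))\<^sup>2"
    by (simp add: spread_def sum.distrib sum_subtractf sum_distrib_left[symmetric] inner_sum_left)
  then show ?thesis by (simp add: sum_eq_avg power2_norm_eq_inner)
qed

lemma spread_nonneg: "0 \<le> spread u"
  by (simp add: spread_def sum_nonneg)

lemma spread_const [simp]: "spread (\<lambda>i. c) = 0"
  by (simp add: spread_def)

lemma spread_diff_le: "spread (\<lambda>i. u i - v i) \<le> 2 * spread u + 2 * spread v"
proof -
  have "(norm (u i - v i - (avg u - avg v)))\<^sup>2 \<le> 2 * (norm (u i - avg u))\<^sup>2 + 2 * (norm (v i - avg v))\<^sup>2" for i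
    using norm_sq_diff_le[of "u i - avg u" "v i - avg v"] by (simp add: algebra_simps)
  then show ?thesis
    by (simp add: spread_def avg_diff sum.distrib[symmetric] sum_distrib_left sum_mono)
qed

lemma norm_avg_sq_le:
  fixes u :: "'n::finite \<Rightarrow> 'a::real_inner"
  shows "(norm (avg u))\<^sup>2 \<le> (\<Sum>i\<in>UNIV. (norm (u i))\<^sup>2) / real CARD('n)"
  using sum_norm_sq_decomp[of u] spread_nonneg[of u] by (simp add: field_simps)

section \<open>Matrices acting on families of vectors\<close>

definition mix :: "real^'n^'n \<Rightarrow> ('n::finite \<Rightarrow> 'a::real_vector) \<Rightarrow> 'n \<Rightarrow> 'a" where
  "mix A u i = (\<Sum>j\<in>UNIV. A $ i $ j *\<^sub>R u j)"

lemma mix_add: "mix A (\<lambda>j. u j + v j) i = mix A u i + mix A v i"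
  and mix_diff: "mix A (\<lambda>j. u j - v j) i = mix A u i - mix A v i"
  by (simp_all add: mix_def sum.distrib sum_subtractf scaleR_right_distrib scaleR_right_diff_distrib)

lemma norm_matrix_vector_le: "norm (A *v v) \<le> spectral_norm A * norm v"
  unfolding spectral_norm_def by (rule onorm[OF matrix_vector_mul_bounded_linear])

lemma norm_vec_sq: "(norm (v :: real^'n))\<^sup>2 = (\<Sum>i\<in>UNIV. (v $ i)\<^sup>2)"
  by (simp add: norm_vec_def L2_set_def sum_nonneg)

text \<open>The operator on families of vectors is the Kronecker product of \<open>A\<close> with an
  identity, so it has the norm of \<open>A\<close>: every coordinate \<open>k\<close> is transformed
  by \<open>A\<close> separately, and the sums over nodes and coordinates are exchanged.\<close>

lemma sum_norm_sq_mix_le: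
  fixes u :: "'n::finite \<Rightarrow> real^'p"
  shows "(\<Sum>i\<in>UNIV. (norm (mix A u i))\<^sup>2) \<le> (spectral_norm A)\<^sup>2 * (\<Sum>j\<in>UNIV. (norm (u j))\<^sup>2)"
proof -
  define w where "w k = (\<chi> j. u j $ k)" for k
  have "mix A u i $ k = (A *v w k) $ i" for i k
    by (simp add: mix_def w_def matrix_vector_mult_def)
  then have "(\<Sum>i\<in>UNIV. (norm (mix A u i))\<^sup>2) = (\<Sum>k\<in>UNIV. (norm (A *v w k))\<^sup>2)"
    unfolding norm_vec_sq by (subst sum.swap) simp
  also have "\<dots> \<le> (\<Sum>k\<in>UNIV. (spectral_norm A)\<^sup>2 * (norm (w k))\<^sup>2)"
    by (intro sum_mono) (metis norm_matrix_vector_le norm_ge_zero power_mono power_mult_distrib)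
  also have "\<dots> = (spectral_norm A)\<^sup>2 * (\<Sum>j\<in>UNIV. (norm (u j))\<^sup>2)"
    unfolding norm_vec_sq sum_distrib_left[symmetric] by (subst sum.swap) (simp add: w_def)
  finally show ?thesis .
qed

text \<open>Column \<open>j\<close> is the image of a unit vector. This controls the noise of one
  node once \<open>A\<close> has distributed it to all of them.\<close>

lemma column_norm_sq_le: "(\<Sum>i\<in>UNIV. (A $ i $ j)\<^sup>2) \<le> (spectral_norm (A :: real^'n^'n))\<^sup>2"
proof -
  have "(norm (A *v axis j 1))\<^sup>2 \<le> (spectral_norm A)\<^sup>2"
    using norm_matrix_vector_le[of A "axis j 1"] by (simp add: norm_axis_1 power_mono)
  then show ?thesis by (simp add: norm_vec_sq matrix_vector_mult_basis column_def)
qed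

definition deviation_matrix :: "real^'n^'n \<Rightarrow> real^'n^'n" where
  "deviation_matrix W = W - (\<chi> i j. 1 / real CARD('n))"

lemma mixing_rate_eq: "mixing_rate W = spectral_norm (deviation_matrix W)"
  by (simp add: mixing_rate_def deviation_matrix_def)

context
  fixes W :: "real^'n^'n"
  assumes ds: "doubly_stochastic W"
begin

lemma avg_mix: "avg (mix W u) = avg u"
proof -
  have "(\<Sum>i\<in>UNIV. mix W u i) = (\<Sum>j\<in>UNIV. (\<Sum>i\<in>UNIV. W $ i $ j) *\<^sub>R u j)"
    unfolding mix_def by (subst sum.swap) (simp add: scaleR_sum_left)
  then show ?thesis using ds by (simp add: avg_def doubly_stochastic_def)
qed

lemma mix_deviation: "mix (deviation_matrix W) u i = mix W u i - avg u"
  by (simp add: mix_def deviation_matrix_def avg_def scaleR_diff_left sum_subtractf scaleR_sum_right)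

text \<open>The rows of \<open>W\<close> and of the averaging matrix both sum to 1, so constants are
  annihilated; any common vector may be subtracted before the contraction is applied.\<close>

lemma mix_deviation_const: "mix (deviation_matrix W) (\<lambda>j. u j - c) i = mix (deviation_matrix W) u i"
proof -
  have "mix W (\<lambda>j. c) i = c"
    using ds by (simp add: mix_def scaleR_sum_left[symmetric] doubly_stochastic_def)
  then show ?thesis by (simp add: mix_deviation mix_diff avg_diff)
qed

lemma spread_mix: "spread (mix W u) = (\<Sum>i\<in>UNIV. (norm (mix (deviation_matrix W) u i))\<^sup>2)"
  by (simp add: spread_def avg_mix mix_deviation)

text \<open>Only \<open>u\<close> is centred by its mean, which produces \<open>spread u\<close>,
  while \<open>d\<close> keeps its full norm. In this form it serves both the consensus and the
  tracking recursion.\<close>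

lemma sum_mix_deviation_young:
  fixes u d :: "'n \<Rightarrow> real^'p"
  assumes "lam = mixing_rate W" "0 \<le> lam" "lam < 1"
  shows "(\<Sum>i\<in>UNIV. (norm (mix (deviation_matrix W) (\<lambda>j. u j + d j) i))\<^sup>2)
    \<le> (1 + lam\<^sup>2) / 2 * spread u + 2 * lam\<^sup>2 / (1 - lam\<^sup>2) * (\<Sum>j\<in>UNIV. (norm (d j))\<^sup>2)"
proof -
  have "(\<Sum>i\<in>UNIV. (norm (mix (deviation_matrix W) (\<lambda>j. u j + d j) i))\<^sup>2)
      = (\<Sum>i\<in>UNIV. (norm (mix (deviation_matrix W) (\<lambda>j. (u j - avg u) + d j) i))\<^sup>2)"
    using mix_deviation_const[of "\<lambda>j. u j + d j" "avg u"] by (simp add: algebra_simps)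
  also have "\<dots> \<le> lam\<^sup>2 * (\<Sum>j\<in>UNIV. (norm ((u j - avg u) + d j))\<^sup>2)"
    unfolding assms(1) mixing_rate_eq by (rule sum_norm_sq_mix_le)
  also have "\<dots> \<le> (\<Sum>j\<in>UNIV. (1 + lam\<^sup>2) / 2 * (norm (u j - avg u))\<^sup>2 + 2 * lam\<^sup>2 / (1 - lam\<^sup>2) * (norm (d j))\<^sup>2)"
    unfolding sum_distrib_left by (intro sum_mono contraction_young assms)
  also have "\<dots> = (1 + lam\<^sup>2) / 2 * spread u + 2 * lam\<^sup>2 / (1 - lam\<^sup>2) * (\<Sum>j\<in>UNIV. (norm (d j))\<^sup>2)"
    unfolding spread_def sum_distrib_left sum.distrib ..
  finally show ?thesis .
qed

end

section \<open>Gradients and the descent inequality\<close>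

lemma GDERIV_gradient:
  fixes h :: "real^'p \<Rightarrow> real"
  assumes "h differentiable (at x)"
  shows "GDERIV h x :> gradient h x"
proof -
  obtain D where D: "(h has_derivative D) (at x)" using assms by (auto simp: differentiable_def)
  interpret D: bounded_linear D using D by (rule has_derivative_bounded_linear)
  \<comment> \<open>Riesz representation of the derivative in coordinates; the uniqueness shown
    below is what makes \<open>THE\<close> return this vector.\<close>
  define d where "d = (\<Sum>b\<in>Basis. D b *\<^sub>R b)"
  have "D = (\<lambda>y. y \<bullet> d)"
  proof
    fix y
    have "D y = D (\<Sum>b\<in>Basis. (y \<bullet> b) *\<^sub>R b)" by (simp only: euclidean_representation)
    also have "\<dots> = y \<bullet> d" by (simp add: D.sum D.scaleR d_def inner_sum_right mult.commute)
    finally show "D y = y \<bullet> d" .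
  qed
  then have ex: "GDERIV h x :> d" using D by (simp add: gderiv_def)
  have "e = d" if "GDERIV h x :> e" for e
  proof -
    have "(\<lambda>y. y \<bullet> e) = (\<lambda>y. y \<bullet> d)"
      using that ex unfolding gderiv_def by (rule has_derivative_unique)
    then show ?thesis by (metis inner_eq_zero_iff inner_diff_right right_minus_eq)
  qed
  with ex show ?thesis unfolding gradient_def by (rule theI)
qed

lemma gradient_eqI:
  fixes h :: "real^'p \<Rightarrow> real"
  assumes "GDERIV h x :> d"
  shows "gradient h x = d"
proof -
  have "h differentiable (at x)" using assms by (auto simp: gderiv_def differentiable_def)
  then have "(\<lambda>y. y \<bullet> gradient h x) = (\<lambda>y. y \<bullet> d)"
    using assms GDERIV_gradient unfolding gderiv_def by (blast intro: has_derivative_unique)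
  then show ?thesis by (metis inner_eq_zero_iff inner_diff_right right_minus_eq)
qed

lemma GDERIV_global_cost:
  fixes f :: "'n::finite \<Rightarrow> real^'p \<Rightarrow> real"
  assumes "\<And>i. f i differentiable (at x)"
  shows "GDERIV (global_cost f) x :> avg (\<lambda>i. gradient (f i) x)"
proof -
  have "(f i has_derivative (\<lambda>y. y \<bullet> gradient (f i) x)) (at x)" for i
    using GDERIV_gradient[OF assms, of i] by (simp add: gderiv_def)
  then have "((\<lambda>x. (1 / real CARD('n)) * (\<Sum>i\<in>UNIV. f i x)) has_derivative
      (\<lambda>y. (1 / real CARD('n)) * (\<Sum>i\<in>UNIV. y \<bullet> gradient (f i) x))) (at x)"
    by (intro has_derivative_mult_right has_derivative_sum)
  then show ?thesis
    by (simp add: gderiv_def avg_def inner_sum_right global_cost_def[abs_def])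
qed

text \<open>Along the segment from \<open>x\<close> to \<open>x + d\<close>, the function minus its
  quadratic upper model has nonpositive derivative. Monotonicity takes the place of integrating the
  gradient.\<close>

lemma lipschitz_gradient_descent:
  fixes F :: "'a::real_inner \<Rightarrow> real"
  assumes deriv: "\<And>x. GDERIV F x :> D x"
    and lip: "\<And>x y. norm (D x - D y) \<le> L * norm (x - y)"
  shows "F (x + d) \<le> F x + D x \<bullet> d + L / 2 * (norm d)\<^sup>2"
proof -
  define \<phi> where "\<phi> s = F (x + s *\<^sub>R d) - s * (D x \<bullet> d) - L / 2 * s\<^sup>2 * (norm d)\<^sup>2" for s
  have F': "((\<lambda>s. F (x + s *\<^sub>R d)) has_real_derivative (d \<bullet> D (x + s *\<^sub>R d))) (at s)" for s
  proof -
    have "((\<lambda>s. F (x + s *\<^sub>R d)) has_derivative (\<lambda>h. (h *\<^sub>R d) \<bullet> D (x + s *\<^sub>R d))) (at s)"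
      by (rule has_derivative_compose[where g = F, OF _ deriv[unfolded gderiv_def]])
        (auto intro!: derivative_eq_intros)
    then show ?thesis by (simp add: has_field_derivative_def mult.commute[of _ "d \<bullet> _"] cong: if_cong)
  qed
  have \<phi>': "(\<phi> has_real_derivative (d \<bullet> D (x + s *\<^sub>R d) - D x \<bullet> d - L * s * (norm d)\<^sup>2)) (at s)" for s
    unfolding \<phi>_def by (auto intro!: derivative_eq_intros F')
  have "\<phi> 1 \<le> \<phi> 0"
  proof (rule DERIV_nonpos_imp_nonincreasing[of 0 1])
    fix s :: real assume s: "0 \<le> s" "s \<le> 1"
    have "d \<bullet> D (x + s *\<^sub>R d) - D x \<bullet> d = d \<bullet> (D (x + s *\<^sub>R d) - D x)"
      by (simp add: inner_simps inner_commute)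
    also have "\<dots> \<le> norm d * norm (D (x + s *\<^sub>R d) - D x)" by (rule norm_cauchy_schwarz)
    also have "\<dots> \<le> norm d * (L * norm (s *\<^sub>R d))"
      using lip[of "x + s *\<^sub>R d" x] by (intro mult_left_mono) auto
    also have "\<dots> = L * s * (norm d)\<^sup>2" using s by (simp add: power2_eq_square)
    finally show "\<exists>y. (\<phi> has_real_derivative y) (at s) \<and> y \<le> 0" using \<phi>' by fastforce
  qed simp
  then show ?thesis by (simp add: \<phi>_def)
qed

text \<open>The recursion telescopes when summed. The induction keeps the last term
  \<open>a T\<close> with coefficient 1; weakening it to \<open>c\<close> at the end extends the sum
  to all \<open>T + 1\<close> values with only \<open>T\<close> driving terms.\<close>

lemma geometric_recursion_sum_le:
  fixes a b :: "nat \<Rightarrow> real"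
  assumes "c \<le> 1" and rec: "\<And>t. a (Suc t) \<le> (1 - c) * a t + b t" and "\<And>t. 0 \<le> a t"
  shows "c * (\<Sum>t\<le>T. a t) \<le> a 0 + (\<Sum>t<T. b t)"
proof -
  have "c * (\<Sum>t<T. a t) + a T \<le> a 0 + (\<Sum>t<T. b t)"
  proof (induction T)
    case (Suc T)
    then show ?case using rec[of T] by (simp add: algebra_simps)
  qed simp
  moreover have "0 \<le> (1 - c) * a T" using assms(1) assms(3)[of T] by simp
  ultimately show ?thesis by (simp add: lessThan_Suc_atMost[symmetric] algebra_simps)
qed

subsection \<open>The deterministic error budget\<close>

text \<open>Real arithmetic, detached from probability. \<open>C\<close> is the consensus error,
  \<open>D\<close> the squared averaged error, \<open>E\<close> the sum of the local ones,
  \<open>G\<close> the increments, \<open>V\<close> the averaged estimator and \<open>Y\<close> the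
  tracking deviation; \<open>m\<close> is \<open>lam^2\<close>, \<open>S\<close> the sum of the
  variances and \<open>gr\<close> the initial gradient norm. \<open>Y\<close> enters from index 1
  on, since the trackers run one index ahead of the estimators.\<close>

lemma hsgd_error_budget:
  fixes C D E G V Y :: "nat \<Rightarrow> real"
  assumes par: "1 \<le> n" "0 < L" "0 < \<alpha>" "0 \<le> m" "m < 1" "0 < b" "0 \<le> S" "0 \<le> gr"
    and q: "q = 1 - m"
    and \<beta>: "\<beta> = 48 * L\<^sup>2 * \<alpha>\<^sup>2 / n"
    and step: "\<alpha> * L \<le> 1 / (4 * sqrt 3)" "90 * m * (\<alpha> * L) \<le> q\<^sup>2"
    and nonneg: "\<And>t. 0 \<le> C t" "\<And>t. 0 \<le> D t" "\<And>t. 0 \<le> E t" "\<And>t. 0 \<le> G t" "\<And>t. 0 \<le> V t" "\<And>t. 0 \<le> Y t"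
    and C0: "C 0 = 0"
    and C: "\<And>t. C (Suc t) \<le> (1 + m) / 2 * C t + 2 * m / q * (\<alpha>\<^sup>2 * Y (Suc t))"
    and D0: "D 0 \<le> S / (n\<^sup>2 * b)"
    and D: "\<And>t. D (Suc t) \<le> (1 - \<beta>)\<^sup>2 * D t + (2 * \<beta>\<^sup>2 * S + 2 * L\<^sup>2 * G t) / n\<^sup>2"
    and E0: "E 0 \<le> S / b"
    and E: "\<And>t. E (Suc t) \<le> (1 - \<beta>)\<^sup>2 * E t + (2 * \<beta>\<^sup>2 * S + 2 * L\<^sup>2 * G t)"
    and G: "\<And>t. G t \<le> n * \<alpha>\<^sup>2 * V t + 2 * C t + 2 * C (Suc t)"
    and Y0: "Y (Suc 0) \<le> m * (gr + S / b)"
    and Y: "\<And>t. Y (Suc (Suc t)) \<le> (1 + m) / 2 * Y (Suc t)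
        + 2 * m / q * (2 * L\<^sup>2 * G t + 2 * \<beta>\<^sup>2 * E t) + m * (2 * \<beta>\<^sup>2 * S + 2 * L\<^sup>2 * G t)"
  shows "4 * (\<Sum>t\<le>T. D t) + 6 * L\<^sup>2 / n * (\<Sum>t\<le>T. C t) - (\<Sum>t\<le>T. V t)
    \<le> 4 * S / (\<beta> * b * n\<^sup>2) + 8 * \<beta> * S * real T / n\<^sup>2 + 64 * m\<^sup>2 * gr / (q ^ 3 * n)
      + 96 * m * S / (q ^ 3 * b * n) + 256 * m * \<beta>\<^sup>2 * S * real T / (q ^ 3 * n)"
proof -
  define SC SD SE SG SV SY where "SC = (\<Sum>t\<le>T. C t)" and "SD = (\<Sum>t\<le>T. D t)" and "SE = (\<Sum>t\<le>T. E t)"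
    and "SG = (\<Sum>t<T. G t)" and "SV = (\<Sum>t\<le>T. V t)" and "SY = (\<Sum>t\<le>T. Y (Suc t))"
  note S_defs = this
  have S_nonneg: "0 \<le> SC" "0 \<le> SD" "0 \<le> SE" "0 \<le> SG" "0 \<le> SV" "0 \<le> SY"
    by (auto simp: S_defs nonneg sum_nonneg)
  have q01: "0 < q" "q \<le> 1" using par q by auto
  have sq: "48 * (\<alpha> * L)\<^sup>2 \<le> 1"
  proof -
    have "(\<alpha> * L)\<^sup>2 \<le> (1 / (4 * sqrt 3))\<^sup>2" using par step by (intro power_mono) auto
    then show ?thesis by (simp add: power_divide power_mult_distrib)
  qed
  \<comment> \<open>13/90 slightly exceeds \<open>1 / (4 * sqrt 3)\<close>, and its denominator
    matches the 90 in the step-size bound.\<close>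
  have \<alpha>L: "\<alpha> * L \<le> 13 / 90"
  proof (rule power2_le_imp_le)
    show "(\<alpha> * L)\<^sup>2 \<le> (13 / 90 :: real)\<^sup>2" using sq by (simp add: power2_eq_square)
  qed simp
  have \<beta>_pos: "0 < \<beta>" unfolding \<beta> using par by simp
  have \<beta>_le: "\<beta> \<le> 48 * (\<alpha> * L)\<^sup>2"
  proof -
    have "\<beta> = 48 * (\<alpha> * L)\<^sup>2 / n" by (simp add: \<beta> power_mult_distrib)
    also have "\<dots> \<le> 48 * (\<alpha> * L)\<^sup>2 / 1" using par by (intro divide_left_mono) auto
    finally show ?thesis by simp
  qed
  then have \<beta>1: "\<beta> \<le> 1" using sq by simp
  \<comment> \<open>One factor \<open>\<alpha> * L\<close> is spent on the network bound and the
    other on 13/90; the result 624/8100 is below 8/100.\<close>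
  have m\<beta>: "m * \<beta> \<le> 8 / 100 * q\<^sup>2"
  proof -
    have "m * \<beta> \<le> m * (48 * (\<alpha> * L)\<^sup>2)" using \<beta>_le par by (intro mult_left_mono) auto
    also have "\<dots> = 48 / 90 * (90 * m * (\<alpha> * L)) * (\<alpha> * L)" by (simp add: power2_eq_square)
    also have "\<dots> \<le> 48 / 90 * q\<^sup>2 * (13 / 90)"
      using step \<alpha>L par by (intro mult_mono) auto
    also have "\<dots> \<le> 8 / 100 * q\<^sup>2" by simp
    finally show ?thesis .
  qed
  \<comment> \<open>Loses at most a factor 2 in the decay rate, but makes the divisor of the summed
    recursions exactly \<beta>.\<close>
  have decay: "(1 - \<beta>)\<^sup>2 * x \<le> (1 - \<beta>) * x" if "0 \<le> x" for x
    using \<beta>_pos \<beta>1 that by (intro mult_right_mono) (auto simp: power2_eq_square mult_left_le_one_le)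
  \<comment> \<open>Every \<open>C t\<close> is counted at most twice, as left and as right endpoint
    of an increment; the index shift loses nothing because \<open>C 0 = 0\<close>.\<close>
  have SG_le: "SG \<le> n * \<alpha>\<^sup>2 * SV + 4 * SC"
  proof -
    have "SG \<le> (\<Sum>t<T. n * \<alpha>\<^sup>2 * V t + 2 * C t + 2 * C (Suc t))"
      unfolding S_defs by (intro sum_mono G)
    also have "\<dots> = n * \<alpha>\<^sup>2 * (\<Sum>t<T. V t) + 2 * (\<Sum>t<T. C t) + 2 * (\<Sum>t<T. C (Suc t))"
      by (simp add: sum.distrib sum_distrib_left)
    also have "\<dots> \<le> n * \<alpha>\<^sup>2 * SV + 2 * SC + 2 * SC"
    proof -
      have "(\<Sum>t<T. V t) \<le> SV" "(\<Sum>t<T. C t) \<le> SC"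
        unfolding S_defs by (auto intro!: sum_mono2 nonneg)
      moreover have "(\<Sum>t<T. C (Suc t)) = SC"
        unfolding SC_def lessThan_Suc_atMost[symmetric] by (subst sum.lessThan_Suc_shift) (simp add: C0)
      ultimately show ?thesis using par by (intro add_mono mult_left_mono) auto
    qed
    finally show ?thesis by simp
  qed
  have sum_const: "(\<Sum>t<T. 2 * \<beta>\<^sup>2 * S + 2 * L\<^sup>2 * G t) = 2 * \<beta>\<^sup>2 * S * real T + 2 * L\<^sup>2 * SG"
    by (simp add: sum.distrib sum_distrib_left SG_def)
  have "\<beta> * SD \<le> D 0 + (\<Sum>t<T. (2 * \<beta>\<^sup>2 * S + 2 * L\<^sup>2 * G t) / n\<^sup>2)"
    unfolding SD_def
    by (rule geometric_recursion_sum_le[OF \<beta>1 _ nonneg(2)])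
      (rule order_trans[OF D], intro add_right_mono decay nonneg)
  then have "\<beta> * SD \<le> S / (n\<^sup>2 * b) + (2 * \<beta>\<^sup>2 * S * real T + 2 * L\<^sup>2 * SG) / n\<^sup>2"
    using D0 by (simp add: sum_divide_distrib[symmetric] sum_const)
  then have "SD \<le> (S / (n\<^sup>2 * b) + (2 * \<beta>\<^sup>2 * S * real T + 2 * L\<^sup>2 * SG) / n\<^sup>2) / \<beta>"
    using \<beta>_pos by (simp add: pos_le_divide_eq mult.commute)
  also have "\<dots> = S / (\<beta> * b * n\<^sup>2) + 2 * \<beta> * S * real T / n\<^sup>2 + 2 * L\<^sup>2 / (\<beta> * n\<^sup>2) * SG"
    using \<beta>_pos par by (simp add: field_simps power2_eq_square)
  finally have "SD \<le> S / (\<beta> * b * n\<^sup>2) + 2 * \<beta> * S * real T / n\<^sup>2 + 2 * L\<^sup>2 / (\<beta> * n\<^sup>2) * SG" .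
  \<comment> \<open>Since \<beta> is proportional to \<open>L^2 * \<alpha>^2 / n\<close>, the
    constant \<open>L\<close> drops out here, and 48 becomes 24.\<close>
  moreover have "2 * L\<^sup>2 / (\<beta> * n\<^sup>2) = 1 / (24 * \<alpha>\<^sup>2 * n)"
    unfolding \<beta> using par by (simp add: field_simps power2_eq_square)
  ultimately have SD_le: "SD \<le> S / (\<beta> * b * n\<^sup>2) + 2 * \<beta> * S * real T / n\<^sup>2 + SG / (24 * \<alpha>\<^sup>2 * n)"
    by simp
  have "\<beta> * SE \<le> E 0 + (\<Sum>t<T. 2 * \<beta>\<^sup>2 * S + 2 * L\<^sup>2 * G t)"
    unfolding SE_def
    by (rule geometric_recursion_sum_le[OF \<beta>1 _ nonneg(3)])
      (rule order_trans[OF E], intro add_right_mono decay nonneg)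
  \<comment> \<open>The factor \<beta> stays on the left: the tracking recursion contains
    \<open>\<beta>^2 * E\<close>, and one \<beta> is used up here while the other is traded against
    \<open>m\<close>.\<close>
  then have SE_le: "\<beta> * SE \<le> S / b + 2 * \<beta>\<^sup>2 * S * real T + 2 * L\<^sup>2 * SG"
    using E0 sum_const by simp
  have SC_le_SY: "q / 2 * SC \<le> 2 * m / q * \<alpha>\<^sup>2 * SY"
  proof -
    have "q / 2 * SC \<le> C 0 + (\<Sum>t<T. 2 * m / q * (\<alpha>\<^sup>2 * Y (Suc t)))"
      unfolding SC_def
    proof (rule geometric_recursion_sum_le[OF _ _ nonneg(1)])
      show "q / 2 \<le> 1" using q01 by simp
      show "C (Suc t) \<le> (1 - q / 2) * C t + 2 * m / q * (\<alpha>\<^sup>2 * Y (Suc t))" for t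
        using C[of t] by (simp add: q field_simps)
    qed
    also have "\<dots> = 2 * m / q * \<alpha>\<^sup>2 * (\<Sum>t<T. Y (Suc t))"
      by (simp add: C0 sum_distrib_left mult.assoc)
    also have "\<dots> \<le> 2 * m / q * \<alpha>\<^sup>2 * SY"
      unfolding SY_def using par q01 by (intro mult_left_mono sum_mono2 nonneg) auto
    finally show ?thesis .
  qed
  have SY_le: "q / 2 * SY \<le> m * gr + 132 / 100 * (S / b) + 264 / 100 * (\<beta>\<^sup>2 * S * real T) + 14 * m / q * L\<^sup>2 * SG"
  proof -
    \<comment> \<open>All contributions to the tracking bound are measured in \<open>U\<close>
      (increments), \<open>N\<close> (injected noise) and \<open>S / b\<close>. They add up to 4 + 8
      + 2 = 14, to 0.64 + 2 = 2.64 and to 1 + 0.32 = 1.32 respectively.\<close>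
    define U N where "U = m / q * (L\<^sup>2 * SG)" and "N = \<beta>\<^sup>2 * S * real T"
    have U_nonneg: "0 \<le> U" and N_nonneg: "0 \<le> N" using par q01 S_nonneg by (auto simp: U_def N_def)
    define B1 B2 B3 B4 B5 where "B1 = (\<Sum>t<T. 2 * m / q * (2 * L\<^sup>2 * G t + 2 * \<beta>\<^sup>2 * E t) + m * (2 * \<beta>\<^sup>2 * S + 2 * L\<^sup>2 * G t))"
      and "B2 = 2 * m / q * (2 * L\<^sup>2 * SG + 2 * \<beta>\<^sup>2 * (\<Sum>t<T. E t))"
      and "B3 = 2 * m / q * (2 * L\<^sup>2 * SG + 2 * \<beta>\<^sup>2 * SE)"
      and "B4 = m * (2 * \<beta>\<^sup>2 * S * real T + 2 * L\<^sup>2 * SG)"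
      and "B5 = 4 * (m * \<beta> / q) * (\<beta> * SE)"
    note B_defs = this
    have "q / 2 * SY \<le> Y (Suc 0) + B1"
      unfolding SY_def B_defs
    proof (rule geometric_recursion_sum_le[OF _ _ nonneg(6)])
      show "q / 2 \<le> 1" using q01 by simp
      show "Y (Suc (Suc t)) \<le> (1 - q / 2) * Y (Suc t)
        + (2 * m / q * (2 * L\<^sup>2 * G t + 2 * \<beta>\<^sup>2 * E t) + m * (2 * \<beta>\<^sup>2 * S + 2 * L\<^sup>2 * G t))" for t
        using Y[of t] by (simp add: q field_simps)
    qed
    moreover have "B1 = B2 + B4"
      unfolding B_defs sum.distrib sum_distrib_left[symmetric] sum_const SG_def by simp
    moreover have "B2 \<le> B3"
      unfolding B_defs SE_def using par q01 by (intro mult_left_mono add_left_mono sum_mono2 nonneg) auto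
    moreover have "B3 = 4 * U + B5"
      unfolding B_defs U_def using q01 by (simp add: field_simps power2_eq_square)
    moreover have "B5 \<le> 32 / 100 * (S / b + 2 * N) + 8 * U"
    proof -
      have "B5 \<le> 4 * (m * \<beta> / q) * (S / b + 2 * N + 2 * L\<^sup>2 * SG)"
        using par q01 \<beta>_pos SE_le unfolding N_def B_defs by (intro mult_left_mono) auto
      \<comment> \<open>The increment part is kept apart: it is bounded with
        \<open>\<beta> \<le> 1\<close>, whereas the rest uses that \<open>m * \<beta> / q\<close> is
        small.\<close>
      moreover have "4 * (m * \<beta> / q) * (S / b + 2 * N + 2 * L\<^sup>2 * SG) = 4 * (m * \<beta> / q) * (S / b + 2 * N) + 8 * (\<beta> * U)"
        unfolding U_def by (simp add: algebra_simps add_divide_distrib)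
      moreover have "4 * (m * \<beta> / q) * (S / b + 2 * N) \<le> 32 / 100 * (S / b + 2 * N)"
      proof -
        have "q\<^sup>2 \<le> q * 1" unfolding power2_eq_square using q01 by (intro mult_left_mono) auto
        then have "m * \<beta> \<le> 8 / 100 * q" using m\<beta> by simp
        then have "m * \<beta> / q \<le> 8 / 100" using q01 by (simp only: pos_divide_le_eq)
        then have "4 * (m * \<beta> / q) \<le> 32 / 100" by simp
        then show ?thesis using par N_nonneg by (intro mult_right_mono) auto
      qed
      moreover have "\<beta> * U \<le> 1 * U" using U_nonneg \<beta>1 by (intro mult_right_mono) auto
      ultimately show ?thesis by linarith
    qed
    moreover have "B4 \<le> 2 * N + 2 * U"
    proof -
      have "m * N \<le> 1 * N" using par N_nonneg by (intro mult_right_mono) auto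
      moreover have "m * (L\<^sup>2 * SG) \<le> m / q * (L\<^sup>2 * SG)"
        using par q01 S_nonneg by (intro mult_right_mono) (auto simp: le_divide_eq mult_left_le)
      moreover have "B4 = 2 * (m * N) + 2 * (m * (L\<^sup>2 * SG))"
        unfolding N_def B_defs by (simp add: algebra_simps)
      ultimately show ?thesis unfolding U_def by linarith
    qed
    moreover have "Y (Suc 0) \<le> m * gr + S / b"
    proof -
      have "m * (S / b) \<le> 1 * (S / b)" using par by (intro mult_right_mono) auto
      then show ?thesis using Y0 by (simp add: distrib_left)
    qed
    ultimately have "q / 2 * SY \<le> m * gr + 132 / 100 * (S / b) + 264 / 100 * N + 14 * U"
      unfolding distrib_left by simp
    then show ?thesis by (simp add: N_def U_def)
  qed
  define R where "R = m * gr + 132 / 100 * (S / b) + 264 / 100 * (\<beta>\<^sup>2 * S * real T)"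
  have R_nonneg: "0 \<le> R" unfolding R_def using par by simp
  have SC_le: "SC \<le> 8 * \<alpha>\<^sup>2 * m / q ^ 3 * R + SG / 72"
  proof -
    have "SC \<le> 4 * m * \<alpha>\<^sup>2 / q\<^sup>2 * SY"
      using SC_le_SY q01 by (simp add: field_simps power2_eq_square)
    also have "\<dots> \<le> 4 * m * \<alpha>\<^sup>2 / q\<^sup>2 * (2 / q * (R + 14 * m / q * L\<^sup>2 * SG))"
      using SY_le q01 par unfolding R_def by (intro mult_left_mono) (auto simp: field_simps)
    also have "\<dots> = 8 * \<alpha>\<^sup>2 * m / q ^ 3 * R + 112 * (m * (\<alpha> * L))\<^sup>2 / q ^ 4 * SG"
      using q01 by (simp add: field_simps power2_eq_square power3_eq_cube power4_eq_xxxx)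
    finally have "SC \<le> 8 * \<alpha>\<^sup>2 * m / q ^ 3 * R + 112 * (m * (\<alpha> * L))\<^sup>2 / q ^ 4 * SG" .
    \<comment> \<open>Here 112 = 4 * 2 * 14, and 112 * 72 = 8064 lies just below 8100 = 90 * 90.
      This is the smallness that cuts the loop.\<close>
    moreover have "112 * (m * (\<alpha> * L))\<^sup>2 / q ^ 4 * SG \<le> 1 / 72 * SG"
    proof (rule mult_right_mono)
      have "(90 * m * (\<alpha> * L))\<^sup>2 \<le> (q\<^sup>2)\<^sup>2" using par by (intro power_mono step) auto
      then have "8100 * (m * (\<alpha> * L))\<^sup>2 \<le> q ^ 4" by (simp add: power_mult_distrib)
      moreover have "0 \<le> (m * (\<alpha> * L))\<^sup>2" by simp
      ultimately have "112 * (m * (\<alpha> * L))\<^sup>2 \<le> 1 / 72 * q ^ 4" by linarith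
      then show "112 * (m * (\<alpha> * L))\<^sup>2 / q ^ 4 \<le> 1 / 72" using q01 by (simp only: pos_divide_le_eq zero_less_power)
    qed (rule S_nonneg)
    ultimately show ?thesis by simp
  qed
  define Q where "Q = n * \<alpha>\<^sup>2"
  have Q: "0 < Q" unfolding Q_def using par by simp
  define K where "K = 8 * \<alpha>\<^sup>2 * m / q ^ 3 * R"
  \<comment> \<open>Inserting \<open>SG_le\<close> puts \<open>4 / 72 * SC\<close> on the right.
    Absorbing it leaves the factor 17/18 on the left, whence 18/17 and 18/17 * 1/72 = 1/68.\<close>
  have "SC \<le> 18 / 17 * K + Q * SV / 68"
    using SC_le SG_le unfolding Q_def[symmetric] K_def[symmetric] by linarith
  then have "SC / Q \<le> (18 / 17 * K + Q * SV / 68) / Q"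
    using Q by (intro divide_right_mono) auto
  also have "\<dots> = 18 / 17 * (8 * m / (q ^ 3 * n) * R) + SV / 68"
    unfolding Q_def K_def using par q01 by (simp add: field_simps)
  finally have SCQ: "SC / Q \<le> 18 / 17 * (8 * m / (q ^ 3 * n) * R) + SV / 68" .
  have SGQ: "SG / Q \<le> SV + 4 * (SC / Q)"
    using SG_le Q unfolding Q_def[symmetric] by (simp add: field_simps)
  have LC: "6 * L\<^sup>2 / n * SC \<le> 1 / 8 * (SC / Q)"
  proof -
    have "6 * L\<^sup>2 / n \<le> 1 / (8 * Q)"
      unfolding Q_def using sq par by (simp add: field_simps power_mult_distrib)
    then have "6 * L\<^sup>2 / n * SC \<le> 1 / (8 * Q) * SC" using S_nonneg by (intro mult_right_mono)
    then show ?thesis by simp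
  qed
  define c c' d A1 A2 A3 where "c = SC / Q" and "c' = SG / Q" and "d = 6 * L\<^sup>2 / n * SC"
    and "A1 = S / (\<beta> * b * n\<^sup>2)" and "A2 = \<beta> * S * real T / n\<^sup>2" and "A3 = 8 * m / (q ^ 3 * n) * R"
  note A_defs = this
  have "SD \<le> A1 + 2 * A2 + 1 / 24 * c'"
    using SD_le by (simp add: Q_def A_defs mult.commute mult.left_commute)
  moreover have "0 \<le> A3" unfolding A_defs using par q01 R_nonneg by simp
  \<comment> \<open>The coefficient of \<open>c\<close> is 4/6 + 1/8 = 19/24. After
    \<open>SCQ\<close> it contributes 19/24 * 18/17 < 1 times \<open>A3\<close>, and the total
    coefficient of \<open>SV\<close> stays negative.\<close>
  ultimately have "4 * SD + d - SV \<le> 4 * A1 + 8 * A2 + A3"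
    using LC[folded c_def d_def] SCQ[folded A3_def c_def] SGQ[folded c_def c'_def] S_nonneg(5) by linarith
  then have "4 * SD + 6 * L\<^sup>2 / n * SC - SV
      \<le> 4 * S / (\<beta> * b * n\<^sup>2) + 8 * \<beta> * S * real T / n\<^sup>2 + 8 * m / (q ^ 3 * n) * R"
    by (simp add: A_defs)
  moreover have "8 * m / (q ^ 3 * n) * R \<le> m / (q ^ 3 * n) * (64 * m * gr + 96 * (S / b) + 256 * (\<beta>\<^sup>2 * S * real T))"
  proof -
    \<comment> \<open>Coefficient by coefficient: 8, 10.56 and 21.12 lie below 64, 96 and
      256.\<close>
    have "8 * R \<le> 64 * (m * gr) + 96 * (S / b) + 256 * (\<beta>\<^sup>2 * S * real T)"
    proof -
      have split: "8 * (x + 132 / 100 * y + 264 / 100 * z) \<le> 64 * x + 96 * y + 256 * z"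
        if "0 \<le> x" "0 \<le> y" "0 \<le> z" for x y z :: real
        using that by simp
      show ?thesis unfolding R_def by (rule split) (use par in auto)
    qed
    then have "m / (q ^ 3 * n) * (8 * R) \<le> m / (q ^ 3 * n) * (64 * (m * gr) + 96 * (S / b) + 256 * (\<beta>\<^sup>2 * S * real T))"
      using par q01 by (intro mult_left_mono) auto
    then show ?thesis by (simp add: mult.assoc mult.left_commute)
  qed
  moreover have "m / (q ^ 3 * n) * (64 * m * gr + 96 * (S / b) + 256 * (\<beta>\<^sup>2 * S * real T)) = 64 * m\<^sup>2 * gr / (q ^ 3 * n)
      + 96 * m * S / (q ^ 3 * b * n) + 256 * m * \<beta>\<^sup>2 * S * real T / (q ^ 3 * n)"
    using par q01 by (simp add: field_simps power2_eq_square)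
  ultimately show ?thesis unfolding S_defs by linarith
qed

subsection \<open>Square integrable random vectors\<close>

context prob_space
begin

lemma sq_integrable_imp_integrable:
  fixes X :: "'a \<Rightarrow> 'b::euclidean_space"
  assumes [measurable]: "X \<in> borel_measurable M" and X: "integrable M (\<lambda>\<omega>. (norm (X \<omega>))\<^sup>2)"
  shows "integrable M X"
proof (rule Bochner_Integration.integrable_bound)
  show "integrable M (\<lambda>\<omega>. 1 + (norm (X \<omega>))\<^sup>2)" using X by simp
  have "x \<le> 1 + x\<^sup>2" for x :: real
    using zero_le_power2[of "x - 1 / 2"] by (simp add: power2_eq_square algebra_simps)
  then show "AE \<omega> in M. norm (X \<omega>) \<le> norm (1 + (norm (X \<omega>))\<^sup>2)" by simp
qed simp

lemma sq_integrable_add: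
  fixes X Y :: "'a \<Rightarrow> 'b::euclidean_space"
  assumes [measurable]: "X \<in> borel_measurable M" "Y \<in> borel_measurable M"
    and "integrable M (\<lambda>\<omega>. (norm (X \<omega>))\<^sup>2)" "integrable M (\<lambda>\<omega>. (norm (Y \<omega>))\<^sup>2)"
  shows "integrable M (\<lambda>\<omega>. (norm (X \<omega> + Y \<omega>))\<^sup>2)"
proof (rule Bochner_Integration.integrable_bound)
  show "integrable M (\<lambda>\<omega>. 2 * (norm (X \<omega>))\<^sup>2 + 2 * (norm (Y \<omega>))\<^sup>2)" using assms by simp
  show "AE \<omega> in M. norm ((norm (X \<omega> + Y \<omega>))\<^sup>2) \<le> norm (2 * (norm (X \<omega>))\<^sup>2 + 2 * (norm (Y \<omega>))\<^sup>2)"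
    using norm_sq_add_le by (intro AE_I2) simp
qed simp

lemma integrable_inner_sq:
  fixes X Y :: "'a \<Rightarrow> 'b::euclidean_space"
  assumes [measurable]: "X \<in> borel_measurable M" "Y \<in> borel_measurable M"
    and "integrable M (\<lambda>\<omega>. (norm (X \<omega>))\<^sup>2)" "integrable M (\<lambda>\<omega>. (norm (Y \<omega>))\<^sup>2)"
  shows "integrable M (\<lambda>\<omega>. X \<omega> \<bullet> Y \<omega>)"
proof (rule Bochner_Integration.integrable_bound)
  show "integrable M (\<lambda>\<omega>. (norm (X \<omega>))\<^sup>2 + (norm (Y \<omega>))\<^sup>2)" using assms by simp
  have "\<bar>a \<bullet> b\<bar> \<le> (norm a)\<^sup>2 + (norm b)\<^sup>2" for a b :: 'b
  proof -
    have "\<bar>a \<bullet> b\<bar> \<le> norm a * norm b" by (rule Cauchy_Schwarz_ineq2)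
    also have "\<dots> \<le> (norm a)\<^sup>2 + (norm b)\<^sup>2"
      using sum_squares_bound[of "norm a" "norm b"] mult_nonneg_nonneg[OF norm_ge_zero[of a] norm_ge_zero[of b]]
      by linarith
    finally show ?thesis .
  qed
  then show "AE \<omega> in M. norm (X \<omega> \<bullet> Y \<omega>) \<le> norm ((norm (X \<omega>))\<^sup>2 + (norm (Y \<omega>))\<^sup>2)"
    by (intro AE_I2) simp
qed simp

lemma integral_inner_euclidean:
  fixes X Y :: "'a \<Rightarrow> 'b::euclidean_space"
  assumes "\<And>b. b \<in> Basis \<Longrightarrow> integrable M (\<lambda>\<omega>. (X \<omega> \<bullet> b) * (Y \<omega> \<bullet> b))"
  shows "(\<integral>\<omega>. X \<omega> \<bullet> Y \<omega> \<partial>M) = (\<Sum>b\<in>Basis. \<integral>\<omega>. (X \<omega> \<bullet> b) * (Y \<omega> \<bullet> b) \<partial>M)"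
  by (subst euclidean_inner) (rule Bochner_Integration.integral_sum[OF assms])

text \<open>Independence factorizes scalar products of coordinates, and it also makes them
  integrable without second moments.\<close>

lemma expectation_inner_indep_zero:
  fixes X Y :: "'a \<Rightarrow> 'b::euclidean_space"
  assumes indep: "indep_var borel X borel Y"
    and X: "integrable M X" and Y: "integrable M Y" "expectation Y = 0"
  shows "expectation (\<lambda>\<omega>. X \<omega> \<bullet> Y \<omega>) = 0"
proof -
  have ind: "indep_var borel (\<lambda>\<omega>. X \<omega> \<bullet> b) borel (\<lambda>\<omega>. Y \<omega> \<bullet> b)" for b
    using indep_var_compose[OF indep, of "\<lambda>x. x \<bullet> b" borel "\<lambda>x. x \<bullet> b" borel] by (simp add: comp_def)
  have int: "integrable M (\<lambda>\<omega>. X \<omega> \<bullet> b)" "integrable M (\<lambda>\<omega>. Y \<omega> \<bullet> b)" for b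
    using X Y by auto
  have "expectation (\<lambda>\<omega>. (X \<omega> \<bullet> b) * (Y \<omega> \<bullet> b)) = 0" for b
    using Y by (simp add: indep_var_lebesgue_integral[OF ind int])
  then show ?thesis
    by (subst integral_inner_euclidean) (auto intro!: indep_var_integrable[OF ind] int)
qed

lemma expectation_norm_sq_add:
  fixes X Y :: "'a \<Rightarrow> 'b::euclidean_space"
  assumes [measurable]: "X \<in> borel_measurable M" "Y \<in> borel_measurable M"
    and "integrable M (\<lambda>\<omega>. (norm (X \<omega>))\<^sup>2)" "integrable M (\<lambda>\<omega>. (norm (Y \<omega>))\<^sup>2)"
  shows "expectation (\<lambda>\<omega>. (norm (X \<omega> + Y \<omega>))\<^sup>2) = expectation (\<lambda>\<omega>. (norm (X \<omega>))\<^sup>2)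
    + 2 * expectation (\<lambda>\<omega>. X \<omega> \<bullet> Y \<omega>) + expectation (\<lambda>\<omega>. (norm (Y \<omega>))\<^sup>2)"
  using assms integrable_inner_sq[OF assms] by (simp add: norm_sq_add)

text \<open>Independent centred vectors are orthogonal in mean square, and a constant is orthogonal
  to each of them. Pairwise independence suffices, because the induction meets only the cross terms
  with the new summand.\<close>

lemma expectation_norm_sq_sum_indep:
  fixes X :: "'i \<Rightarrow> 'a \<Rightarrow> 'b::euclidean_space"
  assumes "finite J"
    and meas: "\<And>j. j \<in> J \<Longrightarrow> X j \<in> borel_measurable M"
    and sq: "\<And>j. j \<in> J \<Longrightarrow> integrable M (\<lambda>\<omega>. (norm (X j \<omega>))\<^sup>2)"
    and mean: "\<And>j. j \<in> J \<Longrightarrow> expectation (X j) = 0"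
    and indep: "\<And>i j. i \<in> J \<Longrightarrow> j \<in> J \<Longrightarrow> i \<noteq> j \<Longrightarrow> indep_var borel (X i) borel (X j)"
  shows "integrable M (\<lambda>\<omega>. (norm (c + (\<Sum>j\<in>J. X j \<omega>)))\<^sup>2) \<and>
    expectation (\<lambda>\<omega>. (norm (c + (\<Sum>j\<in>J. X j \<omega>)))\<^sup>2)
      = (norm c)\<^sup>2 + (\<Sum>j\<in>J. expectation (\<lambda>\<omega>. (norm (X j \<omega>))\<^sup>2))"
  using assms
proof (induction J rule: finite_induct)
  case empty
  then show ?case by (simp add: prob_space)
next
  case (insert j J)
  have meas [measurable]: "X i \<in> borel_measurable M" if "i \<in> insert j J" for i
    using insert.prems(1) that by blast
  have int: "integrable M (X i)" if "i \<in> insert j J" for i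
    by (rule sq_integrable_imp_integrable[OF insert.prems(1)[OF that] insert.prems(2)[OF that]])
  have IH: "integrable M (\<lambda>\<omega>. (norm (c + (\<Sum>j\<in>J. X j \<omega>)))\<^sup>2)"
    "expectation (\<lambda>\<omega>. (norm (c + (\<Sum>j\<in>J. X j \<omega>)))\<^sup>2)
      = (norm c)\<^sup>2 + (\<Sum>j\<in>J. expectation (\<lambda>\<omega>. (norm (X j \<omega>))\<^sup>2))"
    using insert.IH[OF insert.prems] by blast+
  have sumM: "(\<lambda>\<omega>. c + (\<Sum>j\<in>J. X j \<omega>)) \<in> borel_measurable M"
    by (intro borel_measurable_add borel_measurable_const borel_measurable_sum meas) auto
  have jM: "X j \<in> borel_measurable M" using meas by simp
  have jsq: "integrable M (\<lambda>\<omega>. (norm (X j \<omega>))\<^sup>2)" using insert.prems(2) by simp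
  have cross: "expectation (\<lambda>\<omega>. (c + (\<Sum>j\<in>J. X j \<omega>)) \<bullet> X j \<omega>) = 0"
  proof -
    have ii: "integrable M (\<lambda>\<omega>. X i \<omega> \<bullet> X j \<omega>)" if "i \<in> J" for i
      by (rule integrable_inner_sq) (use insert.prems(1,2) that in blast)+
    have "expectation (\<lambda>\<omega>. (c + (\<Sum>j\<in>J. X j \<omega>)) \<bullet> X j \<omega>)
        = c \<bullet> expectation (X j) + (\<Sum>i\<in>J. expectation (\<lambda>\<omega>. X i \<omega> \<bullet> X j \<omega>))"
      unfolding inner_add_left inner_sum_left using int[of j] ii by simp
    also have "\<dots> = 0"
    proof -
      have "expectation (\<lambda>\<omega>. X i \<omega> \<bullet> X j \<omega>) = 0" if "i \<in> J" for i
      proof (rule expectation_inner_indep_zero)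
        show "indep_var borel (X i) borel (X j)" using that insert.hyps by (intro insert.prems(4)) auto
      qed (use that int insert.prems(3) in blast)+
      moreover have "expectation (X j) = 0" using insert.prems(3) by blast
      ultimately show ?thesis by simp
    qed
    finally show ?thesis .
  qed
  have eq: "c + (\<Sum>j\<in>insert j J. X j \<omega>) = (c + (\<Sum>j\<in>J. X j \<omega>)) + X j \<omega>" for \<omega>
    using insert.hyps by (simp add: ac_simps)
  have "expectation (\<lambda>\<omega>. (norm ((c + (\<Sum>j\<in>J. X j \<omega>)) + X j \<omega>))\<^sup>2)
      = (norm c)\<^sup>2 + (\<Sum>j\<in>insert j J. expectation (\<lambda>\<omega>. (norm (X j \<omega>))\<^sup>2))"
    unfolding expectation_norm_sq_add[OF sumM jM IH(1) jsq] cross IH(2) sum.insert[OF insert.hyps] by linarith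
  with sq_integrable_add[OF sumM jM IH(1) jsq] show ?case unfolding eq by (rule conjI)
qed

lemma expectation_norm_sq_centered_le:
  fixes X :: "'a \<Rightarrow> 'b::euclidean_space"
  assumes [measurable]: "X \<in> borel_measurable M" and sq: "integrable M (\<lambda>\<omega>. (norm (X \<omega>))\<^sup>2)"
  shows "expectation (\<lambda>\<omega>. (norm (X \<omega> - expectation X))\<^sup>2) \<le> expectation (\<lambda>\<omega>. (norm (X \<omega>))\<^sup>2)"
proof -
  have int: "integrable M X" by (rule sq_integrable_imp_integrable[OF assms])
  have "expectation (\<lambda>\<omega>. (norm (X \<omega> + (- expectation X)))\<^sup>2) = expectation (\<lambda>\<omega>. (norm (X \<omega>))\<^sup>2)
    + 2 * expectation (\<lambda>\<omega>. X \<omega> \<bullet> (- expectation X)) + expectation (\<lambda>\<omega>. (norm (- expectation X))\<^sup>2)"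
    by (rule expectation_norm_sq_add) (use sq in auto)
  also have "\<dots> \<le> expectation (\<lambda>\<omega>. (norm (X \<omega>))\<^sup>2)"
    using int by (simp add: prob_space power2_norm_eq_inner)
  finally show ?thesis by simp
qed

lemma norm_sq_expectation_le:
  fixes X :: "'a \<Rightarrow> 'b::euclidean_space"
  assumes [measurable]: "X \<in> borel_measurable M" and sq: "integrable M (\<lambda>\<omega>. (norm (X \<omega>))\<^sup>2)"
  shows "(norm (expectation X))\<^sup>2 \<le> expectation (\<lambda>\<omega>. (norm (X \<omega>))\<^sup>2)"
proof -
  have int: "integrable M X" by (rule sq_integrable_imp_integrable[OF assms])
  have "0 \<le> expectation (\<lambda>\<omega>. (norm (X \<omega> + (- expectation X)))\<^sup>2)" by simp
  also have "\<dots> = expectation (\<lambda>\<omega>. (norm (X \<omega>))\<^sup>2)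
    + 2 * expectation (\<lambda>\<omega>. X \<omega> \<bullet> (- expectation X)) + expectation (\<lambda>\<omega>. (norm (- expectation X))\<^sup>2)"
    by (rule expectation_norm_sq_add) (use sq in auto)
  also have "\<dots> = expectation (\<lambda>\<omega>. (norm (X \<omega>))\<^sup>2) - (norm (expectation X))\<^sup>2"
    using int by (simp add: prob_space power2_norm_eq_inner)
  finally show ?thesis by simp
qed

text \<open>The outcome itself is treated as a random element with values in \<open>F\<close>,
  through the identity map. Independence makes the joint law of outcome and \<open>Y\<close> a
  product, so Tonelli applies; \<open>F\<close> can be any subalgebra, and integrability need not be
  known beforehand.\<close>

lemma nn_integral_indep_subalgebra:
  assumes F: "subalgebra M F" and H: "subalgebra M H" and indep: "indep_set (sets F) (sets H)"
    and Y_H: "Y \<in> measurable H T" and [measurable]: "h \<in> borel_measurable (F \<Otimes>\<^sub>M T)"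
  shows "(\<integral>\<^sup>+\<omega>. h (\<omega>, Y \<omega>) \<partial>M) = (\<integral>\<^sup>+\<omega>. (\<integral>\<^sup>+\<omega>'. h (\<omega>, Y \<omega>') \<partial>M) \<partial>M)"
proof -
  have id [measurable]: "(\<lambda>\<omega>. \<omega>) \<in> measurable M F"
    by (rule measurable_from_subalg[OF F]) simp
  have Y [measurable]: "Y \<in> measurable M T" by (rule measurable_from_subalg[OF H Y_H])
  interpret S: prob_space "distr M F (\<lambda>\<omega>. \<omega>)" by (rule prob_space_distr) simp
  interpret T: prob_space "distr M T Y" by (rule prob_space_distr) simp
  have D: "distr M F (\<lambda>\<omega>. \<omega>) \<Otimes>\<^sub>M distr M T Y = distr M (F \<Otimes>\<^sub>M T) (\<lambda>\<omega>. (\<omega>, Y \<omega>))"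
  proof (rule pair_measure_eqI)
    show "sigma_finite_measure (distr M F (\<lambda>\<omega>. \<omega>))" "sigma_finite_measure (distr M T Y)" by unfold_locales
    fix A B assume "A \<in> sets (distr M F (\<lambda>\<omega>. \<omega>))" "B \<in> sets (distr M T Y)"
    then have AB [measurable]: "A \<in> sets F" "B \<in> sets T" by auto
    have A: "A \<inter> space M = A" using F sets.sets_into_space[OF AB(1)] by (auto simp: subalgebra_def)
    have YB: "Y -` B \<inter> space M \<in> sets H"
      using measurable_sets[OF Y_H AB(2)] H by (simp add: subalgebra_def)
    have "prob (A \<inter> (Y -` B \<inter> space M)) = prob A * prob (Y -` B \<inter> space M)"
      using indep AB(1) YB by (rule indep_setD)
    then have "emeasure M (A \<inter> (Y -` B \<inter> space M)) = emeasure M A * emeasure M (Y -` B \<inter> space M)"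
      by (simp add: emeasure_eq_measure ennreal_mult)
    moreover have "(\<lambda>\<omega>. (\<omega>, Y \<omega>)) -` (A \<times> B) \<inter> space M = A \<inter> (Y -` B \<inter> space M)"
      using A by auto
    ultimately show "emeasure (distr M F (\<lambda>\<omega>. \<omega>)) A * emeasure (distr M T Y) B
        = emeasure (distr M (F \<Otimes>\<^sub>M T) (\<lambda>\<omega>. (\<omega>, Y \<omega>))) (A \<times> B)"
      by (simp add: emeasure_distr A)
  qed (simp cong: sets_pair_measure_cong)
  have "(\<integral>\<^sup>+\<omega>. h (\<omega>, Y \<omega>) \<partial>M) = (\<integral>\<^sup>+z. h z \<partial>distr M (F \<Otimes>\<^sub>M T) (\<lambda>\<omega>. (\<omega>, Y \<omega>)))"
    by (subst nn_integral_distr) auto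
  also have "\<dots> = (\<integral>\<^sup>+x. (\<integral>\<^sup>+y. h (x, y) \<partial>distr M T Y) \<partial>distr M F (\<lambda>\<omega>. \<omega>))"
    unfolding D[symmetric] by (subst T.nn_integral_fst[symmetric]) auto
  also have "\<dots> = (\<integral>\<^sup>+\<omega>. (\<integral>\<^sup>+y. h (\<omega>, y) \<partial>distr M T Y) \<partial>M)"
    by (subst nn_integral_distr) auto
  also have "\<dots> = (\<integral>\<^sup>+\<omega>. (\<integral>\<^sup>+\<omega>'. h (\<omega>, Y \<omega>') \<partial>M) \<partial>M)"
  proof (rule nn_integral_cong)
    fix \<omega> assume "\<omega> \<in> space M"
    then have [measurable]: "\<omega> \<in> space F" using F by (simp add: subalgebra_def)
    show "(\<integral>\<^sup>+y. h (\<omega>, y) \<partial>distr M T Y) = (\<integral>\<^sup>+\<omega>'. h (\<omega>, Y \<omega>') \<partial>M)"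
      by (subst nn_integral_distr) auto
  qed
  finally show ?thesis .
qed

text \<open>Bounds are first obtained in \<open>[0, \<infinity>]\<close>, where no integrability is
  required; a finite bound then gives integrability and the real inequality together.\<close>

lemma expectation_le_of_nn_integral_le:
  fixes h b :: "'a \<Rightarrow> real"
  assumes [measurable]: "h \<in> borel_measurable M" and nonneg: "\<And>\<omega>. 0 \<le> h \<omega>" "\<And>\<omega>. 0 \<le> b \<omega>"
    and b: "integrable M b"
    and le: "(\<integral>\<^sup>+\<omega>. ennreal (h \<omega>) \<partial>M) \<le> (\<integral>\<^sup>+\<omega>. ennreal (b \<omega>) \<partial>M)"
  shows "integrable M h \<and> expectation h \<le> expectation b"
proof -
  have eq: "(\<integral>\<^sup>+\<omega>. ennreal (b \<omega>) \<partial>M) = ennreal (expectation b)"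
    by (rule nn_integral_eq_integral[OF b]) (use nonneg in auto)
  have h: "integrable M h"
    using le nonneg unfolding eq by (intro integrableI_bounded) (auto simp: order_le_less_trans)
  have "ennreal (expectation h) \<le> ennreal (expectation b)"
    using le nonneg unfolding eq by (subst nn_integral_eq_integral[OF h, symmetric]) auto
  moreover have "0 \<le> expectation b" using nonneg by simp
  ultimately show ?thesis using h by simp
qed

end

subsection \<open>The sample history and the oracle\<close>

lemma space_sample_algebra [simp]: "space (sample_algebra M \<xi> I) = space M"
  by (auto simp: sample_algebra_def space_measure_of_conv)

lemma sets_sample_algebra:
  "sets (sample_algebra M \<xi> I) = sigma_sets (space M) (\<Union>(t, r, i)\<in>I. {\<xi> t r i -` A \<inter> space M | A. A \<in> sets borel})"
  unfolding sample_algebra_def by (rule sets_measure_of) auto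

lemma sample_algebra_mono:
  assumes "I \<subseteq> J" shows "sets (sample_algebra M \<xi> I) \<subseteq> sets (sample_algebra M \<xi> J)"
  unfolding sets_sample_algebra by (rule sigma_sets_mono') (use assms in auto)

lemma measurable_sample_algebra:
  assumes "(t, r, i) \<in> I"
  shows "\<xi> t r i \<in> borel_measurable (sample_algebra M \<xi> I)"
  by (rule measurableI) (use assms in \<open>auto simp: sets_sample_algebra intro!: sigma_sets.Basic\<close>)

locale stochastic_oracle = prob_space M for M :: "'w measure" +
  fixes f :: "'n::finite \<Rightarrow> real^'p \<Rightarrow> real"
    and g :: "'n \<Rightarrow> real^'p \<Rightarrow> real^'q \<Rightarrow> real^'p"
    and \<xi> :: "nat \<Rightarrow> nat \<Rightarrow> 'n \<Rightarrow> 'w \<Rightarrow> real^'q"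
    and \<nu> :: "'n \<Rightarrow> real"
    and L :: real
    and b0 :: nat
  assumes f_diff: "\<And>i x. f i differentiable (at x)"
    and L_pos: "L > 0" and b0_pos: "b0 \<ge> 1"
    and g_borel: "\<And>i. (\<lambda>(x, s). g i x s) \<in> borel \<Otimes>\<^sub>M borel \<rightarrow>\<^sub>M borel"
    and unbiased: "\<And>t r i. (t, r, i) \<in> sample_index b0 \<Longrightarrow>
          unbiased_oracle M (history M b0 \<xi> t) (f i) (g i) (\<xi> t r i)"
    and variance: "\<And>t r i. (t, r, i) \<in> sample_index b0 \<Longrightarrow>
          bounded_variance_oracle M (history M b0 \<xi> t) (f i) (g i) (\<nu> i) (\<xi> t r i)"
    and smooth: "\<And>t r i. (t, r, i) \<in> sample_index b0 \<Longrightarrow>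
          mean_square_smooth_oracle M (history M b0 \<xi> t) (g i) L (\<xi> t r i)"
    and indep: "indep_vars (\<lambda>_. borel) (\<lambda>(t, r, i). \<xi> t r i) (sample_index b0)"
begin

abbreviation grad :: "'n \<Rightarrow> real^'p \<Rightarrow> real^'p" where "grad i \<equiv> gradient (f i)"

abbreviation hist :: "nat \<Rightarrow> 'w measure" where "hist t \<equiv> history M b0 \<xi> t"

lemma space_hist [simp]: "space (hist t) = space M"
  by (simp add: history_def)

lemma sample_measurable [measurable (raw)]:
  "(t, r, i) \<in> sample_index b0 \<Longrightarrow> \<xi> t r i \<in> borel_measurable M"
  using indep unfolding indep_vars_def2 by auto

lemma initial_index: "r \<in> {1..b0} \<Longrightarrow> (0, r, i) \<in> sample_index b0"
  by (simp add: sample_index_def)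

lemma later_index: "(Suc t, Suc 0, i) \<in> sample_index b0"
  by (simp add: sample_index_def)

lemma g_measurable:
  assumes "X \<in> borel_measurable N" "Y \<in> borel_measurable N"
  shows "(\<lambda>\<omega>. g i (X \<omega>) (Y \<omega>)) \<in> borel_measurable N"
  using measurable_compose[OF measurable_Pair[OF assms] g_borel[of i]] by simp

lemma sets_sample_algebra_subset:
  assumes "I \<subseteq> sample_index b0"
  shows "sets (sample_algebra M \<xi> I) \<subseteq> events"
  unfolding sets_sample_algebra
  by (rule sets.sigma_sets_subset)
    (use assms sample_measurable in \<open>auto intro: measurable_sets\<close>)

lemma subalgebra_sample_algebra: "I \<subseteq> sample_index b0 \<Longrightarrow> subalgebra M (sample_algebra M \<xi> I)"
  using sets_sample_algebra_subset by (simp add: subalgebra_def)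

lemma hist_subset: "{(s, r, i) \<in> sample_index b0. s < t} \<subseteq> sample_index b0"
  by auto

lemma subalgebra_hist: "subalgebra M (hist t)"
  unfolding history_def by (rule subalgebra_sample_algebra[OF hist_subset])

lemma hist_measurable_M: "X \<in> borel_measurable (hist t) \<Longrightarrow> X \<in> borel_measurable M"
  by (rule measurable_from_subalg[OF subalgebra_hist])

lemma hist_measurable_sample:
  assumes "X \<in> borel_measurable (hist t)"
  shows "X \<in> borel_measurable (sample_algebra M \<xi> (sample_index b0))"
proof -
  have "subalgebra (sample_algebra M \<xi> (sample_index b0)) (hist t)"
    using sample_algebra_mono[OF hist_subset] by (simp add: subalgebra_def history_def)
  then show ?thesis using assms by (rule measurable_from_subalg)
qed

lemma hist_measurable_mono:
  assumes "t \<le> t'" "X \<in> borel_measurable (hist t)"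
  shows "X \<in> borel_measurable (hist t')"
proof -
  have "{(s, r, i) \<in> sample_index b0. s < t} \<subseteq> {(s, r, i) \<in> sample_index b0. s < t'}"
    using assms(1) by auto
  then have "subalgebra (hist t') (hist t)"
    using sample_algebra_mono[of _ _ M \<xi>] unfolding subalgebra_def history_def by simp
  then show ?thesis using assms(2) by (rule measurable_from_subalg)
qed

lemma sample_hist_measurable:
  assumes "(s, r, i) \<in> sample_index b0" "s < t"
  shows "\<xi> s r i \<in> borel_measurable (hist t)"
  unfolding history_def by (rule measurable_sample_algebra) (use assms in auto)

text \<open>Grouping of an independent family: the events of a single sample are closed under
  intersection, so independence passes to the sigma-algebras generated by two disjoint blocks,
  indexed here by \<open>bool\<close>.\<close>

lemma indep_set_sample_algebra:
  assumes "I \<subseteq> sample_index b0" "J \<subseteq> sample_index b0" "I \<inter> J = {}"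
  shows "indep_set (sets (sample_algebra M \<xi> I)) (sets (sample_algebra M \<xi> J))"
proof -
  let ?E = "\<lambda>k. {(case k of (t, r, i) \<Rightarrow> \<xi> t r i) -` A \<inter> space M | A. A \<in> sets borel}"
  have "indep_sets ?E (sample_index b0)"
    using indep unfolding indep_vars_def2 by simp
  then have "indep_sets ?E (\<Union>j\<in>UNIV. case_bool I J j)"
    by (rule indep_sets_mono_index[rotated]) (use assms in \<open>auto simp: UNIV_bool\<close>)
  then have "indep_sets (\<lambda>j. sigma_sets (space M) (\<Union>k\<in>case_bool I J j. ?E k)) UNIV"
  proof (rule indep_sets_collect_sigma)
    show "Int_stable (?E k)" for k
    proof (rule Int_stableI)
      fix a b assume "a \<in> ?E k" "b \<in> ?E k"
      then obtain A B where "a = (case k of (t, r, i) \<Rightarrow> \<xi> t r i) -` A \<inter> space M" "A \<in> sets borel"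
        "b = (case k of (t, r, i) \<Rightarrow> \<xi> t r i) -` B \<inter> space M" "B \<in> sets borel" by blast
      then show "a \<inter> b \<in> ?E k" by (intro CollectI exI[of _ "A \<inter> B"]) auto
    qed
    show "disjoint_family_on (case_bool I J) UNIV"
      using assms(3) by (auto simp: disjoint_family_on_def split: bool.splits)
  qed
  moreover have "(\<lambda>j. sigma_sets (space M) (\<Union>k\<in>case_bool I J j. ?E k))
      = case_bool (sets (sample_algebra M \<xi> I)) (sets (sample_algebra M \<xi> J))"
  proof
    fix j :: bool
    have "(\<Union>k\<in>K. ?E k) = (\<Union>(t, r, i)\<in>K. {\<xi> t r i -` A \<inter> space M | A. A \<in> sets borel})" for K
      by (intro SUP_cong refl) (simp split: prod.split)
    then show "sigma_sets (space M) (\<Union>k\<in>case_bool I J j. ?E k)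
        = case_bool (sets (sample_algebra M \<xi> I)) (sets (sample_algebra M \<xi> J)) j"
      unfolding sets_sample_algebra by (cases j) simp_all
  qed
  ultimately show ?thesis unfolding indep_set_def by simp
qed

lemma indep_var_samples:
  assumes k: "(t, r, i) \<in> sample_index b0" and k': "(t', r', i') \<in> sample_index b0"
    and ne: "(t, r, i) \<noteq> (t', r', i')"
  shows "indep_var borel (\<xi> t r i) borel (\<xi> t' r' i')"
proof -
  have "indep_set (sets (sample_algebra M \<xi> {(t, r, i)})) (sets (sample_algebra M \<xi> {(t', r', i')}))"
    by (rule indep_set_sample_algebra) (use assms in auto)
  then show ?thesis
    unfolding indep_var_eq sets_sample_algebra using sample_measurable[OF k] sample_measurable[OF k'] by simp
qed

text \<open>The samples of all nodes at one time are taken as a single element of a product space,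
  because averaging and mixing combine the noise of all nodes.\<close>

lemma nn_integral_hist_sample:
  assumes "h \<in> borel_measurable (hist (Suc t) \<Otimes>\<^sub>M Pi\<^sub>M UNIV (\<lambda>_. borel))"
  shows "(\<integral>\<^sup>+\<omega>. h (\<omega>, \<lambda>j. \<xi> (Suc t) (Suc 0) j \<omega>) \<partial>M)
    = (\<integral>\<^sup>+\<omega>. (\<integral>\<^sup>+\<omega>'. h (\<omega>, \<lambda>j. \<xi> (Suc t) (Suc 0) j \<omega>') \<partial>M) \<partial>M)"
proof (rule nn_integral_indep_subalgebra[OF subalgebra_hist _ _ _ assms])
  let ?J = "{(Suc t, Suc 0, i) | i. True} :: (nat \<times> nat \<times> 'n) set"
  have J: "?J \<subseteq> sample_index b0" using later_index by auto
  then show "subalgebra M (sample_algebra M \<xi> ?J)" by (rule subalgebra_sample_algebra)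
  show "(\<lambda>\<omega> j. \<xi> (Suc t) (Suc 0) j \<omega>) \<in> measurable (sample_algebra M \<xi> ?J) (Pi\<^sub>M UNIV (\<lambda>_. borel))"
    by (rule measurable_PiM_single') (auto intro!: measurable_sample_algebra)
  show "indep_set (sets (hist (Suc t))) (sets (sample_algebra M \<xi> ?J))"
    unfolding history_def by (rule indep_set_sample_algebra) (use J in auto)
qed

section \<open>The oracle at deterministic points\<close>

lemma oracle_deviation:
  assumes k: "(t, r, i) \<in> sample_index b0"
  shows "integrable M (\<lambda>\<omega>. (norm (g i x (\<xi> t r i \<omega>) - grad i x))\<^sup>2)"
    and "expectation (\<lambda>\<omega>. (norm (g i x (\<xi> t r i \<omega>) - grad i x))\<^sup>2) \<le> (\<nu> i)\<^sup>2"
proof -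
  have [measurable]: "(\<lambda>\<omega>. g i x (\<xi> t r i \<omega>)) \<in> borel_measurable M"
    by (intro g_measurable borel_measurable_const sample_measurable k)
  \<comment> \<open>A constant vector is measurable for every sigma-algebra, so the oracle
    assumption applies to it.\<close>
  have "(\<integral>\<^sup>+\<omega>. ennreal ((norm (g i x (\<xi> t r i \<omega>) - grad i x))\<^sup>2) \<partial>M) \<le> (\<integral>\<^sup>+\<omega>. ennreal ((\<nu> i)\<^sup>2) \<partial>M)"
    using bspec[OF variance[OF k, unfolded bounded_variance_oracle_def], of "\<lambda>_. x"]
    by (simp add: emeasure_space_1)
  then have "integrable M (\<lambda>\<omega>. (norm (g i x (\<xi> t r i \<omega>) - grad i x))\<^sup>2) \<and>
    expectation (\<lambda>\<omega>. (norm (g i x (\<xi> t r i \<omega>) - grad i x))\<^sup>2) \<le> expectation (\<lambda>_. (\<nu> i)\<^sup>2)"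
    by (intro expectation_le_of_nn_integral_le) auto
  then show "integrable M (\<lambda>\<omega>. (norm (g i x (\<xi> t r i \<omega>) - grad i x))\<^sup>2)"
    and "expectation (\<lambda>\<omega>. (norm (g i x (\<xi> t r i \<omega>) - grad i x))\<^sup>2) \<le> (\<nu> i)\<^sup>2"
    by (simp_all add: prob_space)
qed

text \<open>Integrability comes first, from the variance bound; the tower property then turns the
  conditional mean into a plain one, since the argument \<open>x\<close> is constant.\<close>

lemma oracle_mean:
  assumes k: "(t, r, i) \<in> sample_index b0"
  shows "integrable M (\<lambda>\<omega>. g i x (\<xi> t r i \<omega>))"
    and "expectation (\<lambda>\<omega>. g i x (\<xi> t r i \<omega>)) = grad i x"
proof -
  interpret H: finite_measure_subalgebra M "hist t"
    by unfold_locales (rule subalgebra_hist)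
  have meas [measurable]: "(\<lambda>\<omega>. g i x (\<xi> t r i \<omega>)) \<in> borel_measurable M"
    by (intro g_measurable borel_measurable_const sample_measurable k)
  have "integrable M (\<lambda>\<omega>. g i x (\<xi> t r i \<omega>) - grad i x)"
    by (rule sq_integrable_imp_integrable[OF _ oracle_deviation(1)[OF k]]) simp
  then have "integrable M (\<lambda>\<omega>. (g i x (\<xi> t r i \<omega>) - grad i x) + grad i x)"
    by (intro Bochner_Integration.integrable_add) auto
  then show int: "integrable M (\<lambda>\<omega>. g i x (\<xi> t r i \<omega>))" by simp
  show "expectation (\<lambda>\<omega>. g i x (\<xi> t r i \<omega>)) = grad i x"
  proof (rule vec_eq_iff[THEN iffD2], rule allI)
    fix k'
    have int': "integrable M (\<lambda>\<omega>. g i x (\<xi> t r i \<omega>) $ k')"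
      using integrable_bounded_linear[OF bounded_linear_vec_nth int] .
    have "expectation (\<lambda>\<omega>. g i x (\<xi> t r i \<omega>)) $ k' = expectation (\<lambda>\<omega>. g i x (\<xi> t r i \<omega>) $ k')"
      using integral_bounded_linear[OF bounded_linear_vec_nth int] by simp
    also have "\<dots> = expectation (real_cond_exp M (hist t) (\<lambda>\<omega>. g i x (\<xi> t r i \<omega>) $ k'))"
      using H.real_cond_exp_int(2)[OF int'] by simp
    also have "\<dots> = expectation (\<lambda>\<omega>. grad i x $ k')"
      using bspec[OF unbiased[OF k, unfolded unbiased_oracle_def], of "\<lambda>_. x"]
      by (intro integral_cong_AE) auto
    finally show "expectation (\<lambda>\<omega>. g i x (\<xi> t r i \<omega>)) $ k' = grad i x $ k'" by (simp add: prob_space)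
  qed
qed

lemma oracle_smooth:
  assumes k: "(t, r, i) \<in> sample_index b0"
  shows "integrable M (\<lambda>\<omega>. (norm (g i x (\<xi> t r i \<omega>) - g i y (\<xi> t r i \<omega>)))\<^sup>2)"
    and "expectation (\<lambda>\<omega>. (norm (g i x (\<xi> t r i \<omega>) - g i y (\<xi> t r i \<omega>)))\<^sup>2) \<le> L\<^sup>2 * (norm (x - y))\<^sup>2"
proof -
  have [measurable]: "(\<lambda>\<omega>. g i x (\<xi> t r i \<omega>)) \<in> borel_measurable M" for x
    by (intro g_measurable borel_measurable_const sample_measurable k)
  have "(\<integral>\<^sup>+\<omega>. ennreal ((norm (g i x (\<xi> t r i \<omega>) - g i y (\<xi> t r i \<omega>)))\<^sup>2) \<partial>M)
      \<le> ennreal (L\<^sup>2) * (\<integral>\<^sup>+\<omega>. ennreal ((norm (x - y))\<^sup>2) \<partial>M)"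
    using bspec[OF bspec[OF smooth[OF k, unfolded mean_square_smooth_oracle_def], of "\<lambda>_. x"], of "\<lambda>_. y"]
    by simp
  then have "(\<integral>\<^sup>+\<omega>. ennreal ((norm (g i x (\<xi> t r i \<omega>) - g i y (\<xi> t r i \<omega>)))\<^sup>2) \<partial>M)
      \<le> (\<integral>\<^sup>+\<omega>. ennreal (L\<^sup>2 * (norm (x - y))\<^sup>2) \<partial>M)"
    by (simp add: emeasure_space_1 ennreal_mult)
  then have "integrable M (\<lambda>\<omega>. (norm (g i x (\<xi> t r i \<omega>) - g i y (\<xi> t r i \<omega>)))\<^sup>2) \<and>
    expectation (\<lambda>\<omega>. (norm (g i x (\<xi> t r i \<omega>) - g i y (\<xi> t r i \<omega>)))\<^sup>2) \<le> expectation (\<lambda>_. L\<^sup>2 * (norm (x - y))\<^sup>2)"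
    by (intro expectation_le_of_nn_integral_le) auto
  then show "integrable M (\<lambda>\<omega>. (norm (g i x (\<xi> t r i \<omega>) - g i y (\<xi> t r i \<omega>)))\<^sup>2)"
    and "expectation (\<lambda>\<omega>. (norm (g i x (\<xi> t r i \<omega>) - g i y (\<xi> t r i \<omega>)))\<^sup>2) \<le> L\<^sup>2 * (norm (x - y))\<^sup>2"
    by (simp_all add: prob_space)
qed

text \<open>Smoothness is assumed for the samples in mean square, and Jensen's inequality transfers
  it to their expectation. Any sample of node \<open>i\<close> would do; at time 1 the position does
  not depend on \<open>b0\<close>.\<close>

lemma grad_lipschitz: "norm (grad i x - grad i y) \<le> L * norm (x - y)"
proof (rule power2_le_imp_le)
  note k = later_index[of 0 i]
  have [measurable]: "(\<lambda>\<omega>. g i x (\<xi> (Suc 0) (Suc 0) i \<omega>)) \<in> borel_measurable M" for x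
    by (intro g_measurable borel_measurable_const sample_measurable k)
  have "(norm (grad i x - grad i y))\<^sup>2
      = (norm (expectation (\<lambda>\<omega>. g i x (\<xi> (Suc 0) (Suc 0) i \<omega>) - g i y (\<xi> (Suc 0) (Suc 0) i \<omega>))))\<^sup>2"
    using oracle_mean[OF k] by simp
  also have "\<dots> \<le> expectation (\<lambda>\<omega>. (norm (g i x (\<xi> (Suc 0) (Suc 0) i \<omega>) - g i y (\<xi> (Suc 0) (Suc 0) i \<omega>)))\<^sup>2)"
    by (intro norm_sq_expectation_le oracle_smooth k) simp
  also have "\<dots> \<le> (L * norm (x - y))\<^sup>2"
    using oracle_smooth(2)[OF k] by (simp add: power_mult_distrib)
  finally show "(norm (grad i x - grad i y))\<^sup>2 \<le> (L * norm (x - y))\<^sup>2" .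
qed (use L_pos in simp)

lemma grad_measurable [measurable]: "grad i \<in> borel_measurable borel"
proof (rule borel_measurable_continuous_onI)
  have "L-lipschitz_on UNIV (grad i)"
    by (rule lipschitz_onI) (use grad_lipschitz L_pos in \<open>auto simp: dist_norm\<close>)
  then show "continuous_on UNIV (grad i)" by (rule lipschitz_on_continuous_on)
qed

end

subsection \<open>Adapted noise\<close>

context stochastic_oracle
begin

text \<open>With weight 1 this is the plain deviation \<open>g i x s - grad i x\<close>, so the same
  lemmas also cover the initial minibatch and single samples.\<close>

definition noise :: "real \<Rightarrow> 'n \<Rightarrow> real^'p \<Rightarrow> real^'p \<Rightarrow> real^'q \<Rightarrow> real^'p" where
  "noise \<beta> i x y s = (g i x s - grad i x) - (1 - \<beta>) *\<^sub>R (g i y s - grad i y)"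

lemma noise_measurable:
  assumes [measurable]: "X \<in> borel_measurable N" "Y \<in> borel_measurable N" "Z \<in> borel_measurable N"
  shows "(\<lambda>\<omega>. noise \<beta> i (X \<omega>) (Y \<omega>) (Z \<omega>)) \<in> borel_measurable N"
proof -
  have [measurable]: "(\<lambda>\<omega>. g i (X \<omega>) (Z \<omega>)) \<in> borel_measurable N" "(\<lambda>\<omega>. g i (Y \<omega>) (Z \<omega>)) \<in> borel_measurable N"
    by (rule g_measurable; fact)+
  show ?thesis unfolding noise_def by measurable
qed

text \<open>The source of variance reduction: the noise equals \<open>(1 - \<beta>)\<close> times
  the centred difference \<open>A\<close> of two samples, which is small for close arguments, plus
  \<beta> times the plain deviation \<open>B\<close>. The oracle variance therefore enters only with
  \<beta> squared.\<close>

lemma noise_moments: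
  assumes k: "(t, r, i) \<in> sample_index b0" and \<beta>: "0 \<le> \<beta>" "\<beta> \<le> 1"
  shows noise_sq_integrable: "integrable M (\<lambda>\<omega>. (norm (noise \<beta> i x y (\<xi> t r i \<omega>)))\<^sup>2)"
    and noise_mean: "expectation (\<lambda>\<omega>. noise \<beta> i x y (\<xi> t r i \<omega>)) = 0"
    and noise_variance: "expectation (\<lambda>\<omega>. (norm (noise \<beta> i x y (\<xi> t r i \<omega>)))\<^sup>2)
      \<le> 2 * L\<^sup>2 * (norm (x - y))\<^sup>2 + 2 * \<beta>\<^sup>2 * (\<nu> i)\<^sup>2"
proof -
  let ?s = "\<lambda>\<omega>. \<xi> t r i \<omega>"
  have g [measurable]: "(\<lambda>\<omega>. g i x (?s \<omega>)) \<in> borel_measurable M" for x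
    by (intro g_measurable borel_measurable_const sample_measurable k)
  have [measurable]: "(\<lambda>\<omega>. noise \<beta> i x y (?s \<omega>)) \<in> borel_measurable M"
    unfolding noise_def by measurable
  define A B where "A = (\<lambda>\<omega>. (g i x (?s \<omega>) - g i y (?s \<omega>)) - (grad i x - grad i y))"
    and "B = (\<lambda>\<omega>. g i x (?s \<omega>) - grad i x)"
  have [measurable]: "A \<in> borel_measurable M" "B \<in> borel_measurable M"
    unfolding A_def B_def by measurable
  have E: "expectation (\<lambda>\<omega>. g i x (?s \<omega>) - g i y (?s \<omega>)) = grad i x - grad i y"
    using oracle_mean[OF k] by simp
  have A_int: "integrable M (\<lambda>\<omega>. (norm (A \<omega>))\<^sup>2)"
    using sq_integrable_add[OF _ _ oracle_smooth(1)[OF k, of x y], of "\<lambda>_. - (grad i x - grad i y)"]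
    by (simp add: A_def diff_conv_add_uminus del: add_uminus_conv_diff)
  \<comment> \<open>Centring does not increase the second moment, so \<open>A\<close> inherits the
    constant of the uncentred difference.\<close>
  have A_le: "expectation (\<lambda>\<omega>. (norm (A \<omega>))\<^sup>2) \<le> L\<^sup>2 * (norm (x - y))\<^sup>2"
    using expectation_norm_sq_centered_le[OF _ oracle_smooth(1)[OF k, of x y]] oracle_smooth(2)[OF k, of x y]
    unfolding E A_def by (auto intro: order_trans)
  have B_int: "integrable M (\<lambda>\<omega>. (norm (B \<omega>))\<^sup>2)" and B_le: "expectation (\<lambda>\<omega>. (norm (B \<omega>))\<^sup>2) \<le> (\<nu> i)\<^sup>2"
    unfolding B_def by (rule oracle_deviation[OF k])+
  have bound: "(norm (noise \<beta> i x y (?s \<omega>)))\<^sup>2 \<le> 2 * (norm (A \<omega>))\<^sup>2 + 2 * \<beta>\<^sup>2 * (norm (B \<omega>))\<^sup>2" for \<omega>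
  proof -
    have "noise \<beta> i x y (?s \<omega>) = (1 - \<beta>) *\<^sub>R A \<omega> + \<beta> *\<^sub>R B \<omega>"
      by (simp add: noise_def A_def B_def algebra_simps)
    then have "(norm (noise \<beta> i x y (?s \<omega>)))\<^sup>2 \<le> 2 * ((1 - \<beta>)\<^sup>2 * (norm (A \<omega>))\<^sup>2) + 2 * (\<beta>\<^sup>2 * (norm (B \<omega>))\<^sup>2)"
      using norm_sq_add_le[of "(1 - \<beta>) *\<^sub>R A \<omega>" "\<beta> *\<^sub>R B \<omega>"] by (simp add: power_mult_distrib)
    moreover have "(1 - \<beta>)\<^sup>2 \<le> 1" using \<beta> by (simp add: power_le_one)
    then have "(1 - \<beta>)\<^sup>2 * (norm (A \<omega>))\<^sup>2 \<le> 1 * (norm (A \<omega>))\<^sup>2" by (intro mult_right_mono) auto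
    ultimately show ?thesis by simp
  qed
  have bound_int: "integrable M (\<lambda>\<omega>. 2 * (norm (A \<omega>))\<^sup>2 + 2 * \<beta>\<^sup>2 * (norm (B \<omega>))\<^sup>2)"
    using A_int B_int by simp
  show int: "integrable M (\<lambda>\<omega>. (norm (noise \<beta> i x y (?s \<omega>)))\<^sup>2)"
    by (rule Bochner_Integration.integrable_bound[OF bound_int]) (use bound in \<open>auto intro!: AE_I2\<close>)
  show "expectation (\<lambda>\<omega>. noise \<beta> i x y (?s \<omega>)) = 0"
    unfolding noise_def using oracle_mean[OF k] by (simp add: prob_space)
  have "expectation (\<lambda>\<omega>. (norm (noise \<beta> i x y (?s \<omega>)))\<^sup>2)
      \<le> expectation (\<lambda>\<omega>. 2 * (norm (A \<omega>))\<^sup>2 + 2 * \<beta>\<^sup>2 * (norm (B \<omega>))\<^sup>2)"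
    by (rule integral_mono[OF int bound_int bound])
  also have "\<dots> = 2 * expectation (\<lambda>\<omega>. (norm (A \<omega>))\<^sup>2) + 2 * \<beta>\<^sup>2 * expectation (\<lambda>\<omega>. (norm (B \<omega>))\<^sup>2)"
    using A_int B_int by simp
  also have "\<dots> \<le> 2 * (L\<^sup>2 * (norm (x - y))\<^sup>2) + 2 * \<beta>\<^sup>2 * (\<nu> i)\<^sup>2"
    using A_le B_le by (intro add_mono mult_left_mono) auto
  finally show "expectation (\<lambda>\<omega>. (norm (noise \<beta> i x y (?s \<omega>)))\<^sup>2)
      \<le> 2 * L\<^sup>2 * (norm (x - y))\<^sup>2 + 2 * \<beta>\<^sup>2 * (\<nu> i)\<^sup>2" by simp
qed

lemma indep_var_noise:
  assumes "(t, r, i) \<in> sample_index b0" "(t', r', i') \<in> sample_index b0" "(t, r, i) \<noteq> (t', r', i')"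
  shows "indep_var borel (\<lambda>\<omega>. c *\<^sub>R noise \<beta> i x y (\<xi> t r i \<omega>)) borel (\<lambda>\<omega>. c' *\<^sub>R noise \<beta> i' x' y' (\<xi> t' r' i' \<omega>))"
proof -
  have [measurable]: "noise \<beta> i x y \<in> borel_measurable borel" for i x y
    using noise_measurable[of "\<lambda>_. x" borel "\<lambda>_. y" "\<lambda>s. s" \<beta> i] by simp
  show ?thesis
    using indep_var_compose[OF indep_var_samples[OF assms],
        of "\<lambda>s. c *\<^sub>R noise \<beta> i x y s" borel "\<lambda>s. c' *\<^sub>R noise \<beta> i' x' y' s" borel]
    by (simp add: comp_def)
qed

text \<open>Two properties carried together through every induction: measurability lets the history
  act as a parameter while fresh samples are integrated out, and square integrability keeps the
  moments finite.\<close>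

definition adapted_L2 :: "nat \<Rightarrow> ('w \<Rightarrow> real^'p) \<Rightarrow> bool" where
  "adapted_L2 t X \<longleftrightarrow> X \<in> borel_measurable (hist t) \<and> integrable M (\<lambda>\<omega>. (norm (X \<omega>))\<^sup>2)"

lemma adapted_L2_measurable: "adapted_L2 t X \<Longrightarrow> X \<in> borel_measurable M"
  unfolding adapted_L2_def by (blast intro: hist_measurable_M)

lemma adapted_L2_integrable: "adapted_L2 t X \<Longrightarrow> integrable M (\<lambda>\<omega>. (norm (X \<omega>))\<^sup>2)"
  by (simp add: adapted_L2_def)

lemma adapted_L2_const: "adapted_L2 t (\<lambda>_. c)"
  by (simp add: adapted_L2_def)

lemma adapted_L2_mono: "adapted_L2 t X \<Longrightarrow> t \<le> t' \<Longrightarrow> adapted_L2 t' X"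
  by (auto simp: adapted_L2_def intro: hist_measurable_mono)

lemma adapted_L2_add: "adapted_L2 t X \<Longrightarrow> adapted_L2 t Y \<Longrightarrow> adapted_L2 t (\<lambda>\<omega>. X \<omega> + Y \<omega>)"
  unfolding adapted_L2_def by (auto intro!: sq_integrable_add hist_measurable_M)

lemma adapted_L2_scaleR: "adapted_L2 t X \<Longrightarrow> adapted_L2 t (\<lambda>\<omega>. c *\<^sub>R X \<omega>)"
  unfolding adapted_L2_def by (auto simp: power_mult_distrib)

lemma adapted_L2_diff: "adapted_L2 t X \<Longrightarrow> adapted_L2 t Y \<Longrightarrow> adapted_L2 t (\<lambda>\<omega>. X \<omega> - Y \<omega>)"
  using adapted_L2_add[of t X "\<lambda>\<omega>. (-1) *\<^sub>R Y \<omega>"] adapted_L2_scaleR[of t Y "-1"] by simp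

lemma adapted_L2_sum: "(\<And>i. i \<in> I \<Longrightarrow> adapted_L2 t (X i)) \<Longrightarrow> adapted_L2 t (\<lambda>\<omega>. \<Sum>i\<in>I. X i \<omega>)"
  by (induction I rule: infinite_finite_induct) (auto intro: adapted_L2_add adapted_L2_const)

lemma adapted_L2_avg: "(\<And>i. adapted_L2 t (X i)) \<Longrightarrow> adapted_L2 t (\<lambda>\<omega>. avg (\<lambda>i. X i \<omega>))"
  unfolding avg_def by (intro adapted_L2_scaleR adapted_L2_sum)

lemma adapted_L2_mix: "(\<And>j. adapted_L2 t (X j)) \<Longrightarrow> adapted_L2 t (\<lambda>\<omega>. mix A (\<lambda>j. X j \<omega>) i)"
  unfolding mix_def by (intro adapted_L2_scaleR adapted_L2_sum)

lemma adapted_L2_grad: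
  assumes "adapted_L2 t X"
  shows "adapted_L2 t (\<lambda>\<omega>. grad i (X \<omega>))"
proof -
  have [measurable]: "X \<in> borel_measurable (hist t)" using assms by (simp add: adapted_L2_def)
  have "integrable M (\<lambda>\<omega>. (norm (grad i (X \<omega>)))\<^sup>2)"
  proof (rule Bochner_Integration.integrable_bound)
    show "integrable M (\<lambda>\<omega>. 2 * (L\<^sup>2 * (norm (X \<omega>))\<^sup>2) + 2 * (norm (grad i 0))\<^sup>2)"
      using adapted_L2_integrable[OF assms] by simp
    have "(norm (grad i x))\<^sup>2 \<le> 2 * (L\<^sup>2 * (norm x)\<^sup>2) + 2 * (norm (grad i 0))\<^sup>2" for x
    proof -
      have "(norm (grad i x))\<^sup>2 \<le> 2 * (norm (grad i x - grad i 0))\<^sup>2 + 2 * (norm (grad i 0))\<^sup>2"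
        using norm_sq_add_le[of "grad i x - grad i 0" "grad i 0"] by simp
      moreover have "(norm (grad i x - grad i 0))\<^sup>2 \<le> (L * norm x)\<^sup>2"
        using grad_lipschitz[of i x 0] by (intro power_mono) auto
      ultimately show ?thesis by (simp add: power_mult_distrib)
    qed
    then show "AE \<omega> in M. norm ((norm (grad i (X \<omega>)))\<^sup>2) \<le> norm (2 * (L\<^sup>2 * (norm (X \<omega>))\<^sup>2) + 2 * (norm (grad i 0))\<^sup>2)"
      by (intro AE_I2) simp
    have [measurable]: "X \<in> borel_measurable M" by (rule adapted_L2_measurable[OF assms])
    show "(\<lambda>\<omega>. (norm (grad i (X \<omega>)))\<^sup>2) \<in> borel_measurable M" by measurable
  qed
  then show ?thesis unfolding adapted_L2_def by simp
qed

text \<open>Conditionally on the history, the noise terms of distinct nodes are independent and centred, so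
  they add up orthogonally to each other and to every adapted term.\<close>
lemma noise_step:
  assumes \<beta>: "0 \<le> \<beta>" "\<beta> \<le> 1"
    and c: "adapted_L2 (Suc t) c" and x: "\<And>j. adapted_L2 (Suc t) (x j)" and y: "\<And>j. adapted_L2 (Suc t) (y j)"
  shows "integrable M (\<lambda>\<omega>. (norm (c \<omega> + (\<Sum>j\<in>UNIV. w j *\<^sub>R noise \<beta> j (x j \<omega>) (y j \<omega>) (\<xi> (Suc t) (Suc 0) j \<omega>))))\<^sup>2) \<and>
    expectation (\<lambda>\<omega>. (norm (c \<omega> + (\<Sum>j\<in>UNIV. w j *\<^sub>R noise \<beta> j (x j \<omega>) (y j \<omega>) (\<xi> (Suc t) (Suc 0) j \<omega>))))\<^sup>2)
      \<le> expectation (\<lambda>\<omega>. (norm (c \<omega>))\<^sup>2)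
        + (\<Sum>j\<in>UNIV. (w j)\<^sup>2 * (2 * L\<^sup>2 * expectation (\<lambda>\<omega>. (norm (x j \<omega> - y j \<omega>))\<^sup>2) + 2 * \<beta>\<^sup>2 * (\<nu> j)\<^sup>2))"
proof -
  let ?N = "\<lambda>\<omega> s. c \<omega> + (\<Sum>j\<in>UNIV. w j *\<^sub>R noise \<beta> j (x j \<omega>) (y j \<omega>) (s j))"
  let ?B = "\<lambda>\<omega>. (norm (c \<omega>))\<^sup>2 + (\<Sum>j\<in>UNIV. (w j)\<^sup>2 * (2 * L\<^sup>2 * (norm (x j \<omega> - y j \<omega>))\<^sup>2 + 2 * \<beta>\<^sup>2 * (\<nu> j)\<^sup>2))"
  have [measurable]: "c \<in> borel_measurable (hist (Suc t))" "x j \<in> borel_measurable (hist (Suc t))"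
    "y j \<in> borel_measurable (hist (Suc t))" for j
    using c x y by (auto simp: adapted_L2_def)
  have [measurable]: "c \<in> borel_measurable M" "x j \<in> borel_measurable M" "y j \<in> borel_measurable M"
    "\<xi> (Suc t) (Suc 0) j \<in> borel_measurable M" for j
    using c x y adapted_L2_measurable sample_measurable[OF later_index] by blast+
  have d: "integrable M (\<lambda>\<omega>. (norm (x j \<omega> - y j \<omega>))\<^sup>2)" for j
    using adapted_L2_integrable[OF adapted_L2_diff[OF x y]] .
  \<comment> \<open>The outcome \<open>\<omega>\<close> is frozen: \<open>c\<close>,
    \<open>x\<close> and \<open>y\<close> become constants and only \<open>\<omega>'\<close> moves
    the samples, so the moment bounds for deterministic arguments apply.\<close>
  have inner: "expectation (\<lambda>\<omega>'. (norm (?N \<omega> (\<lambda>j. \<xi> (Suc t) (Suc 0) j \<omega>')))\<^sup>2) \<le> ?B \<omega>"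
    "integrable M (\<lambda>\<omega>'. (norm (?N \<omega> (\<lambda>j. \<xi> (Suc t) (Suc 0) j \<omega>')))\<^sup>2)" for \<omega>
  proof -
    let ?X = "\<lambda>j \<omega>'. w j *\<^sub>R noise \<beta> j (x j \<omega>) (y j \<omega>) (\<xi> (Suc t) (Suc 0) j \<omega>')"
    have Xm: "?X j \<in> borel_measurable M" for j
      using noise_measurable[of "\<lambda>_. x j \<omega>" M "\<lambda>_. y j \<omega>" "\<xi> (Suc t) (Suc 0) j" \<beta> j] by simp
    have "integrable M (\<lambda>\<omega>'. (norm (c \<omega> + (\<Sum>j\<in>UNIV. ?X j \<omega>')))\<^sup>2) \<and>
      expectation (\<lambda>\<omega>'. (norm (c \<omega> + (\<Sum>j\<in>UNIV. ?X j \<omega>')))\<^sup>2)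
        = (norm (c \<omega>))\<^sup>2 + (\<Sum>j\<in>UNIV. expectation (\<lambda>\<omega>'. (norm (?X j \<omega>'))\<^sup>2))"
    proof (rule expectation_norm_sq_sum_indep)
      show "integrable M (\<lambda>\<omega>'. (norm (?X j \<omega>'))\<^sup>2)" for j
        using noise_sq_integrable[OF later_index[of t j] \<beta>, where x = "x j \<omega>" and y = "y j \<omega>"] by (simp add: power_mult_distrib)
      show "expectation (?X j) = 0" for j
        using noise_mean[OF later_index[of t j] \<beta>, where x = "x j \<omega>" and y = "y j \<omega>"] by simp
      show "indep_var borel (?X i) borel (?X j)" if "i \<noteq> j" for i j
        by (rule indep_var_noise) (use that in \<open>auto intro: later_index\<close>)
    qed (simp_all add: Xm)
    moreover have "expectation (\<lambda>\<omega>'. (norm (?X j \<omega>'))\<^sup>2)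
        \<le> (w j)\<^sup>2 * (2 * L\<^sup>2 * (norm (x j \<omega> - y j \<omega>))\<^sup>2 + 2 * \<beta>\<^sup>2 * (\<nu> j)\<^sup>2)" for j
      using noise_variance[OF later_index[of t j] \<beta>, where x = "x j \<omega>" and y = "y j \<omega>"]
      by (simp add: power_mult_distrib mult_left_mono)
    ultimately show "expectation (\<lambda>\<omega>'. (norm (?N \<omega> (\<lambda>j. \<xi> (Suc t) (Suc 0) j \<omega>')))\<^sup>2) \<le> ?B \<omega>"
      "integrable M (\<lambda>\<omega>'. (norm (?N \<omega> (\<lambda>j. \<xi> (Suc t) (Suc 0) j \<omega>')))\<^sup>2)"
      by (auto intro: sum_mono)
  qed
  have noise_M: "(\<lambda>\<omega>. noise \<beta> j (x j \<omega>) (y j \<omega>) (\<xi> (Suc t) (Suc 0) j \<omega>)) \<in> borel_measurable M" for j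
    by (rule noise_measurable) measurable
  have noise_pair: "(\<lambda>z. noise \<beta> j (x j (fst z)) (y j (fst z)) (snd z j))
      \<in> borel_measurable (hist (Suc t) \<Otimes>\<^sub>M Pi\<^sub>M UNIV (\<lambda>_. borel))" for j
    by (rule noise_measurable) measurable
  have "(\<lambda>z. ennreal ((norm (?N (fst z) (snd z)))\<^sup>2)) \<in> borel_measurable (hist (Suc t) \<Otimes>\<^sub>M Pi\<^sub>M UNIV (\<lambda>_. borel))"
    using noise_pair by measurable
  from nn_integral_hist_sample[OF this]
  have "(\<integral>\<^sup>+\<omega>. ennreal ((norm (?N \<omega> (\<lambda>j. \<xi> (Suc t) (Suc 0) j \<omega>)))\<^sup>2) \<partial>M)
      = (\<integral>\<^sup>+\<omega>. (\<integral>\<^sup>+\<omega>'. ennreal ((norm (?N \<omega> (\<lambda>j. \<xi> (Suc t) (Suc 0) j \<omega>')))\<^sup>2) \<partial>M) \<partial>M)"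
    by simp
  also have "\<dots> \<le> (\<integral>\<^sup>+\<omega>. ennreal (?B \<omega>) \<partial>M)"
  proof (rule nn_integral_mono)
    fix \<omega>
    show "(\<integral>\<^sup>+\<omega>'. ennreal ((norm (?N \<omega> (\<lambda>j. \<xi> (Suc t) (Suc 0) j \<omega>')))\<^sup>2) \<partial>M) \<le> ennreal (?B \<omega>)"
      by (subst nn_integral_eq_integral[OF inner(2)]) (auto intro: ennreal_leI inner(1))
  qed
  finally have "integrable M (\<lambda>\<omega>. (norm (?N \<omega> (\<lambda>j. \<xi> (Suc t) (Suc 0) j \<omega>)))\<^sup>2) \<and>
      expectation (\<lambda>\<omega>. (norm (?N \<omega> (\<lambda>j. \<xi> (Suc t) (Suc 0) j \<omega>)))\<^sup>2) \<le> expectation ?B"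
    using c d noise_M
    by (intro expectation_le_of_nn_integral_le)
      (auto intro!: Bochner_Integration.integrable_add Bochner_Integration.integrable_sum integrable_mult_right
        sum_nonneg add_nonneg_nonneg mult_nonneg_nonneg simp: adapted_L2_integrable)
  moreover have "expectation ?B = expectation (\<lambda>\<omega>. (norm (c \<omega>))\<^sup>2)
        + (\<Sum>j\<in>UNIV. (w j)\<^sup>2 * (2 * L\<^sup>2 * expectation (\<lambda>\<omega>. (norm (x j \<omega> - y j \<omega>))\<^sup>2) + 2 * \<beta>\<^sup>2 * (\<nu> j)\<^sup>2))"
    using d adapted_L2_integrable[OF c] by (simp add: prob_space)
  ultimately show ?thesis by simp
qed

text \<open>An instance of \<open>noise_step\<close>: for weight 1 and equal points the noise is the
  deviation from the gradient, indicator coefficients select node \<open>i\<close>, and adding the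
  gradient restores the sample.\<close>

lemma adapted_L2_sample:
  assumes "adapted_L2 (Suc t) X"
  shows "adapted_L2 (Suc (Suc t)) (\<lambda>\<omega>. g i (X \<omega>) (\<xi> (Suc t) (Suc 0) i \<omega>))"
proof -
  have "integrable M (\<lambda>\<omega>. (norm (grad i (X \<omega>) + (\<Sum>j\<in>UNIV. (if j = i then 1 else 0) *\<^sub>R
      noise 1 j (X \<omega>) (X \<omega>) (\<xi> (Suc t) (Suc 0) j \<omega>))))\<^sup>2)"
    using noise_step[OF _ _ adapted_L2_grad[OF assms, of i] assms assms, of 1 "\<lambda>j. if j = i then 1 else 0"] by simp
  moreover have "grad i (X \<omega>) + (\<Sum>j\<in>UNIV. (if j = i then 1 else 0) *\<^sub>R
      noise 1 j (X \<omega>) (X \<omega>) (\<xi> (Suc t) (Suc 0) j \<omega>)) = g i (X \<omega>) (\<xi> (Suc t) (Suc 0) i \<omega>)" for \<omega>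
    by (simp add: noise_def if_distrib[where f = "\<lambda>c. c *\<^sub>R _"] sum.delta cong: if_cong)
  ultimately have "integrable M (\<lambda>\<omega>. (norm (g i (X \<omega>) (\<xi> (Suc t) (Suc 0) i \<omega>)))\<^sup>2)" by simp
  moreover have "(\<lambda>\<omega>. g i (X \<omega>) (\<xi> (Suc t) (Suc 0) i \<omega>)) \<in> borel_measurable (hist (Suc (Suc t)))"
  proof (rule g_measurable)
    show "X \<in> borel_measurable (hist (Suc (Suc t)))"
      using adapted_L2_mono[OF assms, of "Suc (Suc t)"] by (simp add: adapted_L2_def)
    show "\<xi> (Suc t) (Suc 0) i \<in> borel_measurable (hist (Suc (Suc t)))"
      by (rule sample_hist_measurable[OF later_index]) simp
  qed
  ultimately show ?thesis by (simp add: adapted_L2_def)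
qed

lemma adapted_L2_initial_sample:
  assumes "r \<in> {1..b0}"
  shows "adapted_L2 (Suc 0) (\<lambda>\<omega>. g i x (\<xi> 0 r i \<omega>))"
proof -
  note k = initial_index[OF assms, of i]
  have g [measurable]: "(\<lambda>\<omega>. g i x (\<xi> 0 r i \<omega>)) \<in> borel_measurable M"
    by (intro g_measurable borel_measurable_const sample_measurable k)
  have "integrable M (\<lambda>\<omega>. (norm ((g i x (\<xi> 0 r i \<omega>) - grad i x) + grad i x))\<^sup>2)"
    by (intro sq_integrable_add oracle_deviation(1)[OF k]) auto
  moreover have "(\<lambda>\<omega>. g i x (\<xi> 0 r i \<omega>)) \<in> borel_measurable (hist (Suc 0))"
    by (intro g_measurable borel_measurable_const sample_hist_measurable[OF k]) simp
  ultimately show ?thesis by (simp add: adapted_L2_def)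
qed

end

subsection \<open>Expected errors of the iterates\<close>

lemma sum_indicator_scaleR:
  fixes u :: "'n::finite \<Rightarrow> 'a::real_vector"
  shows "(\<Sum>j\<in>UNIV. (if j = i then 1 else 0) *\<^sub>R u j) = u i"
  by (simp add: if_distrib[where f = "\<lambda>c. c *\<^sub>R _"] cong: if_cong)

lemma sum_indicator_sq_mult:
  fixes c :: "'n::finite \<Rightarrow> real"
  shows "(\<Sum>j\<in>UNIV. (if j = i then 1 else 0)\<^sup>2 * c j) = c i"
  by (simp add: if_distrib[where f = "\<lambda>x. x\<^sup>2 * _"] cong: if_cong)

lemma avg_eq_sum_scaleR: "avg u = (\<Sum>j\<in>UNIV. (1 / real CARD('n)) *\<^sub>R u j)" for u :: "'n::finite \<Rightarrow> 'a::real_vector"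
  by (simp add: avg_def scaleR_sum_right)

locale gt_hsgd = stochastic_oracle M f g \<xi> \<nu> L b0
  for M :: "'w measure"
    and f :: "'n::finite \<Rightarrow> real^'p \<Rightarrow> real"
    and g :: "'n \<Rightarrow> real^'p \<Rightarrow> real^'q \<Rightarrow> real^'p"
    and \<xi> :: "nat \<Rightarrow> nat \<Rightarrow> 'n \<Rightarrow> 'w \<Rightarrow> real^'q"
    and \<nu> :: "'n \<Rightarrow> real"
    and L :: real
    and b0 :: nat +
  fixes W :: "real^'n^'n"
    and \<alpha> \<beta> lam :: real
    and x0 :: "real^'p"
  assumes ds: "doubly_stochastic W"
    and lam_def: "lam = mixing_rate W" and lam_nonneg: "0 \<le> lam" and lam_less: "lam < 1"
    and \<alpha>_pos: "0 < \<alpha>" and \<beta>_nonneg: "0 \<le> \<beta>" and \<beta>_le: "\<beta> \<le> 1"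
begin

section \<open>Pathwise identities for the iterates\<close>

abbreviation "xs t i \<omega> \<equiv> hsgd_x W g \<alpha> \<beta> b0 x0 (\<lambda>t r i. \<xi> t r i \<omega>) t i"
abbreviation "ys t i \<omega> \<equiv> hsgd_y W g \<alpha> \<beta> b0 x0 (\<lambda>t r i. \<xi> t r i \<omega>) t i"
abbreviation "vs t i \<omega> \<equiv> hsgd_v W g \<alpha> \<beta> b0 x0 (\<lambda>t r i. \<xi> t r i \<omega>) t i"

abbreviation "err t i \<omega> \<equiv> vs t i \<omega> - grad i (xs t i \<omega>)"
abbreviation "inc t i \<omega> \<equiv> xs (Suc t) i \<omega> - xs t i \<omega>"
abbreviation "nse t i \<omega> \<equiv> noise \<beta> i (xs (Suc t) i \<omega>) (xs t i \<omega>) (\<xi> (Suc t) (Suc 0) i \<omega>)"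

lemma xs_Suc: "xs (Suc t) i \<omega> = mix W (\<lambda>j. xs t j \<omega> - \<alpha> *\<^sub>R ys (Suc t) j \<omega>) i"
  unfolding mix_def by (rule hsgd_x.simps)

lemma ys_1: "ys (Suc 0) i \<omega> = mix W (\<lambda>j. vs 0 j \<omega>) i"
  by (simp add: mix_def)

lemma ys_Suc_Suc: "ys (Suc (Suc t)) i \<omega> = mix W (\<lambda>j. ys (Suc t) j \<omega> + (vs (Suc t) j \<omega> - vs t j \<omega>)) i"
  unfolding mix_def by (subst hsgd_y.simps) (simp add: add_diff_eq del: hsgd_y.simps hsgd_v.simps)

lemma err_Suc: "err (Suc t) i \<omega> = (1 - \<beta>) *\<^sub>R err t i \<omega> + nse t i \<omega>"
  unfolding noise_def by (subst hsgd_v.simps) (simp add: algebra_simps del: hsgd_x.simps hsgd_v.simps)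

declare hsgd_x.simps(2) [simp del] hsgd_y.simps(2) [simp del] hsgd_v.simps [simp del]

lemma vs_diff: "vs (Suc t) i \<omega> - vs t i \<omega>
    = (grad i (xs (Suc t) i \<omega>) - grad i (xs t i \<omega>) - \<beta> *\<^sub>R err t i \<omega>) + nse t i \<omega>"
  using err_Suc[where t = t and i = i and \<omega> = \<omega>] by (simp add: algebra_simps)

text \<open>The conservation law of gradient tracking: mixing preserves averages and the differences
  of estimators telescope. Hence the averaged iterate moves exactly along the averaged
  estimator.\<close>

lemma avg_ys: "avg (\<lambda>i. ys (Suc t) i \<omega>) = avg (\<lambda>i. vs t i \<omega>)"
proof (induction t)
  case 0
  show ?case unfolding ys_1 using avg_mix[OF ds] .
next
  case (Suc t)
  show ?case unfolding ys_Suc_Suc avg_mix[OF ds] by (simp add: avg_add avg_diff Suc)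
qed

lemma avg_xs_Suc: "avg (\<lambda>i. xs (Suc t) i \<omega>) = avg (\<lambda>i. xs t i \<omega>) - \<alpha> *\<^sub>R avg (\<lambda>i. vs t i \<omega>)"
  unfolding xs_Suc avg_mix[OF ds] by (simp add: avg_diff avg_scaleR avg_ys)

text \<open>The three claims feed each other, and their offsets matter: \<open>xs t\<close> depends
  on samples before \<open>t\<close>, while \<open>vs t\<close> and \<open>ys (Suc t)\<close> also
  use those of time \<open>t\<close>.\<close>

lemma iterates_L2:
  "(\<forall>i. adapted_L2 t (xs t i)) \<and> (\<forall>i. adapted_L2 (Suc t) (ys (Suc t) i)) \<and> (\<forall>i. adapted_L2 (Suc t) (vs t i))"
proof (induction t)
  case 0
  have v: "adapted_L2 (Suc 0) (vs 0 i)" for i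
    unfolding hsgd_v.simps(1) hsgd_x.simps(1)
    by (intro adapted_L2_scaleR adapted_L2_sum adapted_L2_initial_sample)
  have "adapted_L2 (Suc 0) (ys (Suc 0) i)" for i
    unfolding ys_1 by (rule adapted_L2_mix[OF v])
  with v show ?case by (simp add: adapted_L2_const)
next
  case (Suc t)
  then have x: "adapted_L2 t (xs t i)" and y: "adapted_L2 (Suc t) (ys (Suc t) i)"
    and v: "adapted_L2 (Suc t) (vs t i)" for i by auto
  have x_le: "adapted_L2 (Suc t) (xs t i)" for i by (rule adapted_L2_mono[OF x]) simp
  have x': "adapted_L2 (Suc t) (xs (Suc t) i)" for i
    unfolding xs_Suc by (intro adapted_L2_mix adapted_L2_diff adapted_L2_scaleR x_le y)
  have up: "adapted_L2 (Suc (Suc t)) X" if "adapted_L2 (Suc t) X" for X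
    using that by (rule adapted_L2_mono) simp
  have v': "adapted_L2 (Suc (Suc t)) (vs (Suc t) i)" for i
    unfolding hsgd_v.simps(2) One_nat_def
    by (intro adapted_L2_add adapted_L2_scaleR adapted_L2_diff adapted_L2_sample x' x_le up[OF v])
  have y': "adapted_L2 (Suc (Suc t)) (ys (Suc (Suc t)) i)" for i
    unfolding ys_Suc_Suc by (intro adapted_L2_mix adapted_L2_add adapted_L2_diff v' up y v)
  show ?case using x' y' v' by blast
qed

lemma xs_L2: "adapted_L2 t (xs t i)" and ys_L2: "adapted_L2 (Suc t) (ys (Suc t) i)"
  and vs_L2: "adapted_L2 (Suc t) (vs t i)"
  using iterates_L2[of t] by auto

lemma xs_L2_Suc: "adapted_L2 (Suc t) (xs t i)"
  by (rule adapted_L2_mono[OF xs_L2]) simp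

lemma err_L2: "adapted_L2 (Suc t) (err t i)"
  by (intro adapted_L2_diff vs_L2 adapted_L2_grad xs_L2_Suc)

lemma inc_L2: "adapted_L2 (Suc t) (inc t i)"
  by (intro adapted_L2_diff xs_L2 xs_L2_Suc)

lemma spread_integrable:
  assumes "\<And>i. adapted_L2 t (X i)"
  shows "integrable M (\<lambda>\<omega>. spread (\<lambda>i. X i \<omega>))"
  unfolding spread_def
  by (intro Bochner_Integration.integrable_sum adapted_L2_integrable[where t = t] adapted_L2_diff adapted_L2_avg assms)

lemma spread_xs_integrable: "integrable M (\<lambda>\<omega>. spread (\<lambda>i. xs t i \<omega>))"
  by (rule spread_integrable[OF xs_L2])

lemma spread_ys_integrable: "integrable M (\<lambda>\<omega>. spread (\<lambda>i. ys (Suc t) i \<omega>))"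
  by (rule spread_integrable[OF ys_L2])

lemma avg_vs_integrable: "integrable M (\<lambda>\<omega>. (norm (avg (\<lambda>i. vs t i \<omega>)))\<^sup>2)"
  by (rule adapted_L2_integrable[OF adapted_L2_avg[OF vs_L2]])

lemma avg_err_integrable: "integrable M (\<lambda>\<omega>. (norm (avg (\<lambda>i. err t i \<omega>)))\<^sup>2)"
  by (rule adapted_L2_integrable[OF adapted_L2_avg[OF err_L2]])

lemma err_integrable: "integrable M (\<lambda>\<omega>. (norm (err t i \<omega>))\<^sup>2)"
  by (rule adapted_L2_integrable[OF err_L2])

lemma inc_integrable: "integrable M (\<lambda>\<omega>. (norm (inc t i \<omega>))\<^sup>2)"
  by (rule adapted_L2_integrable[OF inc_L2])

section \<open>Expected errors and their initial values\<close>

definition "x_spread t = expectation (\<lambda>\<omega>. spread (\<lambda>i. xs t i \<omega>))"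
definition "y_spread t = expectation (\<lambda>\<omega>. spread (\<lambda>i. ys t i \<omega>))"
definition "v_avg_sq t = expectation (\<lambda>\<omega>. (norm (avg (\<lambda>i. vs t i \<omega>)))\<^sup>2)"
definition "avg_err_sq t = expectation (\<lambda>\<omega>. (norm (avg (\<lambda>i. err t i \<omega>)))\<^sup>2)"
definition "err_sq t = (\<Sum>i\<in>UNIV. expectation (\<lambda>\<omega>. (norm (err t i \<omega>))\<^sup>2))"
definition "inc_sq t = (\<Sum>i\<in>UNIV. expectation (\<lambda>\<omega>. (norm (inc t i \<omega>))\<^sup>2))"

definition "total_var = (\<Sum>i\<in>UNIV. (\<nu> i)\<^sup>2)"

text \<open>Pairs of a node and a minibatch position index one independent family with coefficients
  \<open>w j / b0\<close>; the \<open>b0\<close> terms of a node turn \<open>1 / b0^2\<close> into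
  \<open>1 / b0\<close>. The free \<open>c\<close> and \<open>w\<close> let the averaged error, each
  local error and the first tracker be instances.\<close>

lemma initial_step:
  "expectation (\<lambda>\<omega>. (norm (c + (\<Sum>j\<in>UNIV. w j *\<^sub>R (vs 0 j \<omega> - grad j x0))))\<^sup>2)
    \<le> (norm c)\<^sup>2 + (\<Sum>j\<in>UNIV. (w j)\<^sup>2 * ((\<nu> j)\<^sup>2 / real b0))"
proof -
  have b: "real b0 > 0" using b0_pos by simp
  let ?K = "UNIV \<times> {1..b0} :: ('n \<times> nat) set"
  let ?X = "\<lambda>(j, r) \<omega>. (w j / real b0) *\<^sub>R noise 1 j x0 x0 (\<xi> 0 r j \<omega>)"
  have noise1: "noise 1 j x0 x0 s = g j x0 s - grad j x0" for j s by (simp add: noise_def)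
  have "vs 0 j \<omega> - grad j x0 = (\<Sum>r=1..b0. (1 / real b0) *\<^sub>R noise 1 j x0 x0 (\<xi> 0 r j \<omega>))" for j \<omega>
    unfolding noise1 using b
    by (simp add: hsgd_v.simps scaleR_sum_right[symmetric] sum_subtractf scaleR_right_diff_distrib sum_constant_scaleR
        del: sum_constant)
  then have eq: "(\<Sum>j\<in>UNIV. w j *\<^sub>R (vs 0 j \<omega> - grad j x0)) = (\<Sum>k\<in>?K. ?X k \<omega>)" for \<omega>
    by (simp add: sum.cartesian_product split_def scaleR_sum_right)
  have k: "(0, r, j) \<in> sample_index b0" if "(j, r) \<in> ?K" for j r using that by (intro initial_index) simp
  have "expectation (\<lambda>\<omega>. (norm (c + (\<Sum>k\<in>?K. ?X k \<omega>)))\<^sup>2)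
      = (norm c)\<^sup>2 + (\<Sum>k\<in>?K. expectation (\<lambda>\<omega>. (norm (?X k \<omega>))\<^sup>2))"
  proof (rule conjunct2[OF expectation_norm_sq_sum_indep])
    show "?X k \<in> borel_measurable M" if "k \<in> ?K" for k
    proof -
      obtain j r where [simp]: "k = (j, r)" by (cases k)
      have "\<xi> 0 r j \<in> borel_measurable M" by (rule sample_measurable) (use that in \<open>intro k, simp\<close>)
      from noise_measurable[OF borel_measurable_const borel_measurable_const this]
      show ?thesis by simp
    qed
    show "integrable M (\<lambda>\<omega>. (norm (?X k \<omega>))\<^sup>2)" if "k \<in> ?K" for k
      using noise_sq_integrable[OF k[of "fst k" "snd k"], of 1] that by (auto simp: power_mult_distrib power_divide split: prod.split)
    show "expectation (?X k) = 0" if "k \<in> ?K" for k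
      using noise_mean[OF k[of "fst k" "snd k"], of 1] that by (auto split: prod.split)
    show "indep_var borel (?X k) borel (?X k')" if "k \<in> ?K" "k' \<in> ?K" "k \<noteq> k'" for k k'
    proof -
      obtain j r j' r' where [simp]: "k = (j, r)" "k' = (j', r')" by (metis surj_pair)
      show ?thesis using that by (simp, intro indep_var_noise k) auto
    qed
  qed simp
  also have "\<dots> \<le> (norm c)\<^sup>2 + (\<Sum>(j, r)\<in>?K. (w j / real b0)\<^sup>2 * (\<nu> j)\<^sup>2)"
  proof (intro add_left_mono sum_mono)
    fix k assume "k \<in> ?K"
    then show "expectation (\<lambda>\<omega>. (norm (?X k \<omega>))\<^sup>2) \<le> (case k of (j, r) \<Rightarrow> (w j / real b0)\<^sup>2 * (\<nu> j)\<^sup>2)"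
      using oracle_deviation(2)[OF k[of "fst k" "snd k"], of x0]
      by (cases k) (auto simp: noise1 power_mult_distrib power_divide intro!: divide_right_mono mult_left_mono)
  qed
  also have "(\<Sum>(j, r)\<in>?K. (w j / real b0)\<^sup>2 * (\<nu> j)\<^sup>2) = (\<Sum>j\<in>UNIV. (w j)\<^sup>2 * ((\<nu> j)\<^sup>2 / real b0))"
    using b by (simp add: sum.cartesian_product[symmetric] power_divide power2_eq_square)
  finally show ?thesis unfolding eq .
qed

lemma avg_err_sq_0: "avg_err_sq 0 \<le> total_var / ((real CARD('n))\<^sup>2 * real b0)"
proof -
  have "avg_err_sq 0 \<le> (\<Sum>j\<in>UNIV. (1 / real CARD('n))\<^sup>2 * ((\<nu> j)\<^sup>2 / real b0))"
    using initial_step[of 0 "\<lambda>_. 1 / real CARD('n)"] by (simp add: avg_err_sq_def avg_eq_sum_scaleR)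
  also have "\<dots> = total_var / ((real CARD('n))\<^sup>2 * real b0)"
    by (simp add: total_var_def sum_divide_distrib power_divide)
  finally show ?thesis .
qed

lemma err_sq_0: "err_sq 0 \<le> total_var / real b0"
proof -
  have "expectation (\<lambda>\<omega>. (norm (err 0 i \<omega>))\<^sup>2) \<le> (\<nu> i)\<^sup>2 / real b0" for i
    using initial_step[of 0 "\<lambda>j. if j = i then 1 else 0"] unfolding sum_indicator_scaleR sum_indicator_sq_mult by simp
  then show ?thesis unfolding err_sq_def total_var_def sum_divide_distrib by (rule sum_mono)
qed

lemma y_spread_1:
  "y_spread (Suc 0) \<le> lam\<^sup>2 * ((\<Sum>i\<in>UNIV. (norm (grad i x0))\<^sup>2) + total_var / real b0)"
proof -
  have v: "expectation (\<lambda>\<omega>. (norm (vs 0 i \<omega>))\<^sup>2) \<le> (norm (grad i x0))\<^sup>2 + (\<nu> i)\<^sup>2 / real b0" for i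
    using initial_step[of "grad i x0" "\<lambda>j. if j = i then 1 else 0"]
    unfolding sum_indicator_scaleR sum_indicator_sq_mult by simp
  have vint: "integrable M (\<lambda>\<omega>. (norm (vs 0 i \<omega>))\<^sup>2)" for i by (rule adapted_L2_integrable[OF vs_L2])
  have "y_spread (Suc 0) \<le> expectation (\<lambda>\<omega>. lam\<^sup>2 * (\<Sum>i\<in>UNIV. (norm (vs 0 i \<omega>))\<^sup>2))"
    unfolding y_spread_def
  proof (rule integral_mono[OF spread_ys_integrable])
    show "spread (\<lambda>i. ys (Suc 0) i \<omega>) \<le> lam\<^sup>2 * (\<Sum>i\<in>UNIV. (norm (vs 0 i \<omega>))\<^sup>2)" for \<omega>
      unfolding ys_1 spread_mix[OF ds] lam_def mixing_rate_eq by (rule sum_norm_sq_mix_le)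
  qed (use vint in simp)
  also have "\<dots> = lam\<^sup>2 * (\<Sum>i\<in>UNIV. expectation (\<lambda>\<omega>. (norm (vs 0 i \<omega>))\<^sup>2))" using vint by simp
  also have "\<dots> \<le> lam\<^sup>2 * (\<Sum>i\<in>UNIV. (norm (grad i x0))\<^sup>2 + (\<nu> i)\<^sup>2 / real b0)"
    by (intro mult_left_mono sum_mono v) simp
  finally show ?thesis by (simp add: sum.distrib total_var_def sum_divide_distrib)
qed

section \<open>One-step recursions\<close>

lemma sum_step_variance:
  "(\<Sum>j\<in>UNIV. 2 * L\<^sup>2 * expectation (\<lambda>\<omega>. (norm (inc t j \<omega>))\<^sup>2) + 2 * \<beta>\<^sup>2 * (\<nu> j)\<^sup>2)
    = 2 * \<beta>\<^sup>2 * total_var + 2 * L\<^sup>2 * inc_sq t"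
  by (simp add: sum.distrib total_var_def inc_sq_def sum_distrib_left)

lemma avg_err_sq_Suc:
  "avg_err_sq (Suc t) \<le> (1 - \<beta>)\<^sup>2 * avg_err_sq t
    + (2 * \<beta>\<^sup>2 * total_var + 2 * L\<^sup>2 * inc_sq t) / (real CARD('n))\<^sup>2"
proof -
  let ?c = "\<lambda>\<omega>. (1 - \<beta>) *\<^sub>R avg (\<lambda>i. err t i \<omega>)"
  have eq: "avg (\<lambda>i. err (Suc t) i \<omega>) = ?c \<omega> + (\<Sum>j\<in>UNIV. (1 / real CARD('n)) *\<^sub>R nse t j \<omega>)" for \<omega>
    unfolding err_Suc avg_add avg_scaleR avg_eq_sum_scaleR[of "\<lambda>j. nse t j \<omega>"] ..
  have "avg_err_sq (Suc t) \<le> expectation (\<lambda>\<omega>. (norm (?c \<omega>))\<^sup>2)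
      + (\<Sum>j\<in>UNIV. (1 / real CARD('n))\<^sup>2 * (2 * L\<^sup>2 * expectation (\<lambda>\<omega>. (norm (inc t j \<omega>))\<^sup>2) + 2 * \<beta>\<^sup>2 * (\<nu> j)\<^sup>2))"
    unfolding avg_err_sq_def eq
    by (rule conjunct2[OF noise_step[OF \<beta>_nonneg \<beta>_le adapted_L2_scaleR[OF adapted_L2_avg[OF err_L2]] xs_L2 xs_L2_Suc]])
  also have "\<dots> = (1 - \<beta>)\<^sup>2 * avg_err_sq t + (2 * \<beta>\<^sup>2 * total_var + 2 * L\<^sup>2 * inc_sq t) / (real CARD('n))\<^sup>2"
    unfolding sum_distrib_left[symmetric] sum_step_variance by (simp add: avg_err_sq_def power_mult_distrib power_divide)
  finally show ?thesis .
qed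

lemma err_sq_Suc:
  "err_sq (Suc t) \<le> (1 - \<beta>)\<^sup>2 * err_sq t + (2 * \<beta>\<^sup>2 * total_var + 2 * L\<^sup>2 * inc_sq t)"
proof -
  have "expectation (\<lambda>\<omega>. (norm (err (Suc t) i \<omega>))\<^sup>2) \<le> (1 - \<beta>)\<^sup>2 * expectation (\<lambda>\<omega>. (norm (err t i \<omega>))\<^sup>2)
      + (2 * L\<^sup>2 * expectation (\<lambda>\<omega>. (norm (inc t i \<omega>))\<^sup>2) + 2 * \<beta>\<^sup>2 * (\<nu> i)\<^sup>2)" for i
    using conjunct2[OF noise_step[where w = "\<lambda>j. if j = i then 1 else 0", OF \<beta>_nonneg \<beta>_le
        adapted_L2_scaleR[where c = "1 - \<beta>", OF err_L2[where t = t and i = i]] xs_L2 xs_L2_Suc]]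
    unfolding sum_indicator_scaleR sum_indicator_sq_mult err_Suc by (simp add: power_mult_distrib)
  then have "err_sq (Suc t) \<le> (\<Sum>i\<in>UNIV. (1 - \<beta>)\<^sup>2 * expectation (\<lambda>\<omega>. (norm (err t i \<omega>))\<^sup>2)
      + (2 * L\<^sup>2 * expectation (\<lambda>\<omega>. (norm (inc t i \<omega>))\<^sup>2) + 2 * \<beta>\<^sup>2 * (\<nu> i)\<^sup>2))"
    unfolding err_sq_def by (rule sum_mono)
  then show ?thesis
    unfolding sum.distrib[of "\<lambda>i. (1 - \<beta>)\<^sup>2 * _ i"] sum_step_variance err_sq_def sum_distrib_left .
qed

text \<open>Only \<open>?d\<close>, which is determined by the past, passes through Young's
  inequality and pays the gap factor. The noise is split off beforehand by orthogonality and is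
  weighted with squared matrix entries, whose column sums are at most \<open>lam^2\<close>. The
  mixed noises of different rows are correlated, but only their squared norms are added.\<close>

lemma y_spread_Suc:
  "y_spread (Suc (Suc t)) \<le> (1 + lam\<^sup>2) / 2 * y_spread (Suc t)
    + 2 * lam\<^sup>2 / (1 - lam\<^sup>2) * (2 * L\<^sup>2 * inc_sq t + 2 * \<beta>\<^sup>2 * err_sq t)
    + lam\<^sup>2 * (2 * \<beta>\<^sup>2 * total_var + 2 * L\<^sup>2 * inc_sq t)"
proof -
  let ?A = "deviation_matrix W"
  let ?d = "\<lambda>j \<omega>. grad j (xs (Suc t) j \<omega>) - grad j (xs t j \<omega>) - \<beta> *\<^sub>R err t j \<omega>"
  let ?c = "\<lambda>i \<omega>. mix ?A (\<lambda>j. ys (Suc t) j \<omega> + ?d j \<omega>) i"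
  let ?s = "\<lambda>j. 2 * L\<^sup>2 * expectation (\<lambda>\<omega>. (norm (inc t j \<omega>))\<^sup>2) + 2 * \<beta>\<^sup>2 * (\<nu> j)\<^sup>2"
  have q: "0 < 1 - lam\<^sup>2" using lam_nonneg lam_less by (simp add: power_less_one_iff)
  have c_L2: "adapted_L2 (Suc t) (?c i)" for i
    by (intro adapted_L2_mix adapted_L2_add adapted_L2_diff adapted_L2_scaleR adapted_L2_grad
        ys_L2 xs_L2 xs_L2_Suc vs_L2)
  have eq: "spread (\<lambda>i. ys (Suc (Suc t)) i \<omega>) = (\<Sum>i\<in>UNIV. (norm (?c i \<omega> + (\<Sum>j\<in>UNIV. ?A $ i $ j *\<^sub>R nse t j \<omega>)))\<^sup>2)" for \<omega>
    unfolding ys_Suc_Suc spread_mix[OF ds] vs_diff add.assoc[symmetric] mix_add[of ?A _ "\<lambda>j. nse t j \<omega>"]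
    by (simp only: mix_def[of ?A "\<lambda>j. nse t j \<omega>"])
  note step = noise_step[OF \<beta>_nonneg \<beta>_le c_L2 xs_L2 xs_L2_Suc]
  have "y_spread (Suc (Suc t)) = (\<Sum>i\<in>UNIV. expectation (\<lambda>\<omega>. (norm (?c i \<omega> + (\<Sum>j\<in>UNIV. ?A $ i $ j *\<^sub>R nse t j \<omega>)))\<^sup>2))"
    unfolding y_spread_def eq by (rule Bochner_Integration.integral_sum) (rule conjunct1[OF step])
  also have "\<dots> \<le> (\<Sum>i\<in>UNIV. expectation (\<lambda>\<omega>. (norm (?c i \<omega>))\<^sup>2) + (\<Sum>j\<in>UNIV. (?A $ i $ j)\<^sup>2 * ?s j))"
    by (intro sum_mono conjunct2[OF step])
  also have "\<dots> = expectation (\<lambda>\<omega>. \<Sum>i\<in>UNIV. (norm (?c i \<omega>))\<^sup>2) + (\<Sum>j\<in>UNIV. (\<Sum>i\<in>UNIV. (?A $ i $ j)\<^sup>2) * ?s j)"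
    unfolding sum.distrib sum_distrib_right
    by (subst Bochner_Integration.integral_sum) (auto intro: adapted_L2_integrable[OF c_L2] sum.swap)
  finally have le: "y_spread (Suc (Suc t)) \<le> expectation (\<lambda>\<omega>. \<Sum>i\<in>UNIV. (norm (?c i \<omega>))\<^sup>2)
      + (\<Sum>j\<in>UNIV. (\<Sum>i\<in>UNIV. (?A $ i $ j)\<^sup>2) * ?s j)" .
  have s_nonneg: "0 \<le> ?s j" for j by simp
  have "(\<Sum>j\<in>UNIV. (\<Sum>i\<in>UNIV. (?A $ i $ j)\<^sup>2) * ?s j) \<le> (\<Sum>j\<in>UNIV. lam\<^sup>2 * ?s j)"
    unfolding lam_def mixing_rate_eq by (intro sum_mono mult_right_mono column_norm_sq_le s_nonneg)
  also have "\<dots> = lam\<^sup>2 * (2 * \<beta>\<^sup>2 * total_var + 2 * L\<^sup>2 * inc_sq t)"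
    unfolding sum_distrib_left[symmetric] sum_step_variance ..
  finally have var: "(\<Sum>j\<in>UNIV. (\<Sum>i\<in>UNIV. (?A $ i $ j)\<^sup>2) * ?s j)
      \<le> lam\<^sup>2 * (2 * \<beta>\<^sup>2 * total_var + 2 * L\<^sup>2 * inc_sq t)" .
  let ?R = "\<lambda>\<omega>. 2 * L\<^sup>2 * (\<Sum>j\<in>UNIV. (norm (inc t j \<omega>))\<^sup>2) + 2 * \<beta>\<^sup>2 * (\<Sum>j\<in>UNIV. (norm (err t j \<omega>))\<^sup>2)"
  have R_int: "integrable M ?R"
    by (intro Bochner_Integration.integrable_add integrable_mult_right Bochner_Integration.integrable_sum
        inc_integrable err_integrable)
  have d_le: "(\<Sum>j\<in>UNIV. (norm (?d j \<omega>))\<^sup>2) \<le> ?R \<omega>" for \<omega>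
  proof -
    have "(norm (?d j \<omega>))\<^sup>2 \<le> 2 * L\<^sup>2 * (norm (inc t j \<omega>))\<^sup>2 + 2 * \<beta>\<^sup>2 * (norm (err t j \<omega>))\<^sup>2" for j
    proof -
      have "(norm (grad j (xs (Suc t) j \<omega>) - grad j (xs t j \<omega>)))\<^sup>2 \<le> (L * norm (inc t j \<omega>))\<^sup>2"
        by (intro power_mono grad_lipschitz) simp
      then show ?thesis
        using norm_sq_diff_le[of "grad j (xs (Suc t) j \<omega>) - grad j (xs t j \<omega>)" "\<beta> *\<^sub>R err t j \<omega>"]
        by (simp add: power_mult_distrib)
    qed
    then show ?thesis unfolding sum_distrib_left sum.distrib[symmetric] by (rule sum_mono)
  qed
  have "expectation (\<lambda>\<omega>. \<Sum>i\<in>UNIV. (norm (?c i \<omega>))\<^sup>2)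
      \<le> expectation (\<lambda>\<omega>. (1 + lam\<^sup>2) / 2 * spread (\<lambda>i. ys (Suc t) i \<omega>) + 2 * lam\<^sup>2 / (1 - lam\<^sup>2) * ?R \<omega>)"
  proof (rule integral_mono)
    show "integrable M (\<lambda>\<omega>. \<Sum>i\<in>UNIV. (norm (?c i \<omega>))\<^sup>2)"
      by (intro Bochner_Integration.integrable_sum adapted_L2_integrable[OF c_L2])
    show "integrable M (\<lambda>\<omega>. (1 + lam\<^sup>2) / 2 * spread (\<lambda>i. ys (Suc t) i \<omega>) + 2 * lam\<^sup>2 / (1 - lam\<^sup>2) * ?R \<omega>)"
      by (intro Bochner_Integration.integrable_add integrable_mult_right spread_ys_integrable R_int)
    fix \<omega>
    have "(\<Sum>i\<in>UNIV. (norm (?c i \<omega>))\<^sup>2) \<le> (1 + lam\<^sup>2) / 2 * spread (\<lambda>i. ys (Suc t) i \<omega>)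
        + 2 * lam\<^sup>2 / (1 - lam\<^sup>2) * (\<Sum>j\<in>UNIV. (norm (?d j \<omega>))\<^sup>2)"
      by (rule sum_mix_deviation_young[OF ds lam_def lam_nonneg lam_less])
    also have "\<dots> \<le> (1 + lam\<^sup>2) / 2 * spread (\<lambda>i. ys (Suc t) i \<omega>) + 2 * lam\<^sup>2 / (1 - lam\<^sup>2) * ?R \<omega>"
      using q by (intro add_left_mono mult_left_mono d_le) simp
    finally show "(\<Sum>i\<in>UNIV. (norm (?c i \<omega>))\<^sup>2)
        \<le> (1 + lam\<^sup>2) / 2 * spread (\<lambda>i. ys (Suc t) i \<omega>) + 2 * lam\<^sup>2 / (1 - lam\<^sup>2) * ?R \<omega>" .
  qed
  also have "\<dots> = (1 + lam\<^sup>2) / 2 * y_spread (Suc t) + 2 * lam\<^sup>2 / (1 - lam\<^sup>2) * expectation ?R"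
    unfolding y_spread_def using spread_ys_integrable R_int by simp
  also have "expectation ?R = 2 * L\<^sup>2 * inc_sq t + 2 * \<beta>\<^sup>2 * err_sq t"
    unfolding inc_sq_def err_sq_def using inc_integrable err_integrable by simp
  finally show ?thesis using le var by linarith
qed

lemma x_spread_0: "x_spread 0 = 0"
  by (simp add: x_spread_def)

lemma x_spread_Suc:
  "x_spread (Suc t) \<le> (1 + lam\<^sup>2) / 2 * x_spread t + 2 * lam\<^sup>2 / (1 - lam\<^sup>2) * (\<alpha>\<^sup>2 * y_spread (Suc t))"
proof -
  have "spread (\<lambda>i. xs (Suc t) i \<omega>)
      \<le> (1 + lam\<^sup>2) / 2 * spread (\<lambda>i. xs t i \<omega>) + 2 * lam\<^sup>2 / (1 - lam\<^sup>2) * (\<alpha>\<^sup>2 * spread (\<lambda>i. ys (Suc t) i \<omega>))" for \<omega>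
  proof -
    let ?y = "avg (\<lambda>i. ys (Suc t) i \<omega>)"
    \<comment> \<open>The deviation matrix does not see a common multiple of \<open>?y\<close>; the
      perturbation thus becomes the deviation of the trackers instead of their full size.\<close>
    have "mix (deviation_matrix W) (\<lambda>j. xs t j \<omega> - \<alpha> *\<^sub>R ys (Suc t) j \<omega>) i
        = mix (deviation_matrix W) (\<lambda>j. xs t j \<omega> + (- \<alpha>) *\<^sub>R (ys (Suc t) j \<omega> - ?y)) i" for i
      using mix_deviation_const[OF ds, of "\<lambda>j. xs t j \<omega> - \<alpha> *\<^sub>R ys (Suc t) j \<omega>" "- \<alpha> *\<^sub>R ?y" i]
      by (simp add: algebra_simps)
    then have "spread (\<lambda>i. xs (Suc t) i \<omega>)
        = (\<Sum>i\<in>UNIV. (norm (mix (deviation_matrix W) (\<lambda>j. xs t j \<omega> + (- \<alpha>) *\<^sub>R (ys (Suc t) j \<omega> - ?y)) i))\<^sup>2)"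
      unfolding xs_Suc spread_mix[OF ds] by simp
    also have "\<dots> \<le> (1 + lam\<^sup>2) / 2 * spread (\<lambda>i. xs t i \<omega>)
        + 2 * lam\<^sup>2 / (1 - lam\<^sup>2) * (\<Sum>j\<in>UNIV. (norm ((- \<alpha>) *\<^sub>R (ys (Suc t) j \<omega> - ?y)))\<^sup>2)"
      by (rule sum_mix_deviation_young[OF ds lam_def lam_nonneg lam_less])
    also have "(\<Sum>j\<in>UNIV. (norm ((- \<alpha>) *\<^sub>R (ys (Suc t) j \<omega> - ?y)))\<^sup>2) = \<alpha>\<^sup>2 * spread (\<lambda>i. ys (Suc t) i \<omega>)"
      by (simp add: spread_def power_mult_distrib sum_distrib_left)
    finally show ?thesis .
  qed
  then have "x_spread (Suc t) \<le> expectation (\<lambda>\<omega>. (1 + lam\<^sup>2) / 2 * spread (\<lambda>i. xs t i \<omega>)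
      + 2 * lam\<^sup>2 / (1 - lam\<^sup>2) * (\<alpha>\<^sup>2 * spread (\<lambda>i. ys (Suc t) i \<omega>)))"
    unfolding x_spread_def
    by (intro integral_mono Bochner_Integration.integrable_add integrable_mult_right
        spread_xs_integrable spread_ys_integrable)
  then show ?thesis
    unfolding x_spread_def y_spread_def using spread_xs_integrable spread_ys_integrable by simp
qed

text \<open>Pythagoras again: the mean increment is exactly \<open>- \<alpha>\<close> times the
  averaged estimator, and the remainder is a difference of two families of deviations.\<close>

lemma inc_sq_le:
  "inc_sq t \<le> real CARD('n) * \<alpha>\<^sup>2 * v_avg_sq t + 2 * x_spread t + 2 * x_spread (Suc t)"
proof -
  have "(\<Sum>i\<in>UNIV. (norm (inc t i \<omega>))\<^sup>2) \<le> real CARD('n) * \<alpha>\<^sup>2 * (norm (avg (\<lambda>i. vs t i \<omega>)))\<^sup>2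
      + 2 * spread (\<lambda>i. xs t i \<omega>) + 2 * spread (\<lambda>i. xs (Suc t) i \<omega>)" for \<omega>
  proof -
    have "avg (\<lambda>i. inc t i \<omega>) = - (\<alpha> *\<^sub>R avg (\<lambda>i. vs t i \<omega>))"
      by (simp add: avg_diff avg_xs_Suc)
    then show ?thesis
      using spread_diff_le[of "\<lambda>i. xs (Suc t) i \<omega>" "\<lambda>i. xs t i \<omega>"]
      unfolding sum_norm_sq_decomp by (simp add: power_mult_distrib)
  qed
  then have "expectation (\<lambda>\<omega>. \<Sum>i\<in>UNIV. (norm (inc t i \<omega>))\<^sup>2)
    \<le> expectation (\<lambda>\<omega>. real CARD('n) * \<alpha>\<^sup>2 * (norm (avg (\<lambda>i. vs t i \<omega>)))\<^sup>2
      + 2 * spread (\<lambda>i. xs t i \<omega>) + 2 * spread (\<lambda>i. xs (Suc t) i \<omega>))"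
    by (intro integral_mono Bochner_Integration.integrable_add Bochner_Integration.integrable_sum
        integrable_mult_right spread_xs_integrable avg_vs_integrable inc_integrable)
  then show ?thesis
    unfolding inc_sq_def v_avg_sq_def x_spread_def
    using spread_xs_integrable avg_vs_integrable inc_integrable by simp
qed

section \<open>Descent of the global cost\<close>

abbreviation "Fgrad x \<equiv> avg (\<lambda>i. grad i x)"

lemma Fgrad_lipschitz: "norm (Fgrad x - Fgrad y) \<le> L * norm (x - y)"
proof -
  have "(norm (Fgrad x - Fgrad y))\<^sup>2 \<le> (\<Sum>i::'n\<in>UNIV. (norm (grad i x - grad i y))\<^sup>2) / real CARD('n)"
    unfolding avg_diff[symmetric] by (rule norm_avg_sq_le)
  also have "\<dots> \<le> (\<Sum>i::'n\<in>UNIV. (L * norm (x - y))\<^sup>2) / real CARD('n)"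
    by (intro divide_right_mono sum_mono power_mono grad_lipschitz) auto
  also have "\<dots> = (L * norm (x - y))\<^sup>2" by simp
  finally show ?thesis by (rule power2_le_imp_le) (use L_pos in simp)
qed

lemma gradient_global_cost: "gradient (global_cost f) x = Fgrad x"
  by (rule gradient_eqI[OF GDERIV_global_cost[OF f_diff]])

text \<open>Polarization writes the inner product of gradient and averaged estimator through three
  squares. Half of the square of the estimator pays for the smoothness term, as
  \<open>\<alpha> * L \<le> 1 / 2\<close>; the other half survives as the negative term after
  scaling by \<open>4 / \<alpha>\<close>. The 6 is 2 for passing from the nodes to their mean plus 4
  for the bias of the averaged local gradients.\<close>

lemma descent_step:
  assumes "\<alpha> * L \<le> 1 / 2"
  shows "(\<Sum>i\<in>UNIV. (norm (Fgrad (xs t i \<omega>)))\<^sup>2) / real CARD('n)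
    \<le> 4 / \<alpha> * (global_cost f (avg (\<lambda>i. xs t i \<omega>)) - global_cost f (avg (\<lambda>i. xs (Suc t) i \<omega>)))
      + 4 * (norm (avg (\<lambda>i. err t i \<omega>)))\<^sup>2 + 6 * L\<^sup>2 / real CARD('n) * spread (\<lambda>i. xs t i \<omega>)
      - (norm (avg (\<lambda>i. vs t i \<omega>)))\<^sup>2"
proof -
  let ?n = "real CARD('n)"
  let ?x = "avg (\<lambda>i. xs t i \<omega>)" and ?v = "avg (\<lambda>i. vs t i \<omega>)" and ?s = "spread (\<lambda>i. xs t i \<omega>)"
  let ?F = "global_cost f"
  have lip_sq: "(norm (Fgrad (xs t i \<omega>)))\<^sup>2 \<le> 2 * (norm (Fgrad ?x))\<^sup>2 + 2 * L\<^sup>2 * (norm (xs t i \<omega> - ?x))\<^sup>2" for i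
  proof -
    have "(norm (Fgrad (xs t i \<omega>) - Fgrad ?x))\<^sup>2 \<le> (L * norm (xs t i \<omega> - ?x))\<^sup>2"
      by (intro power_mono Fgrad_lipschitz) simp
    then show ?thesis
      using norm_sq_add_le[of "Fgrad ?x" "Fgrad (xs t i \<omega>) - Fgrad ?x"] by (simp add: power_mult_distrib)
  qed
  have "(\<Sum>i\<in>UNIV. (norm (Fgrad (xs t i \<omega>)))\<^sup>2) / ?n
      \<le> (\<Sum>i\<in>UNIV. 2 * (norm (Fgrad ?x))\<^sup>2 + 2 * L\<^sup>2 * (norm (xs t i \<omega> - ?x))\<^sup>2) / ?n"
    by (intro divide_right_mono sum_mono lip_sq) simp
  also have "\<dots> = 2 * (norm (Fgrad ?x))\<^sup>2 + 2 * L\<^sup>2 / ?n * ?s"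
    by (simp add: sum.distrib spread_def sum_distrib_left[symmetric] add_divide_distrib)
  finally have nodes: "(\<Sum>i\<in>UNIV. (norm (Fgrad (xs t i \<omega>)))\<^sup>2) / ?n
      \<le> 2 * (norm (Fgrad ?x))\<^sup>2 + 2 * L\<^sup>2 / ?n * ?s" .
  have dev: "(norm (?v - Fgrad ?x))\<^sup>2 \<le> 2 * (norm (avg (\<lambda>i. err t i \<omega>)))\<^sup>2 + 2 * L\<^sup>2 / ?n * ?s"
  proof -
    have "(norm (avg (\<lambda>i. grad i (xs t i \<omega>) - grad i ?x)))\<^sup>2 \<le> (\<Sum>i\<in>UNIV. (norm (grad i (xs t i \<omega>) - grad i ?x))\<^sup>2) / ?n"
      by (rule norm_avg_sq_le)
    also have "\<dots> \<le> (\<Sum>i\<in>UNIV. (L * norm (xs t i \<omega> - ?x))\<^sup>2) / ?n"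
      by (intro divide_right_mono sum_mono power_mono grad_lipschitz) auto
    also have "\<dots> = L\<^sup>2 / ?n * ?s"
      by (simp add: spread_def power_mult_distrib sum_distrib_left[symmetric])
    finally have "(norm (avg (\<lambda>i. grad i (xs t i \<omega>) - grad i ?x)))\<^sup>2 \<le> L\<^sup>2 / ?n * ?s" .
    moreover have "?v - Fgrad ?x = avg (\<lambda>i. err t i \<omega>) + avg (\<lambda>i. grad i (xs t i \<omega>) - grad i ?x)"
      by (simp add: avg_diff)
    ultimately show ?thesis
      using norm_sq_add_le[of "avg (\<lambda>i. err t i \<omega>)" "avg (\<lambda>i. grad i (xs t i \<omega>) - grad i ?x)"] by simp
  qed
  have "?F (avg (\<lambda>i. xs (Suc t) i \<omega>)) \<le> ?F ?x + Fgrad ?x \<bullet> (- (\<alpha> *\<^sub>R ?v)) + L / 2 * (norm (- (\<alpha> *\<^sub>R ?v)))\<^sup>2"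
    unfolding avg_xs_Suc diff_conv_add_uminus
    by (rule lipschitz_gradient_descent[OF GDERIV_global_cost[OF f_diff] Fgrad_lipschitz])
  also have "\<dots> = ?F ?x - \<alpha> * (Fgrad ?x \<bullet> ?v) + \<alpha> / 2 * ((\<alpha> * L) * (norm ?v)\<^sup>2)"
    by (simp add: power_mult_distrib power2_eq_square)
  also have "\<dots> \<le> ?F ?x - \<alpha> * (Fgrad ?x \<bullet> ?v) + \<alpha> / 2 * (1 / 2 * (norm ?v)\<^sup>2)"
    using \<alpha>_pos assms by (intro add_left_mono mult_left_mono mult_right_mono) auto
  finally have "\<alpha> * (Fgrad ?x \<bullet> ?v - 1 / 4 * (norm ?v)\<^sup>2) \<le> ?F ?x - ?F (avg (\<lambda>i. xs (Suc t) i \<omega>))"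
    by (simp add: algebra_simps)
  then have "Fgrad ?x \<bullet> ?v - 1 / 4 * (norm ?v)\<^sup>2 \<le> (?F ?x - ?F (avg (\<lambda>i. xs (Suc t) i \<omega>))) / \<alpha>"
    using \<alpha>_pos by (simp add: pos_le_divide_eq mult.commute)
  moreover have "(norm (?v - Fgrad ?x))\<^sup>2 = (norm ?v)\<^sup>2 - 2 * (Fgrad ?x \<bullet> ?v) + (norm (Fgrad ?x))\<^sup>2"
    unfolding power2_norm_eq_inner by (simp add: inner_simps inner_commute)
  ultimately have "2 * (norm (Fgrad ?x))\<^sup>2 \<le> 4 * ((?F ?x - ?F (avg (\<lambda>i. xs (Suc t) i \<omega>))) / \<alpha>)
      + 2 * (norm (?v - Fgrad ?x))\<^sup>2 - (norm ?v)\<^sup>2"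
    by linarith
  with nodes dev show ?thesis by simp
qed

lemma sum_expected_gradients_le:
  assumes "\<alpha> * L \<le> 1 / 2" and below: "\<And>x. Fstar \<le> global_cost f x"
  shows "(\<Sum>t\<le>T. \<Sum>i\<in>UNIV. expectation (\<lambda>\<omega>. (norm (Fgrad (xs t i \<omega>)))\<^sup>2)) / real CARD('n)
    \<le> 4 / \<alpha> * (global_cost f x0 - Fstar)
      + (4 * (\<Sum>t\<le>T. avg_err_sq t) + 6 * L\<^sup>2 / real CARD('n) * (\<Sum>t\<le>T. x_spread t) - (\<Sum>t\<le>T. v_avg_sq t))"
proof -
  let ?n = "real CARD('n)"
  let ?R = "\<lambda>t \<omega>. 4 * (norm (avg (\<lambda>i. err t i \<omega>)))\<^sup>2 + 6 * L\<^sup>2 / ?n * spread (\<lambda>i. xs t i \<omega>)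
      - (norm (avg (\<lambda>i. vs t i \<omega>)))\<^sup>2"
  have grad_int: "integrable M (\<lambda>\<omega>. (norm (Fgrad (xs t i \<omega>)))\<^sup>2)" for t i
    by (rule adapted_L2_integrable[OF adapted_L2_avg[OF adapted_L2_grad[OF xs_L2]]])
  have R_int: "integrable M (?R t)" for t
    by (intro Bochner_Integration.integrable_add Bochner_Integration.integrable_diff integrable_mult_right
        avg_err_integrable spread_xs_integrable avg_vs_integrable)
  have path: "(\<Sum>t\<le>T. (\<Sum>i\<in>UNIV. (norm (Fgrad (xs t i \<omega>)))\<^sup>2) / ?n)
      \<le> 4 / \<alpha> * (global_cost f x0 - Fstar) + (\<Sum>t\<le>T. ?R t \<omega>)" for \<omega>
  proof -
    let ?F = "\<lambda>t. global_cost f (avg (\<lambda>i. xs t i \<omega>))"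
    have "(\<Sum>t\<le>T. (\<Sum>i\<in>UNIV. (norm (Fgrad (xs t i \<omega>)))\<^sup>2) / ?n)
        \<le> (\<Sum>t\<le>T. 4 / \<alpha> * (?F t - ?F (Suc t)) + ?R t \<omega>)"
      by (rule sum_mono) (use descent_step[OF assms(1)] in \<open>simp add: algebra_simps\<close>)
    also have "\<dots> = 4 / \<alpha> * (?F 0 - ?F (Suc T)) + (\<Sum>t\<le>T. ?R t \<omega>)"
    proof -
      have "(\<Sum>t\<le>T. ?F t - ?F (Suc t)) = ?F 0 - ?F (Suc T)"
        by (induction T) auto
      then show ?thesis unfolding sum.distrib sum_distrib_left[symmetric] by simp
    qed
    \<comment> \<open>All nodes start at \<open>x0\<close>, so the first cost is deterministic; the
      last one is replaced by its lower bound.\<close>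
    also have "\<dots> \<le> 4 / \<alpha> * (global_cost f x0 - Fstar) + (\<Sum>t\<le>T. ?R t \<omega>)"
      using \<alpha>_pos below by (intro add_right_mono mult_left_mono) auto
    finally show ?thesis .
  qed
  have "expectation (\<lambda>\<omega>. \<Sum>t\<le>T. (\<Sum>i\<in>UNIV. (norm (Fgrad (xs t i \<omega>)))\<^sup>2) / ?n)
      \<le> expectation (\<lambda>\<omega>. 4 / \<alpha> * (global_cost f x0 - Fstar) + (\<Sum>t\<le>T. ?R t \<omega>))"
    by (rule integral_mono[OF _ _ path])
      (intro Bochner_Integration.integrable_add Bochner_Integration.integrable_sum integrable_divide
        grad_int R_int integrable_const)+
  moreover have "expectation (\<lambda>\<omega>. \<Sum>t\<le>T. (\<Sum>i\<in>UNIV. (norm (Fgrad (xs t i \<omega>)))\<^sup>2) / ?n)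
      = (\<Sum>t\<le>T. \<Sum>i\<in>UNIV. expectation (\<lambda>\<omega>. (norm (Fgrad (xs t i \<omega>)))\<^sup>2)) / ?n"
    using grad_int by (simp add: sum_divide_distrib)
  moreover
  have ER: "expectation (?R t) = 4 * avg_err_sq t + 6 * L\<^sup>2 / ?n * x_spread t - v_avg_sq t" for t
    unfolding avg_err_sq_def x_spread_def v_avg_sq_def
    using avg_err_integrable spread_xs_integrable avg_vs_integrable by simp
  have "expectation (\<lambda>\<omega>. 4 / \<alpha> * (global_cost f x0 - Fstar) + (\<Sum>t\<le>T. ?R t \<omega>))
      = 4 / \<alpha> * (global_cost f x0 - Fstar)
      + (4 * (\<Sum>t\<le>T. avg_err_sq t) + 6 * L\<^sup>2 / ?n * (\<Sum>t\<le>T. x_spread t) - (\<Sum>t\<le>T. v_avg_sq t))"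
  proof -
    have "expectation (\<lambda>\<omega>. 4 / \<alpha> * (global_cost f x0 - Fstar) + (\<Sum>t\<le>T. ?R t \<omega>))
        = 4 / \<alpha> * (global_cost f x0 - Fstar) + (\<Sum>t\<le>T. expectation (?R t))"
      using R_int by (simp add: prob_space)
    then show ?thesis unfolding ER sum_subtractf sum.distrib sum_distrib_left .
  qed
  ultimately show ?thesis by simp
qed

end

subsection \<open>The uniformly drawn output\<close>

context gt_hsgd
begin

text \<open>The drawn index takes the place of a fresh sample and the algebra of all samples that of
  the history; integrating over the uniform law leaves a finite average.\<close>

lemma expectation_uniform_output:
  assumes h [measurable]: "h \<in> borel_measurable borel" and nonneg: "\<And>x. 0 \<le> h x"
    and int: "\<And>t i. t \<le> T \<Longrightarrow> integrable M (\<lambda>\<omega>. h (xs t i \<omega>))"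
    and \<tau>: "\<tau> \<in> M \<rightarrow>\<^sub>M count_space UNIV"
    and unif: "distr M (count_space UNIV) \<tau> = measure_pmf (pmf_of_set ({0..T} \<times> UNIV))"
    and ind: "indep_set (sets (vimage_algebra (space M) \<tau> (count_space UNIV)))
          (sets (sample_algebra M \<xi> (sample_index b0)))"
  shows "integrable M (\<lambda>\<omega>. h (xs (fst (\<tau> \<omega>)) (snd (\<tau> \<omega>)) \<omega>)) \<and>
    expectation (\<lambda>\<omega>. h (xs (fst (\<tau> \<omega>)) (snd (\<tau> \<omega>)) \<omega>))
      = (\<Sum>t\<le>T. \<Sum>i\<in>UNIV. expectation (\<lambda>\<omega>. h (xs t i \<omega>))) / (real (Suc T) * real CARD('n))"
proof -
  let ?S = "sample_algebra M \<xi> (sample_index b0)"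
  let ?K = "{0..T} \<times> UNIV :: (nat \<times> 'n) set"
  let ?H = "\<lambda>(\<omega>, k). ennreal (h (xs (fst k) (snd k) \<omega>))"
  have K: "finite ?K" "?K \<noteq> {}" "card ?K = Suc T * CARD('n)" by (auto simp: card_cartesian_product)
  have xs_S [measurable]: "xs t i \<in> borel_measurable ?S" for t i
    using xs_L2 by (intro hist_measurable_sample) (auto simp: adapted_L2_def)
  have sub_S: "subalgebra M ?S" by (rule subalgebra_sample_algebra) simp
  have xs_M [measurable]: "xs t i \<in> borel_measurable M" for t i
    by (rule measurable_from_subalg[OF sub_S xs_S])
  \<comment> \<open>The index set is countable, so joint measurability reduces to fixed
    indices.\<close>
  have H: "?H \<in> borel_measurable (?S \<Otimes>\<^sub>M count_space UNIV)"
  proof -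
    have "(\<lambda>\<omega>. ennreal (h (xs (fst k) (snd k) \<omega>))) \<in> borel_measurable ?S" for k by measurable
    from measurable_compose[OF measurable_fst this]
    have "(\<lambda>z. ennreal (h (xs (fst (snd z)) (snd (snd z)) (fst z)))) \<in> borel_measurable (?S \<Otimes>\<^sub>M count_space UNIV)"
      by (rule measurable_compose_countable[OF _ measurable_snd,
            where f = "\<lambda>k z. ennreal (h (xs (fst k) (snd k) (fst z)))"])
    then show ?thesis by (simp add: split_def)
  qed
  have sub_\<tau>: "subalgebra M (vimage_algebra (space M) \<tau> (count_space UNIV))"
    unfolding subalgebra_def using indep_setD_ev1[OF ind] by simp
  have ind': "indep_set (sets ?S) (sets (vimage_algebra (space M) \<tau> (count_space UNIV)))"
    unfolding indep_sets2_eq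
  proof (intro conjI ballI)
    fix a b assume "a \<in> sets ?S" "b \<in> sets (vimage_algebra (space M) \<tau> (count_space UNIV))"
    then show "prob (a \<inter> b) = prob a * prob b"
      using indep_setD[OF ind, of b a] by (simp add: Int_commute mult.commute)
  qed (rule indep_setD_ev2[OF ind], rule indep_setD_ev1[OF ind])
  have \<tau>': "\<tau> \<in> vimage_algebra (space M) \<tau> (count_space UNIV) \<rightarrow>\<^sub>M count_space UNIV"
    by (rule measurable_vimage_algebra1) auto
  have "(\<integral>\<^sup>+\<omega>. ?H (\<omega>, \<tau> \<omega>) \<partial>M) = (\<integral>\<^sup>+\<omega>. (\<integral>\<^sup>+\<omega>'. ?H (\<omega>, \<tau> \<omega>') \<partial>M) \<partial>M)"
    by (rule nn_integral_indep_subalgebra[OF sub_S sub_\<tau> ind' \<tau>' H])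
  also have "\<dots> = (\<integral>\<^sup>+\<omega>. (\<integral>\<^sup>+k. ?H (\<omega>, k) \<partial>distr M (count_space UNIV) \<tau>) \<partial>M)"
    by (intro nn_integral_cong) (simp add: nn_integral_distr[OF \<tau>])
  also have "\<dots> = (\<integral>\<^sup>+\<omega>. ennreal ((\<Sum>k\<in>?K. h (xs (fst k) (snd k) \<omega>)) / (real (Suc T) * real CARD('n))) \<partial>M)"
  proof (rule nn_integral_cong)
    fix \<omega>
    have "(\<integral>\<^sup>+k. ?H (\<omega>, k) \<partial>measure_pmf (pmf_of_set ?K)) = (\<Sum>k\<in>?K. ?H (\<omega>, k)) / card ?K"
      using K by (intro nn_integral_pmf_of_set) auto
    also have "\<dots> = ennreal (\<Sum>k\<in>?K. h (xs (fst k) (snd k) \<omega>)) / ennreal (real (card ?K))"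
      using nonneg by (simp add: sum_ennreal ennreal_of_nat_eq_real_of_nat)
    also have "\<dots> = ennreal ((\<Sum>k\<in>?K. h (xs (fst k) (snd k) \<omega>)) / real (card ?K))"
    proof (rule divide_ennreal)
      have "0 < card ?K" unfolding K(3) by simp
      then show "0 < real (card ?K)" by (simp only: of_nat_0_less_iff)
    qed (intro sum_nonneg nonneg)
    finally show "(\<integral>\<^sup>+k. ?H (\<omega>, k) \<partial>distr M (count_space UNIV) \<tau>)
        = ennreal ((\<Sum>k\<in>?K. h (xs (fst k) (snd k) \<omega>)) / (real (Suc T) * real CARD('n)))"
      unfolding unif K(3) of_nat_mult by simp
  qed
  finally have eq: "(\<integral>\<^sup>+\<omega>. ennreal (h (xs (fst (\<tau> \<omega>)) (snd (\<tau> \<omega>)) \<omega>)) \<partial>M)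
      = (\<integral>\<^sup>+\<omega>. ennreal ((\<Sum>k\<in>?K. h (xs (fst k) (snd k) \<omega>)) / (real (Suc T) * real CARD('n))) \<partial>M)"
    by simp
  have b_int: "integrable M (\<lambda>\<omega>. (\<Sum>k\<in>?K. h (xs (fst k) (snd k) \<omega>)) / (real (Suc T) * real CARD('n)))"
    by (intro integrable_divide Bochner_Integration.integrable_sum int) auto
  have E: "expectation (\<lambda>\<omega>. (\<Sum>k\<in>?K. h (xs (fst k) (snd k) \<omega>)) / (real (Suc T) * real CARD('n)))
      = (\<Sum>t\<le>T. \<Sum>i\<in>UNIV. expectation (\<lambda>\<omega>. h (xs t i \<omega>))) / (real (Suc T) * real CARD('n))"
  proof -
    have "expectation (\<lambda>\<omega>. \<Sum>k\<in>?K. h (xs (fst k) (snd k) \<omega>)) = (\<Sum>k\<in>?K. expectation (\<lambda>\<omega>. h (xs (fst k) (snd k) \<omega>)))"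
      by (intro Bochner_Integration.integral_sum int) auto
    then show ?thesis by (simp add: sum.cartesian_product split_def atLeast0AtMost)
  qed
  have out_M: "(\<lambda>\<omega>. h (xs (fst (\<tau> \<omega>)) (snd (\<tau> \<omega>)) \<omega>)) \<in> borel_measurable M"
    by (rule measurable_compose_countable[OF _ \<tau>, where f = "\<lambda>k \<omega>. h (xs (fst k) (snd k) \<omega>)"]) measurable
  have b_nonneg: "0 \<le> (\<Sum>k\<in>?K. h (xs (fst k) (snd k) \<omega>)) / (real (Suc T) * real CARD('n))" for \<omega>
    using nonneg by (intro divide_nonneg_nonneg sum_nonneg) auto
  \<comment> \<open>The comparison lemma yields only an inequality; as the two nonnegative integrals
    agree, it is applied in both directions.\<close>
  have 1: "integrable M (\<lambda>\<omega>. h (xs (fst (\<tau> \<omega>)) (snd (\<tau> \<omega>)) \<omega>)) \<and>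
    expectation (\<lambda>\<omega>. h (xs (fst (\<tau> \<omega>)) (snd (\<tau> \<omega>)) \<omega>))
      \<le> expectation (\<lambda>\<omega>. (\<Sum>k\<in>?K. h (xs (fst k) (snd k) \<omega>)) / (real (Suc T) * real CARD('n)))"
    by (intro expectation_le_of_nn_integral_le out_M b_int nonneg b_nonneg) (simp add: eq)
  have 2: "expectation (\<lambda>\<omega>. (\<Sum>k\<in>?K. h (xs (fst k) (snd k) \<omega>)) / (real (Suc T) * real CARD('n)))
      \<le> expectation (\<lambda>\<omega>. h (xs (fst (\<tau> \<omega>)) (snd (\<tau> \<omega>)) \<omega>))"
    by (intro conjunct2[OF expectation_le_of_nn_integral_le] borel_measurable_integrable[OF b_int]
        nonneg b_nonneg conjunct1[OF 1]) (simp add: eq)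
  show ?thesis using 1 2 unfolding E by simp
qed

end

text \<open>At \<open>lam = 0\<close> the quotient is infinite and bounds nothing, but the
  inequality cleared of denominators stays true, hence its form.\<close>

lemma step_size_bound_le:
  assumes "0 < L" "0 \<le> lam" "0 < \<alpha>" "ereal \<alpha> < step_size_bound n lam L"
  shows "\<alpha> * L \<le> 1 / (4 * sqrt 3)" and "90 * lam\<^sup>2 * (\<alpha> * L) \<le> (1 - lam\<^sup>2)\<^sup>2"
proof -
  have bound: "ereal (\<alpha> * L) \<le> c" if "min a (min b c') \<le> c" "step_size_bound n lam L = min a (min b c') * ereal (1 / L)" for a b c c'
  proof -
    have "ereal \<alpha> \<le> c * ereal (1 / L)"
      using assms that by (metis ereal_mult_right_mono less_imp_le order_trans ereal_less_eq(5) zero_le_divide_1_iff)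
    then have "ereal \<alpha> * ereal L \<le> (c * ereal (1 / L)) * ereal L"
      using assms by (intro ereal_mult_right_mono) auto
    also have "\<dots> = c" using assms by (simp add: mult.assoc)
    finally show ?thesis by simp
  qed
  have "ereal (\<alpha> * L) \<le> ereal (1 / (4 * sqrt 3))"
    by (rule bound[OF _ step_size_bound_def]) (simp add: min.coboundedI2)
  then show "\<alpha> * L \<le> 1 / (4 * sqrt 3)" by simp
  have "ereal (\<alpha> * L) \<le> ereal ((1 - lam\<^sup>2)\<^sup>2) / ereal (90 * lam\<^sup>2)"
    by (rule bound[OF _ step_size_bound_def]) simp
  then show "90 * lam\<^sup>2 * (\<alpha> * L) \<le> (1 - lam\<^sup>2)\<^sup>2"
    by (cases "lam = 0") (auto simp: field_simps)
qed

theorem theorem1: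
  fixes M :: "'w measure"
    and f :: "'n::finite \<Rightarrow> real^'p \<Rightarrow> real"
    and g :: "'n \<Rightarrow> real^'p \<Rightarrow> real^'q \<Rightarrow> real^'p"
    and \<xi> :: "nat \<Rightarrow> nat \<Rightarrow> 'n \<Rightarrow> 'w \<Rightarrow> real^'q"
    and \<nu> :: "'n \<Rightarrow> real"
    and W :: "real^'n^'n"
    and x0 :: "real^'p"
    and L \<alpha> \<beta> lam Fstar \<nu>bar2 n :: real
    and b0 T :: nat
    and \<tau> :: "'w \<Rightarrow> nat \<times> 'n"
    and xout :: "'w \<Rightarrow> real^'p"
  assumes "prob_space M"
    and n_def: "n = real CARD('n)"
    and f_diff: "\<And>i x. f i differentiable (at x)"
    and "L > 0" and "\<And>i. \<nu> i \<ge> 0" and "b0 \<ge> 1"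
    and g_borel: "\<And>i. (\<lambda>(x, s). g i x s) \<in> borel \<Otimes>\<^sub>M borel \<rightarrow>\<^sub>M borel"
    and unbiased: "\<And>t r i. (t, r, i) \<in> sample_index b0 \<Longrightarrow>
          unbiased_oracle M (history M b0 \<xi> t) (f i) (g i) (\<xi> t r i)"
    and variance: "\<And>t r i. (t, r, i) \<in> sample_index b0 \<Longrightarrow>
          bounded_variance_oracle M (history M b0 \<xi> t) (f i) (g i) (\<nu> i) (\<xi> t r i)"
    and smooth: "\<And>t r i. (t, r, i) \<in> sample_index b0 \<Longrightarrow>
          mean_square_smooth_oracle M (history M b0 \<xi> t) (g i) L (\<xi> t r i)"
    and indep: "prob_space.indep_vars M (\<lambda>_. borel) (\<lambda>(t, r, i). \<xi> t r i) (sample_index b0)"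
    and \<nu>bar2_def: "\<nu>bar2 = (1 / n) * (\<Sum>i\<in>UNIV. (\<nu> i)\<^sup>2)"
    and F_below: "bdd_below (range (global_cost f))"
    and Fstar_def: "Fstar = (INF x. global_cost f x)"
    and "primitive_matrix W" and "doubly_stochastic W"
    and lam_def: "lam = mixing_rate W" and "lam \<in> {0..<1}"
    and \<beta>_def: "\<beta> = 48 * L\<^sup>2 * \<alpha>\<^sup>2 / n"
    and \<alpha>_bounds: "0 < \<alpha>" "ereal \<alpha> < step_size_bound CARD('n) lam L"
    and "T \<ge> 2"
    and \<tau>_meas: "\<tau> \<in> M \<rightarrow>\<^sub>M count_space UNIV"
    and \<tau>_unif: "distr M (count_space UNIV) \<tau> = measure_pmf (pmf_of_set ({0..T} \<times> UNIV))"
    and \<tau>_indep: "prob_space.indep_set M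
          (sets (vimage_algebra (space M) \<tau> (count_space UNIV)))
          (sets (sample_algebra M \<xi> (sample_index b0)))"
    and xout_def: "\<And>\<omega>. xout \<omega> =
          hsgd_x W g \<alpha> \<beta> b0 x0 (\<lambda>t r i. \<xi> t r i \<omega>) (fst (\<tau> \<omega>)) (snd (\<tau> \<omega>))"
  shows "integrable M (\<lambda>\<omega>. (norm (gradient (global_cost f) (xout \<omega>)))\<^sup>2) \<and>
    prob_space.expectation M (\<lambda>\<omega>. (norm (gradient (global_cost f) (xout \<omega>)))\<^sup>2)
      \<le> 4 * (global_cost f x0 - Fstar) / (\<alpha> * real T)
        + 8 * \<beta> * \<nu>bar2 / n
        + 4 * \<nu>bar2 / (\<beta> * real b0 * n * real T)
        + 64 * lam^4 * (\<Sum>i\<in>UNIV. (norm (gradient (f i) x0))\<^sup>2) / ((1 - lam\<^sup>2)^3 * n * real T)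
        + 96 * lam\<^sup>2 * \<nu>bar2 / ((1 - lam\<^sup>2)^3 * real b0 * real T)
        + 256 * lam\<^sup>2 * \<beta>\<^sup>2 * \<nu>bar2 / (1 - lam\<^sup>2)^3"
proof -
  interpret prob_space M by fact
  have n: "1 \<le> n" unfolding n_def by (simp add: Suc_leI)
  note step = step_size_bound_le[OF \<open>L > 0\<close> _ \<alpha>_bounds]
  have lam: "0 \<le> lam" "lam < 1" using \<open>lam \<in> {0..<1}\<close> by auto
  have \<alpha>L: "\<alpha> * L \<le> 1 / (4 * sqrt 3)" and lam_step: "90 * lam\<^sup>2 * (\<alpha> * L) \<le> (1 - lam\<^sup>2)\<^sup>2"
    using step[OF lam(1)] by auto
  have sq: "48 * (\<alpha> * L)\<^sup>2 \<le> 1"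
  proof -
    have "(\<alpha> * L)\<^sup>2 \<le> (1 / (4 * sqrt 3))\<^sup>2" using \<alpha>L \<alpha>_bounds \<open>L > 0\<close> by (intro power_mono) auto
    then show ?thesis by (simp add: power_divide power_mult_distrib)
  qed
  have half: "\<alpha> * L \<le> 1 / 2"
    by (rule power2_le_imp_le) (use sq in \<open>simp_all add: power_divide\<close>)
  have \<beta>: "0 < \<beta>" "\<beta> \<le> 1"
  proof -
    show "0 < \<beta>" unfolding \<beta>_def using \<open>L > 0\<close> \<alpha>_bounds n by simp
    have "48 * L\<^sup>2 * \<alpha>\<^sup>2 \<le> n" using sq n by (simp add: power_mult_distrib mult_ac)
    then show "\<beta> \<le> 1" unfolding \<beta>_def using n by simp
  qed
  interpret gt_hsgd M f g \<xi> \<nu> L b0 W \<alpha> \<beta> lam x0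
    by unfold_locales (use assms lam \<beta> in auto)
  define gr where "gr = (\<Sum>i\<in>UNIV. (norm (gradient (f i) x0))\<^sup>2)"
  define m where "m = lam\<^sup>2"
  define q where "q = 1 - m"
  have m: "0 \<le> m" "m < 1" unfolding m_def using lam by (auto simp: power_less_one_iff)
  have q: "0 < q" using m by (simp add: q_def)
  have b: "real b0 > 0" using \<open>b0 \<ge> 1\<close> by simp
  have T: "real T > 0" using \<open>T \<ge> 2\<close> by simp
  have S: "total_var = n * \<nu>bar2" "0 \<le> total_var"
    unfolding total_var_def \<nu>bar2_def using n by (auto simp: sum_nonneg)
  have below: "Fstar \<le> global_cost f x" for x
    unfolding Fstar_def by (rule cINF_lower[OF F_below]) simp
  have budget: "4 * (\<Sum>t\<le>T. avg_err_sq t) + 6 * L\<^sup>2 / n * (\<Sum>t\<le>T. x_spread t) - (\<Sum>t\<le>T. v_avg_sq t)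
    \<le> 4 * total_var / (\<beta> * b0 * n\<^sup>2) + 8 * \<beta> * total_var * real T / n\<^sup>2 + 64 * m\<^sup>2 * gr / (q ^ 3 * n)
      + 96 * m * total_var / (q ^ 3 * b0 * n) + 256 * m * \<beta>\<^sup>2 * total_var * real T / (q ^ 3 * n)"
  proof (rule hsgd_error_budget[where E = err_sq and G = inc_sq and Y = y_spread and \<alpha> = \<alpha>])
    show "0 \<le> gr" unfolding gr_def by (simp add: sum_nonneg)
    show "0 \<le> x_spread t" "0 \<le> avg_err_sq t" "0 \<le> err_sq t" "0 \<le> inc_sq t" "0 \<le> v_avg_sq t" "0 \<le> y_spread t" for t
      unfolding x_spread_def avg_err_sq_def err_sq_def inc_sq_def v_avg_sq_def y_spread_def
      by (auto intro!: sum_nonneg integral_nonneg_AE simp: spread_nonneg)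
  qed (use n b m q lam_step \<alpha>L \<alpha>_bounds \<open>L > 0\<close> S \<beta>_def q_def x_spread_0 x_spread_Suc avg_err_sq_0 avg_err_sq_Suc
      err_sq_0 err_sq_Suc inc_sq_le y_spread_1 y_spread_Suc in \<open>simp_all add: m_def gr_def n_def q_def\<close>)
  define R where "R = 4 / \<alpha> * (global_cost f x0 - Fstar)
    + (4 * total_var / (\<beta> * b0 * n\<^sup>2) + 8 * \<beta> * total_var * real T / n\<^sup>2 + 64 * m\<^sup>2 * gr / (q ^ 3 * n)
      + 96 * m * total_var / (q ^ 3 * b0 * n) + 256 * m * \<beta>\<^sup>2 * total_var * real T / (q ^ 3 * n))"
  let ?h = "\<lambda>x. (norm (Fgrad x))\<^sup>2"
  let ?Z = "(\<Sum>t\<le>T. \<Sum>i\<in>UNIV. expectation (\<lambda>\<omega>. ?h (xs t i \<omega>))) / n"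
  have Z_le: "?Z \<le> R"
    using sum_expected_gradients_le[OF half below, of T] budget unfolding R_def n_def by linarith
  have Z_nonneg: "0 \<le> ?Z" using n by (intro divide_nonneg_nonneg sum_nonneg) auto
  have h_meas: "?h \<in> borel_measurable borel" unfolding avg_def by measurable
  have out: "integrable M (\<lambda>\<omega>. ?h (xout \<omega>)) \<and> expectation (\<lambda>\<omega>. ?h (xout \<omega>))
      = (\<Sum>t\<le>T. \<Sum>i\<in>UNIV. expectation (\<lambda>\<omega>. ?h (xs t i \<omega>))) / (real (Suc T) * real CARD('n))"
    unfolding xout_def
    by (rule expectation_uniform_output[OF h_meas _ _ \<tau>_meas \<tau>_unif \<tau>_indep])
      (auto intro: adapted_L2_integrable[OF adapted_L2_avg[OF adapted_L2_grad[OF xs_L2]]])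
  have "expectation (\<lambda>\<omega>. ?h (xout \<omega>)) = ?Z / real (Suc T)"
    using out by (simp add: n_def mult.commute)
  \<comment> \<open>The output is drawn from \<open>T + 1\<close> times; dividing by
    \<open>T\<close> only enlarges the bound because \<open>?Z\<close> is nonnegative.\<close>
  also have "\<dots> \<le> ?Z / real T" using Z_nonneg T by (intro divide_left_mono) auto
  also have "\<dots> \<le> R / real T" using Z_le T by (intro divide_right_mono) auto
  also have "R / real T = 4 * (global_cost f x0 - Fstar) / (\<alpha> * real T)
        + 8 * \<beta> * \<nu>bar2 / n
        + 4 * \<nu>bar2 / (\<beta> * real b0 * n * real T)
        + 64 * m\<^sup>2 * gr / (q ^ 3 * n * real T)
        + 96 * m * \<nu>bar2 / (q ^ 3 * real b0 * real T)
        + 256 * m * \<beta>\<^sup>2 * \<nu>bar2 / q ^ 3"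
  proof -
    \<comment> \<open>The sum of the variances is \<open>n\<close> times their mean, which cancels
      one power of \<open>n\<close>; the terms growing linearly in \<open>T\<close> lose that
      factor.\<close>
    have "4 * total_var / (\<beta> * b0 * n\<^sup>2) / T = 4 * \<nu>bar2 / (\<beta> * real b0 * n * real T)"
      "8 * \<beta> * total_var * real T / n\<^sup>2 / T = 8 * \<beta> * \<nu>bar2 / n"
      "96 * m * total_var / (q ^ 3 * b0 * n) / T = 96 * m * \<nu>bar2 / (q ^ 3 * real b0 * real T)"
      "256 * m * \<beta>\<^sup>2 * total_var * real T / (q ^ 3 * n) / T = 256 * m * \<beta>\<^sup>2 * \<nu>bar2 / q ^ 3"
      unfolding S(1) using n T by (simp_all add: power2_eq_square)
    then show ?thesis unfolding R_def add_divide_distrib by (simp add: mult.commute)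
  qed
  finally have "expectation (\<lambda>\<omega>. ?h (xout \<omega>)) \<le> 4 * (global_cost f x0 - Fstar) / (\<alpha> * real T)
        + 8 * \<beta> * \<nu>bar2 / n
        + 4 * \<nu>bar2 / (\<beta> * real b0 * n * real T)
        + 64 * m\<^sup>2 * gr / (q ^ 3 * n * real T)
        + 96 * m * \<nu>bar2 / (q ^ 3 * real b0 * real T)
        + 256 * m * \<beta>\<^sup>2 * \<nu>bar2 / q ^ 3" .
  then show ?thesis
    using out unfolding gradient_global_cost m_def q_def gr_def by simp
qed

end
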